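(* Let $T$ be a nonempty separable metric space and let $X=\{X(t),\,t\in T\}$ be a separable, bounded, centered Gaussian process with values in $\mathbb{R}^d$. Let $(X_i)_{i\ge 1}$ be a sequence of i.i.d. copies of $X$. Put $W_n=\mathrm{conv}\{X_1(t),\ldots,X_n(t),\ t\in T\}$ and $W=\mathrm{conv}\{K_t,\ t\in T\}$, where $K_t$ is the ellipsoid of concentration of $X(t)$. 1) With probability 1, $\frac{1}{\sqrt{2\ln n}}W_n\to W$ in $\mathcal{K}^d$ as $n\to\infty$, i.e. $\rho\left(\frac{1}{\sqrt{2\ln n}}W_n,\,W\right)\to 0$. 2) If moreover $T$ is compact and $X$ is continuous, then almost surely $$\rho\left(\frac{1}{\sqrt{2\ln n}}W_n,\,W\right)=o\left(\frac{1}{\sqrt{\ln n}}\right),\qquad n\to\infty.$$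
   Context: $\mathcal{K}^d$ is the space of nonempty compact convex subsets of $\mathbb{R}^d$ with the Hausdorff distance $\rho(A,B)=\max\{\inf\{\epsilon>0: A\subset B^\epsilon\},\ \inf\{\epsilon>0: B\subset A^\epsilon\}\}$, where $A^\epsilon$ is the open $\epsilon$-neighbourhood of $A$ in the Euclidean norm. For $S\subset\mathbb{R}^d$, $\mathrm{conv}\,S$ denotes the closed convex hull of $S$; $\mathrm{conv}\{K_t,\ t\in T\}$ is the closed convex hull of $\bigcup_{t\in T}K_t$, and $\mathrm{conv}\{X_1(t),\ldots,X_n(t),\ t\in T\}$ is the closed convex hull of $\{X_i(t): 1\le i\le n,\ t\in T\}$. The process $X$ is Gaussian centered if all its finite-dimensional distributions are (jointly) Gaussian with mean zero. It is bounded if $\sup_{t\in T}|X(t)|<\infty$ almost surely, and continuous if almost surely its paths are continuous on $T$. It is separable if there are a countable set $T_0\subset T$ and a null event outside of which, for every $t\in T$, there is a sequence $(t_k)$ in $T_0$ with $t_k\to t$ and $X(t_k)\to X(t)$. The copies $X_i$ are independent processes with the same law as $X$, and they are taken with the same path properties (separability, boundedness and, in part 2, continuity). $R_t$ is the covariance matrix of $X(t)$. The ellipsoid of concentration of $X(t)$ is $K_t=\{x\in\mathbb{R}^d: \langle R_t^{-1}x,x\rangle\le 1\}$ when $R_t$ is invertible; for general (possibly degenerate) $R_t$ it is $K_t=\{R_t^{1/2}y: y\in\mathbb{R}^d,\ |y|\le 1\}$, which agrees with the preceding formula in the invertible case. *)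

theory Defs
  imports "HOL-Probability.Probability" "HOL-Library.Landau_Symbols"
begin

definition convex_bodies :: "'a::euclidean_space set set" where
  "convex_bodies = {A. A \<noteq> {} \<and> compact A \<and> convex A}"

definition nbhd :: "'a::metric_space set \<Rightarrow> real \<Rightarrow> 'a set" where
  "nbhd A \<epsilon> = (\<Union>a\<in>A. ball a \<epsilon>)"

text \<open>Meaningful for nonempty bounded sets; otherwise an infimum may be taken over the
  empty set.\<close>

definition hausdorff_distance :: "'a::metric_space set \<Rightarrow> 'a set \<Rightarrow> real" where
  "hausdorff_distance A B =
     max (Inf {\<epsilon>. \<epsilon> > 0 \<and> A \<subseteq> nbhd B \<epsilon>}) (Inf {\<epsilon>. \<epsilon> > 0 \<and> B \<subseteq> nbhd A \<epsilon>})"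

definition closed_convex_hull :: "'a::euclidean_space set \<Rightarrow> 'a set" where
  "closed_convex_hull S = closure (convex hull S)"

definition centered_gaussian_rv :: "'w measure \<Rightarrow> ('w \<Rightarrow> real) \<Rightarrow> bool" where
  "centered_gaussian_rv M Z \<longleftrightarrow> Z \<in> borel_measurable M \<and>
     ((AE \<omega> in M. Z \<omega> = 0) \<or> (\<exists>\<sigma>>0. distributed M lborel Z (normal_density 0 \<sigma>)))"

text \<open>Finitely many random vectors are jointly Gaussian (possibly degenerate) and centered iff all
  their real linear combinations are centered Gaussian.\<close>

definition centered_gaussian_process ::
    "'w measure \<Rightarrow> 't set \<Rightarrow> ('t \<Rightarrow> 'w \<Rightarrow> 'a::euclidean_space) \<Rightarrow> bool" where
  "centered_gaussian_process M T X \<longleftrightarrow>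
     (\<forall>t\<in>T. X t \<in> borel_measurable M) \<and>
     (\<forall>F a. finite F \<and> F \<subseteq> T \<longrightarrow> centered_gaussian_rv M (\<lambda>\<omega>. \<Sum>t\<in>F. a t \<bullet> X t \<omega>))"

definition bounded_process ::
    "'w measure \<Rightarrow> 't set \<Rightarrow> ('t \<Rightarrow> 'w \<Rightarrow> 'a::real_normed_vector) \<Rightarrow> bool" where
  "bounded_process M T X \<longleftrightarrow> (AE \<omega> in M. bounded ((\<lambda>t. X t \<omega>) ` T))"

definition continuous_process ::
    "'w measure \<Rightarrow> 't::topological_space set \<Rightarrow> ('t \<Rightarrow> 'w \<Rightarrow> 'a::topological_space) \<Rightarrow> bool" where
  "continuous_process M T X \<longleftrightarrow> (AE \<omega> in M. continuous_on T (\<lambda>t. X t \<omega>))"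

definition separable_process ::
    "'w measure \<Rightarrow> 't::topological_space set \<Rightarrow> ('t \<Rightarrow> 'w \<Rightarrow> 'a::topological_space) \<Rightarrow> bool" where
  "separable_process M T X \<longleftrightarrow>
     (\<exists>T0. countable T0 \<and> T0 \<subseteq> T \<and>
       (AE \<omega> in M. \<forall>t\<in>T. \<exists>s. (\<forall>k. s k \<in> T0) \<and> s \<longlonglongrightarrow> t \<and> (\<lambda>k. X (s k) \<omega>) \<longlonglongrightarrow> X t \<omega>))"

definition process_space :: "'t set \<Rightarrow> ('t \<Rightarrow> 'a::topological_space) measure" where
  "process_space T = (\<Pi>\<^sub>M t\<in>T. borel)"

definition sample_path :: "'t set \<Rightarrow> ('t \<Rightarrow> 'w \<Rightarrow> 'a) \<Rightarrow> 'w \<Rightarrow> 't \<Rightarrow> 'a" where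
  "sample_path T X \<omega> = (\<lambda>t\<in>T. X t \<omega>)"

definition process_law ::
    "'w measure \<Rightarrow> 't set \<Rightarrow> ('t \<Rightarrow> 'w \<Rightarrow> 'a::topological_space) \<Rightarrow> ('t \<Rightarrow> 'a) measure" where
  "process_law M T X = distr M (process_space T) (sample_path T X)"

text \<open>The copies are indexed from 1 and may live on another probability space than the
  original process.\<close>

definition iid_copies ::
    "'v measure \<Rightarrow> 't set \<Rightarrow> (nat \<Rightarrow> 't \<Rightarrow> 'v \<Rightarrow> 'a::topological_space)
      \<Rightarrow> 'w measure \<Rightarrow> ('t \<Rightarrow> 'w \<Rightarrow> 'a) \<Rightarrow> bool" where
  "iid_copies N T Y M X \<longleftrightarrow>
     prob_space.indep_vars N (\<lambda>_. process_space T) (\<lambda>i. sample_path T (Y i)) {1..} \<and>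
     (\<forall>i\<ge>1. process_law N T (Y i) = process_law M T X)"

definition covariance_matrix :: "'w measure \<Rightarrow> ('w \<Rightarrow> real ^ 'd) \<Rightarrow> real ^ 'd ^ 'd" where
  "covariance_matrix M V = (\<chi> i j. \<integral>\<omega>. (V \<omega> $ i - (\<integral>\<omega>'. V \<omega>' $ i \<partial>M)) *
                                       (V \<omega> $ j - (\<integral>\<omega>'. V \<omega>' $ j \<partial>M)) \<partial>M)"

definition pos_semidef :: "real ^ 'd ^ 'd \<Rightarrow> bool" where
  "pos_semidef A \<longleftrightarrow> transpose A = A \<and> (\<forall>x. (A *v x) \<bullet> x \<ge> 0)"

text \<open>The description is proper, by existence and uniqueness of the square root, whenever
  the argument is positive semidefinite.\<close>

definition matrix_sqrt :: "real ^ 'd ^ 'd \<Rightarrow> real ^ 'd ^ 'd" where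
  "matrix_sqrt A = (THE S. pos_semidef S \<and> S ** S = A)"

definition concentration_ellipsoid :: "'w measure \<Rightarrow> ('w \<Rightarrow> real ^ 'd) \<Rightarrow> (real ^ 'd) set" where
  "concentration_ellipsoid M V = (\<lambda>y. matrix_sqrt (covariance_matrix M V) *v y) ` cball 0 1"

definition process_hull ::
    "'t set \<Rightarrow> (nat \<Rightarrow> 't \<Rightarrow> 'v \<Rightarrow> 'a::euclidean_space) \<Rightarrow> nat \<Rightarrow> 'v \<Rightarrow> 'a set" where
  "process_hull T Y n \<omega> = closed_convex_hull {Y i t \<omega> | i t. i \<in> {1..n} \<and> t \<in> T}"

definition limit_body ::
    "'w measure \<Rightarrow> 't set \<Rightarrow> ('t \<Rightarrow> 'w \<Rightarrow> real ^ 'd) \<Rightarrow> (real ^ 'd) set" where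
  "limit_body M T X = closed_convex_hull (\<Union>t\<in>T. concentration_ellipsoid M (X t))"

text \<open>For \<open>n = 1\<close> the factor is \<open>1 / 0 = 0\<close>, which is irrelevant for the asymptotics.\<close>

definition scaled_hull ::
    "'t set \<Rightarrow> (nat \<Rightarrow> 't \<Rightarrow> 'v \<Rightarrow> 'a::euclidean_space) \<Rightarrow> nat \<Rightarrow> 'v \<Rightarrow> 'a set" where
  "scaled_hull T Y n \<omega> = (\<lambda>x. (1 / sqrt (2 * ln (real n))) *\<^sub>R x) ` process_hull T Y n \<omega>"

end

theory Submission
  imports Defs "HOL-Real_Asymp.Real_Asymp"
begin

text \<open>Let \<open>p u = sup\<^sub>t sd \<langle>X t, u\<rangle>\<close>, the support function of \<open>W\<close>, and \<open>s\<^sub>n = sqrt (2 ln n)\<close>. Everything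
  reduces to comparing \<open>max\<^sub>i\<^sub>\<le>\<^sub>n sup\<^sub>t \<langle>X\<^sub>i t, u\<rangle>\<close> with \<open>s\<^sub>n p u\<close>, uniformly over unit vectors \<open>u\<close>, up to \<open>O(1)\<close>
  for the first part and up to \<open>o(1)\<close> for the second.

  The upper bound rests on the Borell-TIS inequality \<open>P(sup Z > m + v) \<le> exp (- v\<^sup>2 / 2)\<close>, where \<open>Z\<close> has
  variances at most 1 and \<open>m\<close> bounds the expected finite maxima. It is applied to the variables
  \<open>\<langle>X t, u\<rangle> / p u\<close>, and Borel-Cantelli gives the bound \<open>s\<^sub>n + m + \<epsilon>\<close>. If \<open>T\<close> is compact and \<open>X\<close> is continuous,
  the index set splits into finitely many pieces on each of which \<open>m\<close> is as small as desired.

  The Borell-TIS inequality with the sharp constant is obtained from a random walk argument: the Gaussian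
  vector is a sum of \<open>k\<close> independent copies of itself scaled by \<open>1 / sqrt k\<close>, and a step of size \<open>1 / sqrt k\<close>
  multiplies the Laplace transform of a smooth approximation of the maximum by at most
  \<open>exp (\<theta>\<^sup>2 / (2 k) + O(k powr (- 3 / 2)))\<close>.

  The lower bound is a union bound over a grid of directions, using independence and the Gaussian tail.\<close>

section \<open>Centred Gaussian variables\<close>

text \<open>Errors must be additive rather than proportional to \<open>s\<^sub>n\<close>, and this
  forces the sharp constant: at \<open>v = s\<^sub>n + \<epsilon>\<close> the tail bound equals
  \<open>exp (- \<epsilon> * s\<^sub>n - \<epsilon>\<^sup>2 / 2) / n\<close>, just summable, whereas
  a worse constant would move the level by a factor. Division by \<open>s\<^sub>n\<close> then turns
  an error O(1) into convergence and o(1) into the rate. The quotient by \<open>p u\<close> breaks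
  down where \<open>p\<close> vanishes. It is taken on the orthogonal complement of the zero space
  of \<open>p\<close>, where \<open>p\<close> is a norm with compact unit sphere. No moment of the
  supremum is known at the start: boundedness gives only a level respected with probability at least
  1/2. Variances and expected maxima are bounded from such a quantile, the latter by the lower tail
  of the concentration inequality. Laws are compared on the product sigma-algebra, so events involve
  countably many indices; separability enters as the extension of closed constraints from a
  countable set of times to \<open>T\<close>.\<close>

lemma cgrv_measurable: "centered_gaussian_rv M Z \<Longrightarrow> Z \<in> borel_measurable M"
  by (simp add: centered_gaussian_rv_def)

lemma prob_space_std_normal: "prob_space std_normal_distribution"
  by (rule prob_space_normal_density) simp

lemma integral_std_normal_square:
  "integrable std_normal_distribution (\<lambda>x. x\<^sup>2)" "(\<integral>x. x\<^sup>2 \<partial>std_normal_distribution) = 1"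
  using integrable_std_normal_moment[of 2] integral_std_normal_moment_even[of 1]
  by (simp_all add: integrable_density integral_density)

lemma integral_std_normal_mean:
  "integrable std_normal_distribution (\<lambda>x. x)" "(\<integral>x. x \<partial>std_normal_distribution) = 0"
  using integrable_std_normal_moment[of 1] integral_std_normal_moment_odd[of 0]
  by (simp_all add: integrable_density integral_density)

lemma integrable_std_normal_exp: "integrable std_normal_distribution (\<lambda>x. exp (c * x))"
proof -
  have "std_normal_density x * exp (c * x) = exp (c\<^sup>2 / 2) * normal_density c 1 x" for x
    by (simp add: normal_density_def power2_eq_square field_simps flip: exp_add)
  then show ?thesis
    by (simp add: integrable_density)
qed

text \<open>One representation covers the degenerate and the nondegenerate case: a standard normal
  variable multiplied by a standard deviation that may be 0. Integrals and probabilities of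
  \<open>Z\<close> then refer to one fixed density.\<close>

lemma cgrv_distr:
  assumes M: "prob_space M" and Z: "centered_gaussian_rv M Z"
  shows "distr M borel Z = distr std_normal_distribution borel (\<lambda>x. sqrt (\<integral>\<omega>. (Z \<omega>)\<^sup>2 \<partial>M) * x)"
proof -
  interpret M: prob_space M by fact
  interpret S: prob_space std_normal_distribution by (rule prob_space_std_normal)
  have Zm[measurable]: "Z \<in> borel_measurable M" using Z by (rule cgrv_measurable)
  obtain \<sigma> where \<sigma>: "\<sigma> \<ge> 0" "distr M borel Z = distr std_normal_distribution borel (\<lambda>x. \<sigma> * x)"
  proof (cases "AE \<omega> in M. Z \<omega> = 0")
    case True
    have "distr M borel Z = distr M borel (\<lambda>_. 0)"
      by (rule distr_cong_AE) (use True in auto)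
    also have "\<dots> = distr std_normal_distribution borel (\<lambda>x. 0 * x)"
      by (rule measure_eqI) (auto simp: emeasure_distr M.emeasure_space_1 S.emeasure_space_1[simplified] vimage_def)
    finally show ?thesis by (intro that[of 0]) auto
  next
    case False
    then obtain \<sigma> where \<sigma>: "\<sigma> > 0" "distributed M lborel Z (normal_density 0 \<sigma>)"
      using Z by (auto simp: centered_gaussian_rv_def)
    then have "distributed M lborel (\<lambda>x. Z x / \<sigma>) std_normal_density"
      using M.normal_standard_normal_convert[of \<sigma> Z 0] by simp
    then have "distr M lborel (\<lambda>x. Z x / \<sigma>) = std_normal_distribution"
      by (simp add: distributed_def)
    then have "distr std_normal_distribution borel (\<lambda>x. \<sigma> * x) = distr (distr M lborel (\<lambda>x. Z x / \<sigma>)) borel (\<lambda>x. \<sigma> * x)"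
      by simp
    also have "\<dots> = distr M borel Z"
      using \<sigma> by (subst distr_distr) (auto simp: comp_def)
    finally show ?thesis using \<sigma> by (intro that[of \<sigma>]) auto
  qed
  \<comment> \<open>The scale \<open>\<sigma>\<close> was obtained without a formula; the second
    moment of the law just found identifies it.\<close>
  have "(\<integral>\<omega>. (Z \<omega>)\<^sup>2 \<partial>M) = (\<integral>x. x\<^sup>2 \<partial>distr M borel Z)"
    by (simp add: integral_distr)
  also have "\<dots> = (\<integral>x. (\<sigma> * x)\<^sup>2 \<partial>std_normal_distribution)"
    unfolding \<sigma> by (simp add: integral_distr)
  also have "\<dots> = \<sigma>\<^sup>2"
    by (simp add: power_mult_distrib integral_std_normal_square)
  finally show ?thesis using \<sigma> by simp
qed

lemma cgrv_integral:
  fixes f :: "real \<Rightarrow> 'b::{banach, second_countable_topology}"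
  assumes M: "prob_space M" and Z: "centered_gaussian_rv M Z" and [measurable]: "f \<in> borel_measurable borel"
  shows "integrable M (\<lambda>\<omega>. f (Z \<omega>)) \<longleftrightarrow> integrable std_normal_distribution (\<lambda>x. f (sqrt (\<integral>\<omega>. (Z \<omega>)\<^sup>2 \<partial>M) * x))"
    and "(\<integral>\<omega>. f (Z \<omega>) \<partial>M) = (\<integral>x. f (sqrt (\<integral>\<omega>. (Z \<omega>)\<^sup>2 \<partial>M) * x) \<partial>std_normal_distribution)"
proof -
  have Zm[measurable]: "Z \<in> borel_measurable M" using Z by (rule cgrv_measurable)
  show "integrable M (\<lambda>\<omega>. f (Z \<omega>)) \<longleftrightarrow> integrable std_normal_distribution (\<lambda>x. f (sqrt (\<integral>\<omega>. (Z \<omega>)\<^sup>2 \<partial>M) * x))"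
    using cgrv_distr[OF M Z] integrable_distr_eq[of Z M borel f]
      integrable_distr_eq[of "\<lambda>x. sqrt (\<integral>\<omega>. (Z \<omega>)\<^sup>2 \<partial>M) * x" std_normal_distribution borel f] by simp
  show "(\<integral>\<omega>. f (Z \<omega>) \<partial>M) = (\<integral>x. f (sqrt (\<integral>\<omega>. (Z \<omega>)\<^sup>2 \<partial>M) * x) \<partial>std_normal_distribution)"
    using cgrv_distr[OF M Z] integral_distr[of Z M borel f]
      integral_distr[of "\<lambda>x. sqrt (\<integral>\<omega>. (Z \<omega>)\<^sup>2 \<partial>M) * x" std_normal_distribution borel f] by simp
qed

lemma cgrv_prob:
  assumes M: "prob_space M" and Z: "centered_gaussian_rv M Z" and [measurable]: "A \<in> sets borel"
  shows "measure M {\<omega>\<in>space M. Z \<omega> \<in> A} = measure std_normal_distribution {x. sqrt (\<integral>\<omega>. (Z \<omega>)\<^sup>2 \<partial>M) * x \<in> A}"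
proof -
  have Zm[measurable]: "Z \<in> borel_measurable M" using Z by (rule cgrv_measurable)
  have "measure (distr M borel Z) A = measure (distr std_normal_distribution borel (\<lambda>x. sqrt (\<integral>\<omega>. (Z \<omega>)\<^sup>2 \<partial>M) * x)) A"
    by (simp add: cgrv_distr[OF M Z])
  then show ?thesis
    by (simp add: measure_distr vimage_def Int_def conj_commute)
qed

lemma cgrv_integrable_exp:
  assumes "prob_space M" "centered_gaussian_rv M Z"
  shows "integrable M (\<lambda>\<omega>. exp (c * Z \<omega>))"
  using cgrv_integral(1)[OF assms, of "\<lambda>x. exp (c * x)"] integrable_std_normal_exp[of "c * sqrt (\<integral>\<omega>. (Z \<omega>)\<^sup>2 \<partial>M)"]
  by (simp add: mult.assoc)

lemma cgrv_mean:
  assumes "prob_space M" "centered_gaussian_rv M Z"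
  shows "integrable M Z" "(\<integral>\<omega>. Z \<omega> \<partial>M) = 0"
proof -
  let ?v = "\<integral>\<omega>. (Z \<omega>)\<^sup>2 \<partial>M"
  have "integrable std_normal_distribution (\<lambda>x. sqrt ?v * x)"
    by (intro integrable_mult_right integral_std_normal_mean)
  then show "integrable M Z"
    by (rule cgrv_integral(1)[OF assms, of "\<lambda>x. x", THEN iffD2, rotated]) simp
  have "(\<integral>\<omega>. Z \<omega> \<partial>M) = (\<integral>x. sqrt ?v * x \<partial>std_normal_distribution)"
    by (rule cgrv_integral(2)[OF assms]) simp
  also have "\<dots> = sqrt ?v * (\<integral>x. x \<partial>std_normal_distribution)"
    by (rule integral_mult_right_zero)
  finally show "(\<integral>\<omega>. Z \<omega> \<partial>M) = 0"
    by (simp only: integral_std_normal_mean mult_zero_right)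
qed

lemma cgrv_integrable_square:
  assumes "prob_space M" "centered_gaussian_rv M Z"
  shows "integrable M (\<lambda>\<omega>. (Z \<omega>)\<^sup>2)"
proof -
  have "integrable std_normal_distribution (\<lambda>x. (sqrt (\<integral>\<omega>. (Z \<omega>)\<^sup>2 \<partial>M))\<^sup>2 * x\<^sup>2)"
    by (intro integrable_mult_right integral_std_normal_square)
  then show ?thesis
    by (intro cgrv_integral(1)[OF assms, THEN iffD2]) (simp_all only: power_mult_distrib, simp)
qed

lemma cgrv_char:
  assumes M: "prob_space M" and Z: "centered_gaussian_rv M Z"
  shows "(\<integral>\<omega>. iexp (t * Z \<omega>) \<partial>M) = exp (- (t\<^sup>2 * (\<integral>\<omega>. (Z \<omega>)\<^sup>2 \<partial>M) / 2))"
proof -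
  have nn: "(\<integral>\<omega>. (Z \<omega>)\<^sup>2 \<partial>M) \<ge> 0" by simp
  have "(\<integral>\<omega>. iexp (t * Z \<omega>) \<partial>M) = char std_normal_distribution (t * sqrt (\<integral>\<omega>. (Z \<omega>)\<^sup>2 \<partial>M))"
    by (subst cgrv_integral(2)[OF assms, of "\<lambda>x. iexp (t * x)"]) (simp_all add: char_def mult.assoc)
  also have "\<dots> = exp (- (t\<^sup>2 * (\<integral>\<omega>. (Z \<omega>)\<^sup>2 \<partial>M) / 2))"
    using nn by (simp add: char_std_normal_distribution power_mult_distrib flip: exp_of_real of_real_power)
  finally show ?thesis .
qed

lemma cgrv_variance_zero:
  assumes M: "prob_space M" and Z: "centered_gaussian_rv M Z" and 0: "(\<integral>\<omega>. (Z \<omega>)\<^sup>2 \<partial>M) = 0"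
  shows "AE \<omega> in M. Z \<omega> = 0"
  using integral_nonneg_eq_0_iff_AE[OF cgrv_integrable_square[OF M Z]] 0 by simp

text \<open>The interval has length \<open>2 * a\<close>, and the density is at most 1/2 because
  \<open>2 * pi\<close> exceeds 4.\<close>

lemma std_normal_prob_interval_le:
  assumes "a \<ge> 0" shows "measure std_normal_distribution {-a..a} \<le> a"
proof -
  have "measure std_normal_distribution {-a..a} = (\<integral>x. indicator {-a..a} x \<partial>std_normal_distribution)"
    by simp
  also have "\<dots> = (\<integral>x. std_normal_density x * indicator {-a..a} x \<partial>lborel)"
    by (subst integral_density) auto
  also have "\<dots> \<le> (\<integral>x. (1/2) * indicator {-a..a} x \<partial>lborel)"
  proof (rule integral_mono)
    show "integrable lborel (\<lambda>x. std_normal_density x * indicator {-a..a} x)"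
      by (rule integrable_real_mult_indicator) auto
    show "integrable lborel (\<lambda>x. (1/2::real) * indicator {-a..a} x)"
      by (intro integrable_mult_right integrable_real_indicator) (auto simp: emeasure_lborel_Icc_eq)
    fix x :: real
    have "2 \<le> sqrt (2 * pi)" using pi_gt3 by (intro real_le_rsqrt) simp
    then have "(1 / sqrt (2 * pi)) * exp (- x\<^sup>2 / 2) \<le> (1/2) * 1"
      by (intro mult_mono) (auto simp: divide_simps)
    then show "std_normal_density x * indicator {-a..a} x \<le> (1/2) * indicator {-a..a} x"
      by (auto simp: std_normal_density_def split: split_indicator)
  qed
  also have "\<dots> = a" using assms by simp
  finally show ?thesis .
qed

text \<open>If the standard deviation \<open>\<sigma>\<close> exceeded
  \<open>2 * \<epsilon>\<close>, the event would have probability at most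
  \<open>\<epsilon> / \<sigma> < 1/2\<close>. This turns a bound in probability into a variance
  bound before any moment of a supremum is known.\<close>

lemma cgrv_sd_le_median:
  assumes M: "prob_space M" and Z: "centered_gaussian_rv M Z" and "\<epsilon> > 0"
    and P: "measure M {\<omega>\<in>space M. \<bar>Z \<omega>\<bar> \<le> \<epsilon>} \<ge> 1/2"
  shows "sqrt (\<integral>\<omega>. (Z \<omega>)\<^sup>2 \<partial>M) \<le> 2 * \<epsilon>"
proof (rule ccontr)
  define \<sigma> where "\<sigma> = sqrt (\<integral>\<omega>. (Z \<omega>)\<^sup>2 \<partial>M)"
  assume "\<not> ?thesis"
  then have "\<sigma> > 2 * \<epsilon>" by (simp add: \<sigma>_def)
  with \<open>\<epsilon> > 0\<close> have \<sigma>: "\<sigma> > 2 * \<epsilon>" "\<sigma> > 0" by linarith+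
  have "measure M {\<omega>\<in>space M. \<bar>Z \<omega>\<bar> \<le> \<epsilon>} = measure M {\<omega>\<in>space M. Z \<omega> \<in> {-\<epsilon>..\<epsilon>}}"
    by (rule arg_cong[where f="measure M"]) auto
  also have "\<dots> = measure std_normal_distribution {x. \<sigma> * x \<in> {-\<epsilon>..\<epsilon>}}"
    unfolding \<sigma>_def by (rule cgrv_prob[OF M Z]) auto
  also have "{x. \<sigma> * x \<in> {-\<epsilon>..\<epsilon>}} = {-(\<epsilon>/\<sigma>)..\<epsilon>/\<sigma>}"
    using \<sigma> by (auto simp: field_simps)
  also have "measure std_normal_distribution \<dots> \<le> \<epsilon> / \<sigma>"
    using \<sigma> \<open>\<epsilon> > 0\<close> by (intro std_normal_prob_interval_le) auto
  also have "\<dots> < 1/2" using \<sigma> by (simp add: field_simps)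
  finally show False using P by simp
qed

text \<open>The density decreases on the positive half line, so a rectangle of width
  \<open>b - a\<close> and height the density at \<open>b\<close> fits under its graph.\<close>

lemma std_normal_tail_ge:
  assumes "0 \<le> a" "a \<le> b"
  shows "measure std_normal_distribution {a..} \<ge> (b - a) * std_normal_density b"
proof -
  interpret S: prob_space std_normal_distribution by (rule prob_space_std_normal)
  have "(b - a) * std_normal_density b = (\<integral>x. std_normal_density b * indicator {a..b} x \<partial>lborel)"
    using assms by simp
  also have "\<dots> \<le> (\<integral>x. std_normal_density x * indicator {a..b} x \<partial>lborel)"
  proof (rule integral_mono)
    show "integrable lborel (\<lambda>x. std_normal_density x * indicator {a..b} x)"
      by (rule integrable_real_mult_indicator) auto
    show "integrable lborel (\<lambda>x. std_normal_density b * indicator {a..b} x)"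
      by (intro integrable_mult_right integrable_real_indicator) (auto simp: emeasure_lborel_Icc_eq)
    fix x :: real
    have "std_normal_density b \<le> std_normal_density x" if "x \<in> {a..b}"
      using that assms by (auto simp: std_normal_density_def intro!: divide_right_mono power_mono)
    then show "std_normal_density b * indicator {a..b} x \<le> std_normal_density x * indicator {a..b} x"
      by (auto split: split_indicator)
  qed
  also have "\<dots> = (\<integral>x. indicator {a..b} x \<partial>std_normal_distribution)"
    by (subst integral_density) auto
  also have "\<dots> = measure std_normal_distribution {a..b}"
    by simp
  also have "\<dots> \<le> measure std_normal_distribution {a..}"
    by (intro S.finite_measure_mono) auto
  finally show ?thesis .
qed

text \<open>The bound is uniform over all standard deviations up to \<open>K\<close>, zero included:
  lowering the level by \<open>\<epsilon>\<close> lowers it by at least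
  \<open>\<epsilon> / K\<close> on the standardised scale.\<close>

lemma cgrv_tail_ge:
  assumes M: "prob_space M" and Z: "centered_gaussian_rv M Z" and "0 < \<epsilon>" "0 < K" "\<epsilon> / K \<le> s"
    and K: "sqrt (\<integral>\<omega>. (Z \<omega>)\<^sup>2 \<partial>M) \<le> K"
  shows "measure M {\<omega>\<in>space M. Z \<omega> \<ge> s * sqrt (\<integral>\<omega>. (Z \<omega>)\<^sup>2 \<partial>M) - \<epsilon>}
           \<ge> \<epsilon> / (2 * K) * std_normal_density (s - \<epsilon> / (2 * K))"
proof -
  interpret S: prob_space std_normal_distribution by (rule prob_space_std_normal)
  define \<sigma> where "\<sigma> = sqrt (\<integral>\<omega>. (Z \<omega>)\<^sup>2 \<partial>M)"
  have \<sigma>: "0 \<le> \<sigma>" "\<sigma> \<le> K" using K by (auto simp: \<sigma>_def)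
  \<comment> \<open>Half of the gap \<open>\<epsilon> / K\<close> is the width of the rectangle; the
    other half is kept as a gain in the density.\<close>
  have "\<epsilon> / (2 * K) = (s - \<epsilon> / (2 * K)) - (s - \<epsilon> / K)" by (simp add: field_simps)
  then have "\<epsilon> / (2 * K) * std_normal_density (s - \<epsilon> / (2 * K)) \<le> measure std_normal_distribution {s - \<epsilon> / K..}"
    using assms std_normal_tail_ge[of "s - \<epsilon> / K" "s - \<epsilon> / (2 * K)"] by (simp add: field_simps)
  also have "\<dots> \<le> measure std_normal_distribution {x. \<sigma> * x \<in> {s * \<sigma> - \<epsilon>..}}"
  proof (rule S.finite_measure_mono)
    show "{s - \<epsilon> / K..} \<subseteq> {x. \<sigma> * x \<in> {s * \<sigma> - \<epsilon>..}}"
    proof safe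
      fix x assume "x \<ge> s - \<epsilon> / K"
      then have "\<sigma> * x \<ge> \<sigma> * (s - \<epsilon> / K)" using \<sigma> by (intro mult_left_mono) auto
      moreover have "\<sigma> * (\<epsilon> / K) \<le> K * (\<epsilon> / K)" using \<sigma> assms by (intro mult_right_mono) auto
      ultimately show "\<sigma> * x \<ge> s * \<sigma> - \<epsilon>" using assms by (simp add: algebra_simps)
    qed
  qed simp
  also have "\<dots> = measure M {\<omega>\<in>space M. Z \<omega> \<in> {s * \<sigma> - \<epsilon>..}}"
    unfolding \<sigma>_def by (rule cgrv_prob[OF M Z, symmetric]) auto
  finally show ?thesis by (simp add: \<sigma>_def)
qed

section \<open>Finite families are determined by their linear combinations\<close>

text \<open>The weight \<open>w\<close> is signed; \<open>2 + w\<close> is not, and after normalisation it turns the hypothesis into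
  an equality of characteristic functions of probability measures.\<close>

lemma weighted_law_eq_real:
  fixes Y :: "'a \<Rightarrow> real" and Y' :: "'b \<Rightarrow> real" and w :: "'a \<Rightarrow> real" and w' :: "'b \<Rightarrow> real"
  assumes M: "prob_space M" "prob_space M'"
    and [measurable]: "Y \<in> borel_measurable M" "Y' \<in> borel_measurable M'"
    and [measurable]: "w \<in> borel_measurable M" "w' \<in> borel_measurable M'"
    and w: "\<And>\<omega>. \<bar>w \<omega>\<bar> \<le> 1" "\<And>\<omega>. \<bar>w' \<omega>\<bar> \<le> 1"
    and char: "\<And>t. (\<integral>\<omega>. iexp (t * Y \<omega>) \<partial>M) = (\<integral>\<omega>. iexp (t * Y' \<omega>) \<partial>M')"
    and wchar: "\<And>t. (\<integral>\<omega>. w \<omega> * iexp (t * Y \<omega>) \<partial>M) = (\<integral>\<omega>. w' \<omega> * iexp (t * Y' \<omega>) \<partial>M')"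
    and A[measurable]: "A \<in> sets borel"
  shows "(\<integral>\<omega>. w \<omega> * indicator A (Y \<omega>) \<partial>M) = (\<integral>\<omega>. w' \<omega> * indicator A (Y' \<omega>) \<partial>M')"
proof -
  interpret M: prob_space M by fact
  interpret M': prob_space M' by fact
  \<comment> \<open>The case \<open>t = 0\<close> says that both weights have the same integral, so
    one normalising constant \<open>c\<close> serves both spaces.\<close>
  have "(\<integral>\<omega>. w \<omega> * iexp (0 * Y \<omega>) \<partial>M) = (\<integral>\<omega>. w' \<omega> * iexp (0 * Y' \<omega>) \<partial>M')" by (rule wchar)
  then have mass: "(\<integral>\<omega>. w \<omega> \<partial>M) = (\<integral>\<omega>. w' \<omega> \<partial>M')" by simp
  define c where "c = 2 + (\<integral>\<omega>. w \<omega> \<partial>M)"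
  have iw: "integrable M w" by (rule M.integrable_const_bound[of _ 1]) (use w in auto)
  have c: "c \<ge> 1"
  proof -
    have "(\<integral>\<omega>. - 1 \<partial>M) \<le> (\<integral>\<omega>. w \<omega> \<partial>M)"
      by (rule integral_mono) (use iw w in \<open>auto simp: abs_le_iff minus_le_iff\<close>)
    then show ?thesis by (simp add: c_def M.prob_space)
  qed
  \<comment> \<open>Proved for an arbitrary probability space so that it applies on both sides: the
    density \<open>(2 + w) / c\<close> yields a genuine law whose characteristic function is built
    from the two given integrals.\<close>
  have dist: "real_distribution (distr (density M (\<lambda>\<omega>. ennreal ((2 + w \<omega>) / c))) borel Y) \<and>
      (\<forall>t. char (distr (density M (\<lambda>\<omega>. ennreal ((2 + w \<omega>) / c))) borel Y) t =
          (2 * (\<integral>\<omega>. iexp (t * Y \<omega>) \<partial>M) + (\<integral>\<omega>. w \<omega> * iexp (t * Y \<omega>) \<partial>M)) / c) \<and>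
      measure (distr (density M (\<lambda>\<omega>. ennreal ((2 + w \<omega>) / c))) borel Y) A =
         (2 * (\<integral>\<omega>. indicator A (Y \<omega>) \<partial>M) + (\<integral>\<omega>. w \<omega> * indicator A (Y \<omega>) \<partial>M)) / c"
    if M: "prob_space M" and [measurable]: "Y \<in> borel_measurable M" "w \<in> borel_measurable M"
      and w: "\<And>\<omega>. \<bar>w \<omega>\<bar> \<le> 1" and c: "c \<ge> 1" "c = 2 + (\<integral>\<omega>. w \<omega> \<partial>M)"
    for M :: "'c measure" and Y :: "'c \<Rightarrow> real" and w and c
  proof -
    interpret K: prob_space M by fact
    have iw: "integrable M w" by (rule K.integrable_const_bound[of _ 1]) (use w in auto)
    have wl: "2 + w \<omega> \<ge> 0" for \<omega> using w[of \<omega>] by (simp add: abs_le_iff)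
    let ?D = "density M (\<lambda>\<omega>. ennreal ((2 + w \<omega>) / c))"
    have "emeasure ?D (space M) = ennreal (\<integral>\<omega>. (2 + w \<omega>) / c \<partial>M)"
    proof -
      have "(\<integral>\<^sup>+ x. ennreal ((2 + w x) / c) \<partial>M) = ennreal (\<integral>\<omega>. (2 + w \<omega>) / c \<partial>M)"
        using c wl iw by (intro nn_integral_eq_integral) auto
      then show ?thesis
        by (subst emeasure_density) (auto simp: nn_integral_cong[of M "\<lambda>x. f x * indicator (space M) x" f for f])
    qed
    also have "\<dots> = 1"
      using c iw by (simp add: K.prob_space)
    finally have pD: "prob_space ?D" by (intro prob_spaceI) simp
    then interpret D: prob_space ?D .
    have rd: "real_distribution (distr ?D borel Y)"
      by (intro D.real_distribution_distr) simp
    have ch: "char (distr ?D borel Y) t =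
          (2 * (\<integral>\<omega>. iexp (t * Y \<omega>) \<partial>M) + (\<integral>\<omega>. w \<omega> * iexp (t * Y \<omega>) \<partial>M)) / c" for t
    proof -
      have i1: "integrable M (\<lambda>\<omega>. iexp (t * Y \<omega>))" by (rule K.integrable_const_bound[of _ 1]) auto
      have i2: "integrable M (\<lambda>\<omega>. w \<omega> * iexp (t * Y \<omega>))"
        by (rule K.integrable_const_bound[of _ 1]) (auto simp: norm_mult w)
      have "char (distr ?D borel Y) t = (\<integral>\<omega>. iexp (t * Y \<omega>) \<partial>?D)"
        unfolding char_def by (subst integral_distr) auto
      also have "\<dots> = (\<integral>\<omega>. ((2 + w \<omega>) / c) *\<^sub>R iexp (t * Y \<omega>) \<partial>M)"
        using c wl by (subst integral_density) auto
      also have "\<dots> = (\<integral>\<omega>. (2 * iexp (t * Y \<omega>) + w \<omega> * iexp (t * Y \<omega>)) / c \<partial>M)"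
        by (intro Bochner_Integration.integral_cong) (auto simp: scaleR_conv_of_real field_simps)
      also have "\<dots> = (2 * (\<integral>\<omega>. iexp (t * Y \<omega>) \<partial>M) + (\<integral>\<omega>. w \<omega> * iexp (t * Y \<omega>) \<partial>M)) / c"
        using i1 i2 by simp
      finally show ?thesis .
    qed
    have "measure (distr ?D borel Y) A = (\<integral>x. indicator A x \<partial>distr ?D borel Y)"
      by (simp)
    also have "\<dots> = (\<integral>\<omega>. indicator A (Y \<omega>) \<partial>?D)" by (subst integral_distr) auto
    also have "\<dots> = (\<integral>\<omega>. ((2 + w \<omega>) / c) *\<^sub>R indicator A (Y \<omega>) \<partial>M)"
      using c wl by (subst integral_density) auto
    also have "\<dots> = (\<integral>\<omega>. (2 * indicator A (Y \<omega>) + w \<omega> * indicator A (Y \<omega>)) / c \<partial>M)"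
      by (intro Bochner_Integration.integral_cong) (auto simp: field_simps)
    also have "\<dots> = (2 * (\<integral>\<omega>. indicator A (Y \<omega>) \<partial>M) + (\<integral>\<omega>. w \<omega> * indicator A (Y \<omega>) \<partial>M)) / c"
    proof -
      have "integrable M (\<lambda>\<omega>. indicator A (Y \<omega>) :: real)" 
        by (rule K.integrable_const_bound[of _ 1]) (auto split: split_indicator)
      moreover have "integrable M (\<lambda>\<omega>. w \<omega> * indicator A (Y \<omega>))"
        by (rule K.integrable_const_bound[of _ 1]) (auto simp: w split: split_indicator)
      ultimately show ?thesis by simp
    qed
    finally show ?thesis using rd ch by blast
  qed
  have c': "c = 2 + (\<integral>\<omega>. w' \<omega> \<partial>M')" by (simp add: c_def mass)
  let ?P = "distr (density M (\<lambda>\<omega>. ennreal ((2 + w \<omega>) / c))) borel Y"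
  let ?P' = "distr (density M' (\<lambda>\<omega>. ennreal ((2 + w' \<omega>) / c))) borel Y'"
  have D1: "distr M borel Y = distr M' borel Y'"
    by (rule Levy_uniqueness) (auto intro!: M.real_distribution_distr M'.real_distribution_distr
        simp: char_def integral_distr char[simplified] fun_eq_iff)
  have eqI: "(\<integral>\<omega>. indicator A (Y \<omega>) \<partial>M) = ((\<integral>\<omega>. indicator A (Y' \<omega>) \<partial>M') :: real)"
    using integral_distr[of Y M borel "indicator A :: real \<Rightarrow> real"]
      integral_distr[of Y' M' borel "indicator A :: real \<Rightarrow> real"] D1 by simp
  note d = dist[OF M(1) assms(3,5) w(1) c c_def] and d' = dist[OF M(2) assms(4,6) w(2) c c']
  have "?P = ?P'"
    by (rule Levy_uniqueness) (use d d' in \<open>auto simp: char[simplified] wchar[simplified] fun_eq_iff\<close>)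
  then have "measure ?P A = measure ?P' A" by simp
  then show ?thesis
    using d d' eqI c by (simp add: field_simps)
qed

text \<open>Real and imaginary parts of the weight are treated separately. Their Fourier integrals
  combine those of \<open>w\<close> and of its conjugate, and the latter are conjugates of the
  former at \<open>- t\<close>.\<close>

lemma weighted_law_eq:
  fixes Y :: "'a \<Rightarrow> real" and Y' :: "'b \<Rightarrow> real" and w :: "'a \<Rightarrow> complex" and w' :: "'b \<Rightarrow> complex"
  assumes M: "prob_space M" "prob_space M'"
    and [measurable]: "Y \<in> borel_measurable M" "Y' \<in> borel_measurable M'"
    and [measurable]: "w \<in> borel_measurable M" "w' \<in> borel_measurable M'"
    and w: "\<And>\<omega>. norm (w \<omega>) \<le> 1" "\<And>\<omega>. norm (w' \<omega>) \<le> 1"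
    and char: "\<And>t. (\<integral>\<omega>. iexp (t * Y \<omega>) \<partial>M) = (\<integral>\<omega>. iexp (t * Y' \<omega>) \<partial>M')"
    and wchar: "\<And>t. (\<integral>\<omega>. w \<omega> * iexp (t * Y \<omega>) \<partial>M) = (\<integral>\<omega>. w' \<omega> * iexp (t * Y' \<omega>) \<partial>M')"
    and A[measurable]: "A \<in> sets borel"
  shows "(\<integral>\<omega>. w \<omega> * indicator A (Y \<omega>) \<partial>M) = (\<integral>\<omega>. w' \<omega> * indicator A (Y' \<omega>) \<partial>M')"
proof -
  interpret M: prob_space M by fact
  interpret M': prob_space M' by fact
  have i: "integrable M (\<lambda>\<omega>. w \<omega> * iexp (t * Y \<omega>))" for t
    by (rule M.integrable_const_bound[of _ 1]) (auto simp: norm_mult w)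
  have i': "integrable M' (\<lambda>\<omega>. w' \<omega> * iexp (t * Y' \<omega>))" for t
    by (rule M'.integrable_const_bound[of _ 1]) (auto simp: norm_mult w)
  have ia: "integrable M (\<lambda>\<omega>. w \<omega> * indicator A (Y \<omega>))"
    by (rule M.integrable_const_bound[of _ 1]) (auto simp: norm_mult w split: split_indicator)
  have ia': "integrable M' (\<lambda>\<omega>. w' \<omega> * indicator A (Y' \<omega>))"
    by (rule M'.integrable_const_bound[of _ 1]) (auto simp: norm_mult w split: split_indicator)
  have cc: "cnj (iexp (- t * y)) = iexp (t * y)" for t y :: real
    by (simp add: exp_cnj)
  have cnjI: "(\<integral>\<omega>. cnj (w \<omega>) * iexp (t * Y \<omega>) \<partial>M) = cnj (\<integral>\<omega>. w \<omega> * iexp (- t * Y \<omega>) \<partial>M)" for t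
    by (simp only: Bochner_Integration.integral_cnj[symmetric] complex_cnj_mult cc)
  have cnjI': "(\<integral>\<omega>. cnj (w' \<omega>) * iexp (t * Y' \<omega>) \<partial>M') = cnj (\<integral>\<omega>. w' \<omega> * iexp (- t * Y' \<omega>) \<partial>M')" for t
    by (simp only: Bochner_Integration.integral_cnj[symmetric] complex_cnj_mult cc)
  have [measurable]: "(\<lambda>\<omega>. cnj (w \<omega>)) \<in> borel_measurable M" "(\<lambda>\<omega>. cnj (w' \<omega>)) \<in> borel_measurable M'"
    by (auto intro!: borel_measurable_continuous_on[of cnj, unfolded comp_def] continuous_intros)
  have j: "integrable M (\<lambda>\<omega>. cnj (w \<omega>) * iexp (t * Y \<omega>))" for t
    by (rule M.integrable_const_bound[of _ 1]) (auto simp: norm_mult w)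
  have j': "integrable M' (\<lambda>\<omega>. cnj (w' \<omega>) * iexp (t * Y' \<omega>))" for t
    by (rule M'.integrable_const_bound[of _ 1]) (auto simp: norm_mult w)
  have R: "(\<integral>\<omega>. Re (w \<omega>) * iexp (t * Y \<omega>) \<partial>M) = (\<integral>\<omega>. Re (w' \<omega>) * iexp (t * Y' \<omega>) \<partial>M')" for t
  proof -
    have e: "of_real (Re z) * x = (z * x + cnj z * x) / 2" for z x :: complex
      by (simp add: complex_add_cnj flip: distrib_right)
    show ?thesis
      unfolding e using i[of t] i'[of t] j[of t] j'[of t] wchar[of t] cnjI[of t] cnjI'[of t] wchar[of "-t"] by simp
  qed
  have I: "(\<integral>\<omega>. Im (w \<omega>) * iexp (t * Y \<omega>) \<partial>M) = (\<integral>\<omega>. Im (w' \<omega>) * iexp (t * Y' \<omega>) \<partial>M')" for t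
  proof -
    have e: "of_real (Im z) * x = (z * x - cnj z * x) / (2 * \<i>)" for z x :: complex
    proof -
      have "z * x - cnj z * x = (z - cnj z) * x" by (simp only: left_diff_distrib)
      also have "\<dots> = (2 * \<i>) * (of_real (Im z) * x)" by (simp add: complex_diff_cnj)
      finally have "z * x - cnj z * x = (2 * \<i>) * (of_real (Im z) * x)" .
      then show ?thesis by simp
    qed
    show ?thesis
      unfolding e using i[of t] i'[of t] j[of t] j'[of t] wchar[of t] cnjI[of t] cnjI'[of t] wchar[of "-t"] by simp
  qed
  have bR: "\<bar>Re (w \<omega>)\<bar> \<le> 1" "\<bar>Im (w \<omega>)\<bar> \<le> 1" for \<omega>
    using w(1)[of \<omega>] abs_Re_le_cmod[of "w \<omega>"] abs_Im_le_cmod[of "w \<omega>"] by linarith+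
  have bR': "\<bar>Re (w' \<omega>)\<bar> \<le> 1" "\<bar>Im (w' \<omega>)\<bar> \<le> 1" for \<omega>
    using w(2)[of \<omega>] abs_Re_le_cmod[of "w' \<omega>"] abs_Im_le_cmod[of "w' \<omega>"] by linarith+
  have "Re (w \<omega> * indicator A (Y \<omega>)) = Re (w \<omega>) * indicator A (Y \<omega>)" "Im (w \<omega> * indicator A (Y \<omega>)) = Im (w \<omega>) * indicator A (Y \<omega>)" for \<omega>
    by (auto split: split_indicator)
  moreover have "Re (w' \<omega> * indicator A (Y' \<omega>)) = Re (w' \<omega>) * indicator A (Y' \<omega>)" "Im (w' \<omega> * indicator A (Y' \<omega>)) = Im (w' \<omega>) * indicator A (Y' \<omega>)" for \<omega>
    by (auto split: split_indicator)
  ultimately show ?thesis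
    using weighted_law_eq_real[OF M assms(3,4) _ _ bR(1) bR'(1) char R A]
      weighted_law_eq_real[OF M assms(3,4) _ _ bR(2) bR'(2) char I A]
    by (intro complex_eqI) (simp_all add: integral_Re[OF ia, symmetric] integral_Re[OF ia', symmetric]
      integral_Im[OF ia, symmetric] integral_Im[OF ia', symmetric])
qed

text \<open>The proof introduces the indicators of a box one coordinate at a time, keeping the exponential of
  an arbitrary linear combination as a weight, so that only the one-dimensional uniqueness theorem is
  needed.\<close>

lemma finite_family_law_eq:
  fixes Z :: "'i \<Rightarrow> 'a \<Rightarrow> real" and Z' :: "'i \<Rightarrow> 'b \<Rightarrow> real"
  assumes M: "prob_space M" "prob_space M'" and F: "finite F"
    and Z[measurable]: "\<And>i. i \<in> F \<Longrightarrow> Z i \<in> borel_measurable M" "\<And>i. i \<in> F \<Longrightarrow> Z' i \<in> borel_measurable M'"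
    and char: "\<And>c. (\<integral>\<omega>. iexp (\<Sum>i\<in>F. c i * Z i \<omega>) \<partial>M) = (\<integral>\<omega>. iexp (\<Sum>i\<in>F. c i * Z' i \<omega>) \<partial>M')"
  shows "distr M (\<Pi>\<^sub>M i\<in>F. borel) (\<lambda>\<omega>. \<lambda>i\<in>F. Z i \<omega>) = distr M' (\<Pi>\<^sub>M i\<in>F. borel) (\<lambda>\<omega>. \<lambda>i\<in>F. Z' i \<omega>)"
proof -
  interpret M: prob_space M by fact
  interpret M': prob_space M' by fact
  have boxes: "(\<integral>\<omega>. (\<Prod>i\<in>G. indicator (A i) (Z i \<omega>)) * iexp (\<Sum>i\<in>F. c i * Z i \<omega>) \<partial>M)
      = (\<integral>\<omega>. (\<Prod>i\<in>G. indicator (A i) (Z' i \<omega>)) * iexp (\<Sum>i\<in>F. c i * Z' i \<omega>) \<partial>M')"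
    if "G \<subseteq> F" and A: "\<And>i. i \<in> F \<Longrightarrow> A i \<in> sets borel" for G c and A :: "'i \<Rightarrow> real set"
    using finite_subset[OF that(1) F] that(1)
  proof (induction G arbitrary: c rule: finite_induct)
    case empty
    then show ?case using char by simp
  next
    case (insert b G)
    have bF: "b \<in> F" and GF: "G \<subseteq> F" using insert by auto
    have mA[measurable]: "i \<in> G \<Longrightarrow> A i \<in> sets borel" "A b \<in> sets borel" for i using A GF bF by auto
    have mZ[measurable]: "i \<in> G \<Longrightarrow> Z i \<in> borel_measurable M" "i \<in> G \<Longrightarrow> Z' i \<in> borel_measurable M'" for i using Z GF by auto
    have mb[measurable]: "Z b \<in> borel_measurable M" "Z' b \<in> borel_measurable M'" using Z bF by auto
    let ?w = "\<lambda>\<omega>. (\<Prod>i\<in>G. indicator (A i) (Z i \<omega>)) * iexp (\<Sum>i\<in>F. c i * Z i \<omega>)"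
    let ?w' = "\<lambda>\<omega>. (\<Prod>i\<in>G. indicator (A i) (Z' i \<omega>)) * iexp (\<Sum>i\<in>F. c i * Z' i \<omega>)"
    \<comment> \<open>Multiplication by \<open>iexp (t * Z b)\<close> only shifts the coefficient of
      \<open>b\<close>. The induction hypothesis, valid for all coefficients, is therefore the
      equality of weighted characteristic functions in the variable \<open>Z b\<close>.\<close>
    have upd: "(\<Sum>i\<in>F. c i * z i) + t * z b = (\<Sum>i\<in>F. (c(b := c b + t)) i * z i)" for t and z :: "'i \<Rightarrow> real"
      using F bF by (simp add: sum.remove[of F b] distrib_right)
    have upd0: "t * z b = (\<Sum>i\<in>F. (if i = b then t else 0) * z i)" for t and z :: "'i \<Rightarrow> real"
      using F bF by (simp add: if_distrib[of "\<lambda>x. x * _"] cong: if_cong)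
    have nrm: "norm (\<Prod>i\<in>G. indicator (A i) (f i) :: complex) \<le> 1" for f :: "'i \<Rightarrow> real"
      unfolding prod_norm[symmetric] by (intro prod_le_1) (auto split: split_indicator)
    have "(\<integral>\<omega>. ?w \<omega> * indicator (A b) (Z b \<omega>) \<partial>M) = (\<integral>\<omega>. ?w' \<omega> * indicator (A b) (Z' b \<omega>) \<partial>M')"
    proof (rule weighted_law_eq[OF M mb])
      show "norm (?w \<omega>) \<le> 1" for \<omega> using nrm[of "\<lambda>i. Z i \<omega>"] by (simp add: norm_mult)
      show "norm (?w' \<omega>) \<le> 1" for \<omega> using nrm[of "\<lambda>i. Z' i \<omega>"] by (simp add: norm_mult)
      show "(\<integral>\<omega>. iexp (t * Z b \<omega>) \<partial>M) = (\<integral>\<omega>. iexp (t * Z' b \<omega>) \<partial>M')" for t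
        unfolding upd0[of t "\<lambda>i. Z i \<omega>" for \<omega>] upd0[of t "\<lambda>i. Z' i \<omega>" for \<omega>] by (rule char)
      have e: "x * iexp u * iexp v = x * iexp (u + v)" for x u v by (simp add: exp_add ring_distribs)
      show "(\<integral>\<omega>. ?w \<omega> * iexp (t * Z b \<omega>) \<partial>M) = (\<integral>\<omega>. ?w' \<omega> * iexp (t * Z' b \<omega>) \<partial>M')" for t
        unfolding e upd[of "\<lambda>i. Z i \<omega>" for \<omega>] upd[of "\<lambda>i. Z' i \<omega>" for \<omega>] by (rule insert.IH[OF GF])
    qed (measurable)
    then show ?case
      using insert.hyps by (simp add: mult_ac)
  qed
  show ?thesis
  proof (rule measure_eqI_PiM_finite[where A="\<lambda>_. space (\<Pi>\<^sub>M i\<in>F. borel)" and M="\<lambda>_. borel"])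
    fix A :: "'i \<Rightarrow> real set"
    assume A[measurable]: "\<And>i. i \<in> F \<Longrightarrow> A i \<in> sets borel"
    have S: "Pi\<^sub>E F A \<in> sets (\<Pi>\<^sub>M i\<in>F. borel)" using F by measurable
    have eq: "complex_of_real (measure K {\<omega>\<in>space K. \<forall>i\<in>F. V i \<omega> \<in> A i}) =
        (\<integral>\<omega>. (\<Prod>i\<in>F. indicator (A i) (V i \<omega>)) * iexp (\<Sum>i\<in>F. 0 * V i \<omega>) \<partial>K)"
      if K: "prob_space K" and [measurable]: "\<And>i. i \<in> F \<Longrightarrow> V i \<in> borel_measurable K" for K :: "'c measure" and V
    proof -
      have "(\<integral>\<omega>. (\<Prod>i\<in>F. indicator (A i) (V i \<omega>)) * iexp (\<Sum>i\<in>F. 0 * V i \<omega>) \<partial>K)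
         = (\<integral>\<omega>. complex_of_real (indicator {\<omega>\<in>space K. \<forall>i\<in>F. V i \<omega> \<in> A i} \<omega>) \<partial>K)"
        using F by (intro Bochner_Integration.integral_cong) (auto split: split_indicator simp: prod_zero_iff)
      also have "\<dots> = complex_of_real (\<integral>\<omega>. indicator {\<omega>\<in>space K. \<forall>i\<in>F. V i \<omega> \<in> A i} \<omega> \<partial>K)"
        by (rule integral_complex_of_real)
      also have "\<dots> = complex_of_real (measure K {\<omega>\<in>space K. \<forall>i\<in>F. V i \<omega> \<in> A i})"
        by (simp add: Int_absorb2[of _ "space K"] subset_eq)
      finally show ?thesis by simp
    qed
    have vi: "emeasure (distr K (\<Pi>\<^sub>M i\<in>F. borel) (\<lambda>\<omega>. \<lambda>i\<in>F. V i \<omega>)) (Pi\<^sub>E F A) = ennreal (measure K {\<omega>\<in>space K. \<forall>i\<in>F. V i \<omega> \<in> A i})"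
      if K: "prob_space K" and [measurable]: "\<And>i. i \<in> F \<Longrightarrow> V i \<in> borel_measurable K" for K :: "'c measure" and V
    proof -
      interpret K: prob_space K by fact
      have "(\<lambda>\<omega>. \<lambda>i\<in>F. V i \<omega>) -` Pi\<^sub>E F A \<inter> space K = {\<omega>\<in>space K. \<forall>i\<in>F. V i \<omega> \<in> A i}"
        by (auto simp: PiE_iff)
      then show ?thesis using S
        by (subst emeasure_distr) (auto intro!: measurable_restrict simp: K.emeasure_eq_measure)
    qed
    have "complex_of_real (measure M {\<omega>\<in>space M. \<forall>i\<in>F. Z i \<omega> \<in> A i}) = complex_of_real (measure M' {\<omega>\<in>space M'. \<forall>i\<in>F. Z' i \<omega> \<in> A i})"
      by (rule trans[OF eq[of M Z, OF M(1) Z(1)] trans[OF boxes[of F A "\<lambda>_. 0", OF subset_refl A] eq[of M' Z', OF M(2) Z(2), symmetric]]])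
    then show "emeasure (distr M (\<Pi>\<^sub>M i\<in>F. borel) (\<lambda>\<omega>. \<lambda>i\<in>F. Z i \<omega>)) (Pi\<^sub>E F A) =
       emeasure (distr M' (\<Pi>\<^sub>M i\<in>F. borel) (\<lambda>\<omega>. \<lambda>i\<in>F. Z' i \<omega>)) (Pi\<^sub>E F A)"
      using vi[of M Z, OF M(1) Z(1)] vi[of M' Z', OF M(2) Z(2)] by simp
  next
    have "prob_space (distr M (\<Pi>\<^sub>M i\<in>F. borel) (\<lambda>\<omega>. \<lambda>i\<in>F. Z i \<omega>))"
      by (intro M.prob_space_distr measurable_restrict) (auto intro: Z)
    then interpret D: prob_space "distr M (\<Pi>\<^sub>M i\<in>F. borel) (\<lambda>\<omega>. \<lambda>i\<in>F. Z i \<omega>)" .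
    show "emeasure (distr M (\<Pi>\<^sub>M i\<in>F. borel) (\<lambda>\<omega>. \<lambda>i\<in>F. Z i \<omega>)) (space (\<Pi>\<^sub>M i\<in>F. borel)) \<noteq> \<infinity>"
      by (simp add: D.emeasure_eq_measure)
    have "Pi\<^sub>E F (\<lambda>_. UNIV) \<in> prod_algebra F (\<lambda>_. borel :: real measure)"
      using F by (intro prod_algebraI_finite) auto
    then show "range (\<lambda>_::nat. space (\<Pi>\<^sub>M i\<in>F. (borel::real measure))) \<subseteq> prod_algebra F (\<lambda>_. borel)"
      by (auto simp: space_PiM)
  qed (use F in auto)
qed

section \<open>The Borell-TIS inequality for finite families\<close>

lemma exp_le_cubic: "exp y \<le> 1 + y + y\<^sup>2 / 2 + \<bar>y\<bar>^3 * exp \<bar>y\<bar>" for y :: real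
proof -
  obtain t where t: "\<bar>t\<bar> \<le> \<bar>y\<bar>" "exp y = (\<Sum>m<3. y ^ m / fact m) + exp t / fact 3 * y ^ 3"
    using Maclaurin_exp_le[of y 3] by blast
  have "exp t / fact 3 * y ^ 3 \<le> \<bar>exp t / fact 3 * y ^ 3\<bar>" by (rule abs_ge_self)
  also have "\<dots> = exp t / 6 * \<bar>y\<bar> ^ 3" by (simp add: abs_mult power_abs fact_numeral)
  also have "\<dots> \<le> exp \<bar>y\<bar> * \<bar>y\<bar> ^ 3"
  proof (rule mult_right_mono)
    have "exp t \<le> exp \<bar>y\<bar>" using t(1) by simp
    then show "exp t / 6 \<le> exp \<bar>y\<bar>" using exp_gt_zero[of t] by linarith
  qed simp
  finally have "exp t / fact 3 * y ^ 3 \<le> \<bar>y\<bar> ^ 3 * exp \<bar>y\<bar>" by (simp only: mult.commute)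
  moreover have "(\<Sum>m<3. y ^ m / fact m) = 1 + y + y\<^sup>2 / 2"
    by (simp add: numeral_3_eq_3 power2_eq_square)
  ultimately show ?thesis using t(2) by linarith
qed

lemma power_le_fact_exp: "0 \<le> y \<Longrightarrow> y ^ k \<le> fact k * exp y" for y :: real
proof -
  assume "0 \<le> y"
  have "(\<Sum>i\<in>{k}. y ^ i /\<^sub>R fact i) \<le> (\<Sum>i. y ^ i /\<^sub>R fact i)"
    using \<open>0 \<le> y\<close> by (intro sum_le_suminf summable_exp_generic) auto
  then show ?thesis by (simp add: exp_def field_simps)
qed

locale finite_gaussian = prob_space M for M :: "'w measure" +
  fixes I :: "'i set" and Z :: "'i \<Rightarrow> 'w \<Rightarrow> real"
  assumes finite_I: "finite I" and I_nonempty: "I \<noteq> {}"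
    and gaussian: "\<And>c. centered_gaussian_rv M (\<lambda>\<omega>. \<Sum>a\<in>I. c a * Z a \<omega>)"
    and var_le: "\<And>a. a \<in> I \<Longrightarrow> (\<integral>\<omega>. (Z a \<omega>)\<^sup>2 \<partial>M) \<le> 1"
begin

lemma prob_space_M: "prob_space M"
  by (rule prob_space_axioms)

lemma gaussian_Z: "a \<in> I \<Longrightarrow> centered_gaussian_rv M (Z a)"
  using gaussian[of "\<lambda>b. if b = a then 1 else 0"] finite_I by (simp add: if_distrib[of "\<lambda>x. x * _"] cong: if_cong)

lemma Z_measurable[measurable]: "a \<in> I \<Longrightarrow> Z a \<in> borel_measurable M"
  by (rule cgrv_measurable[OF gaussian_Z])

text \<open>The l1 norm of the Gaussian vector. The test functions below are Lipschitz for this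
  norm, so its exponential moments settle the questions of integrability.\<close>

definition H :: "'w \<Rightarrow> real" where "H \<omega> = (\<Sum>a\<in>I. \<bar>Z a \<omega>\<bar>)"

lemma H_nonneg: "0 \<le> H \<omega>" by (simp add: H_def sum_nonneg)

lemma H_measurable[measurable]: "H \<in> borel_measurable M"
  unfolding H_def[abs_def] by measurable

lemma integrable_exp_H: "integrable M (\<lambda>\<omega>. exp (c * H \<omega>))"
proof (rule Bochner_Integration.integrable_bound)
  let ?b = "\<bar>c\<bar> * card I"
  let ?g = "\<lambda>\<omega>. \<Sum>a\<in>I. exp (?b * Z a \<omega>) + exp (- ?b * Z a \<omega>)"
  show "integrable M ?g"
    by (intro Bochner_Integration.integrable_sum Bochner_Integration.integrable_add cgrv_integrable_exp prob_space_M gaussian_Z)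
  show "AE \<omega> in M. norm (exp (c * H \<omega>)) \<le> norm (?g \<omega>)"
  proof (rule AE_I2)
    fix \<omega>
    \<comment> \<open>\<open>H\<close> is at most \<open>card I\<close> times the largest absolute
      value, which reduces the exponential of a sum to a sum of exponentials of single
      variables.\<close>
    obtain a where a: "a \<in> I" "\<And>b. b \<in> I \<Longrightarrow> \<bar>Z b \<omega>\<bar> \<le> \<bar>Z a \<omega>\<bar>"
      using obtains_MAX[OF finite_I I_nonempty, of "\<lambda>b. \<bar>Z b \<omega>\<bar>"] finite_I
      by (metis Max_ge finite_imageI imageI)
    have "c * H \<omega> \<le> \<bar>c\<bar> * (\<Sum>b\<in>I. \<bar>Z a \<omega>\<bar>)"
      unfolding H_def using a by (intro mult_mono sum_mono) (auto intro: sum_nonneg)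
    then have "c * H \<omega> \<le> ?b * \<bar>Z a \<omega>\<bar>" by (simp add: mult_ac)
    then have "exp (c * H \<omega>) \<le> exp (?b * \<bar>Z a \<omega>\<bar>)" by simp
    also have "\<dots> \<le> exp (?b * Z a \<omega>) + exp (- ?b * Z a \<omega>)" by (cases "Z a \<omega> \<ge> 0") auto
    also have "\<dots> \<le> ?g \<omega>"
      using a finite_I by (intro member_le_sum[of a I "\<lambda>a. exp (?b * Z a \<omega>) + exp (- ?b * Z a \<omega>)"]) (auto intro: add_nonneg_nonneg)
    finally show "norm (exp (c * H \<omega>)) \<le> norm (?g \<omega>)" by simp
  qed
qed measurable

lemma integrable_dominated:
  fixes g :: "'w \<Rightarrow> real"
  assumes "g \<in> borel_measurable M" "\<And>\<omega>. \<bar>g \<omega>\<bar> \<le> A * exp (c * H \<omega>)"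
  shows "integrable M g"
proof (rule Bochner_Integration.integrable_bound[where f="\<lambda>\<omega>. A * exp (c * H \<omega>)"])
  show "AE \<omega> in M. norm (g \<omega>) \<le> norm (A * exp (c * H \<omega>))"
    using order.trans[OF assms(2) abs_ge_self] by simp
qed (use assms integrable_exp_H in auto)

lemma integrable_H_power: "integrable M (\<lambda>\<omega>. (H \<omega>) ^ k)"
  using H_nonneg by (intro integrable_dominated[where A="fact k" and c=1]) (auto intro: power_le_fact_exp)

lemma integrable_H: "integrable M H"
  using integrable_H_power[of 1] by simp

text \<open>Convexity of the square bounds the second moment of a convex combination by the largest
  one. Gradients of smoothed maxima are such combinations, and this is the source of the sharp
  constant.\<close>

lemma second_moment_le:
  assumes q: "\<And>a. a \<in> I \<Longrightarrow> 0 \<le> q a" "(\<Sum>a\<in>I. q a) = 1"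
  shows "(\<integral>\<omega>. (\<Sum>a\<in>I. q a * Z a \<omega>)\<^sup>2 \<partial>M) \<le> 1"
proof -
  have sq: "integrable M (\<lambda>\<omega>. (Z a \<omega>)\<^sup>2)" if "a \<in> I" for a
    using cgrv_integrable_square[OF prob_space_M gaussian_Z[OF that]] .
  have "(\<integral>\<omega>. (\<Sum>a\<in>I. q a * Z a \<omega>)\<^sup>2 \<partial>M) \<le> (\<integral>\<omega>. (\<Sum>a\<in>I. q a * (Z a \<omega>)\<^sup>2) \<partial>M)"
  proof (rule integral_mono)
    show "integrable M (\<lambda>\<omega>. (\<Sum>a\<in>I. q a * Z a \<omega>)\<^sup>2)"
      by (rule cgrv_integrable_square[OF prob_space_M gaussian])
    show "integrable M (\<lambda>\<omega>. \<Sum>a\<in>I. q a * (Z a \<omega>)\<^sup>2)" using sq by auto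
    show "(\<Sum>a\<in>I. q a * Z a \<omega>)\<^sup>2 \<le> (\<Sum>a\<in>I. q a * (Z a \<omega>)\<^sup>2)" for \<omega>
      using convex_on_sum[OF finite_I I_nonempty convex_power2 q(2), of "\<lambda>a. Z a \<omega>"] q(1) by simp
  qed
  also have "\<dots> = (\<Sum>a\<in>I. q a * (\<integral>\<omega>. (Z a \<omega>)\<^sup>2 \<partial>M))" using sq by simp
  also have "\<dots> \<le> (\<Sum>a\<in>I. q a * 1)" using q var_le by (intro sum_mono mult_left_mono) auto
  finally show ?thesis using q by simp
qed

section \<open>Regularity classes for smooth approximations of the maximum\<close>

definition lipschitz1 :: "(('i \<Rightarrow> real) \<Rightarrow> real) \<Rightarrow> bool" where
  "lipschitz1 f \<longleftrightarrow> (\<forall>x h. \<bar>f (\<lambda>a. x a + h a) - f x\<bar> \<le> (\<Sum>a\<in>I. \<bar>h a\<bar>))"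

text \<open>\<open>q\<close> stands for the gradient, which for a smoothed maximum is a probability
  vector, and \<open>\<beta>\<close> bounds the second order remainder in the l1 norm. Both features
  survive Gaussian averaging with the same \<open>\<beta>\<close>.\<close>

definition smooth_max :: "real \<Rightarrow> (('i \<Rightarrow> real) \<Rightarrow> real) \<Rightarrow> bool" where
  "smooth_max \<beta> f \<longleftrightarrow> (\<forall>x. \<exists>q. (\<forall>a\<in>I. 0 \<le> q a) \<and> (\<Sum>a\<in>I. q a) = 1 \<and>
     (\<forall>h. \<bar>f (\<lambda>a. x a + h a) - f x - (\<Sum>a\<in>I. q a * h a)\<bar> \<le> \<beta> * (\<Sum>a\<in>I. \<bar>h a\<bar>)\<^sup>2))"

lemma sum_abs_scale: "0 \<le> s \<Longrightarrow> (\<Sum>a\<in>I. \<bar>s * Z a \<omega>\<bar>) = s * H \<omega>"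
  by (simp add: H_def abs_mult sum_distrib_left)

lemma lipschitz1_integrable:
  assumes L: "lipschitz1 f" and m: "(\<lambda>\<omega>. f (\<lambda>a. x a + s * Z a \<omega>)) \<in> borel_measurable M" and s: "0 \<le> s"
  shows "integrable M (\<lambda>\<omega>. f (\<lambda>a. x a + s * Z a \<omega>))"
    and "integrable M (\<lambda>\<omega>. exp (\<theta> * f (\<lambda>a. x a + s * Z a \<omega>)))"
proof -
  have b: "\<bar>f (\<lambda>a. x a + s * Z a \<omega>) - f x\<bar> \<le> s * H \<omega>" for \<omega>
    using L s unfolding lipschitz1_def by (metis sum_abs_scale)
  have "\<bar>f (\<lambda>a. x a + s * Z a \<omega>)\<bar> \<le> (\<bar>f x\<bar> + 1) * exp (s * H \<omega>)" for \<omega>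
  proof -
    have "\<bar>f (\<lambda>a. x a + s * Z a \<omega>)\<bar> \<le> \<bar>f x\<bar> + s * H \<omega>" using b[of \<omega>] by linarith
    also have "\<dots> \<le> \<bar>f x\<bar> * exp (s * H \<omega>) + exp (s * H \<omega>)"
    proof (rule add_mono)
      show "\<bar>f x\<bar> \<le> \<bar>f x\<bar> * exp (s * H \<omega>)" using s H_nonneg[of \<omega>] by (simp add: mult_le_cancel_left1)
      show "s * H \<omega> \<le> exp (s * H \<omega>)" using exp_ge_add_one_self[of "s * H \<omega>"] by linarith
    qed
    finally show ?thesis by (simp add: distrib_right)
  qed
  then show "integrable M (\<lambda>\<omega>. f (\<lambda>a. x a + s * Z a \<omega>))"
    by (rule integrable_dominated[OF m])
  have "\<bar>exp (\<theta> * f (\<lambda>a. x a + s * Z a \<omega>))\<bar> \<le> exp (\<theta> * f x) * exp ((\<bar>\<theta>\<bar> * s) * H \<omega>)" for \<omega>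
  proof -
    have "\<theta> * (f (\<lambda>a. x a + s * Z a \<omega>) - f x) \<le> \<bar>\<theta>\<bar> * \<bar>f (\<lambda>a. x a + s * Z a \<omega>) - f x\<bar>"
      by (metis abs_ge_self abs_mult)
    also have "\<dots> \<le> \<bar>\<theta>\<bar> * (s * H \<omega>)" using b by (intro mult_left_mono) auto
    finally show ?thesis by (simp add: algebra_simps flip: exp_add)
  qed
  then show "integrable M (\<lambda>\<omega>. exp (\<theta> * f (\<lambda>a. x a + s * Z a \<omega>)))"
    using m by (intro integrable_dominated) auto
qed

text \<open>Centring removes the first order effect of the quadratic Taylor remainder, so a Gaussian
  step of size \<open>s\<close> costs only \<open>\<theta>\<^sup>2 s\<^sup>2 / 2\<close> up to a term of order \<open>s\<^sup>3\<close>.\<close>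

lemma laplace_small_step:
  assumes \<beta>: "0 \<le> \<beta>"
  obtains C where "0 \<le> C" "\<And>f x s. lipschitz1 f \<Longrightarrow> smooth_max \<beta> f \<Longrightarrow>
      (\<lambda>\<omega>. f (\<lambda>a. x a + s * Z a \<omega>)) \<in> borel_measurable M \<Longrightarrow> 0 \<le> s \<Longrightarrow> s \<le> 1 \<Longrightarrow>
      (\<integral>\<omega>. exp (\<theta> * f (\<lambda>a. x a + s * Z a \<omega>)) \<partial>M)
        \<le> exp (\<theta> * (\<integral>\<omega>. f (\<lambda>a. x a + s * Z a \<omega>) \<partial>M) + \<theta>\<^sup>2 * s\<^sup>2 / 2 + C * s ^ 3)"
proof -
  define h0 where "h0 = (\<integral>\<omega>. H \<omega> \<partial>M)"
  define e where "e = (\<integral>\<omega>. (H \<omega>)\<^sup>2 \<partial>M)"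
  have h0: "0 \<le> h0" and e: "0 \<le> e" unfolding h0_def e_def by (auto simp: H_nonneg)
  \<comment> \<open>\<open>b * exp (H \<omega>)\<close> absorbs
    \<open>\<beta> * ((H \<omega>)\<^sup>2 + e)\<close>, the Taylor remainder plus the shift of the
    mean, by means of \<open>(H \<omega>)\<^sup>2 \<le> 2 * exp (H \<omega>)\<close>.\<close>
  define b where "b = \<beta> * (2 + e)"
  have b: "0 \<le> b" using \<beta> e by (simp add: b_def)
  \<comment> \<open>\<open>A1\<close> collects the third order errors of the squared increment and
    \<open>A2\<close> the cubic remainder of the exponential; 6 is \<open>fact 3\<close>, from
    bounding a cube by an exponential.\<close>
  define A1 where "A1 = \<theta>\<^sup>2 / 2 * (2 * b + b\<^sup>2)"
  define A2 where "A2 = \<bar>\<theta>\<bar> ^ 3 * 6 * exp ((1 + \<bar>\<theta>\<bar>) * h0)"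
  define K where "K \<omega> = A1 * exp (2 * H \<omega>) + A2 * exp ((1 + \<bar>\<theta>\<bar>) * H \<omega>)" for \<omega>
  have K0: "0 \<le> K \<omega>" for \<omega> using b by (auto simp: K_def A1_def A2_def)
  have iK: "integrable M K" unfolding K_def by (intro Bochner_Integration.integrable_add integrable_mult_right integrable_exp_H)
  \<comment> \<open>Uniformity of \<open>C\<close> in \<open>f\<close>, \<open>x\<close> and
    \<open>s\<close> is the point: the step is later repeated with changing functions and base
    points.\<close>
  define C where "C = (\<integral>\<omega>. K \<omega> \<partial>M)"
  show thesis
  proof (rule that)
    show "0 \<le> C" unfolding C_def by (simp add: K0)
    fix f x s
    assume L: "lipschitz1 f" and S: "smooth_max \<beta> f" and m[measurable]: "(\<lambda>\<omega>. f (\<lambda>a. x a + s * Z a \<omega>)) \<in> borel_measurable M"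
      and s: "0 \<le> s" "s \<le> 1"
    let ?F = "\<lambda>\<omega>. f (\<lambda>a. x a + s * Z a \<omega>)"
    define mu where "mu = (\<integral>\<omega>. ?F \<omega> \<partial>M)"
    have iF: "integrable M ?F" by (rule lipschitz1_integrable[OF L m s(1)])
    have iE: "integrable M (\<lambda>\<omega>. exp (\<theta> * ?F \<omega>))" by (rule lipschitz1_integrable[OF L m s(1)])
    obtain q where q: "\<And>a. a \<in> I \<Longrightarrow> 0 \<le> q a" "(\<Sum>a\<in>I. q a) = 1"
      and T: "\<And>h. \<bar>f (\<lambda>a. x a + h a) - f x - (\<Sum>a\<in>I. q a * h a)\<bar> \<le> \<beta> * (\<Sum>a\<in>I. \<bar>h a\<bar>)\<^sup>2"
      using S unfolding smooth_max_def by meson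
    define G where "G \<omega> = (\<Sum>a\<in>I. q a * Z a \<omega>)" for \<omega>
    have gG: "centered_gaussian_rv M G" unfolding G_def[abs_def] by (rule gaussian)
    note iG = cgrv_mean[OF prob_space_M gG] and iG2 = cgrv_integrable_square[OF prob_space_M gG]
    have G1: "\<bar>G \<omega>\<bar> \<le> H \<omega>" for \<omega>
    proof -
      have "\<bar>G \<omega>\<bar> \<le> (\<Sum>a\<in>I. \<bar>q a * Z a \<omega>\<bar>)" unfolding G_def by (rule sum_abs)
      also have "\<dots> \<le> H \<omega>" unfolding H_def abs_mult
      proof (rule sum_mono)
        fix a assume a: "a \<in> I"
        have "q a \<le> 1" using member_le_sum[of a I q] a q finite_I by auto
        then show "\<bar>q a\<bar> * \<bar>Z a \<omega>\<bar> \<le> \<bar>Z a \<omega>\<bar>" using q(1)[OF a] by (simp add: mult_left_le_one_le)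
      qed
      finally show ?thesis .
    qed
    have G2: "(\<integral>\<omega>. (G \<omega>)\<^sup>2 \<partial>M) \<le> 1" unfolding G_def by (rule second_moment_le[OF q])
    have lin: "\<bar>?F \<omega> - f x - s * G \<omega>\<bar> \<le> \<beta> * s\<^sup>2 * (H \<omega>)\<^sup>2" for \<omega>
      using T[of "\<lambda>a. s * Z a \<omega>"] s by (simp add: sum_abs_scale power_mult_distrib G_def sum_distrib_left mult_ac)
    have lip: "\<bar>?F \<omega> - f x\<bar> \<le> s * H \<omega>" for \<omega>
      using L s unfolding lipschitz1_def by (metis sum_abs_scale)
    have "mu - f x = (\<integral>\<omega>. (?F \<omega> - f x - s * G \<omega>) \<partial>M)"
      unfolding mu_def using iF iG by (simp add: prob_space)
    then have "\<bar>mu - f x\<bar> \<le> (\<integral>\<omega>. \<bar>?F \<omega> - f x - s * G \<omega>\<bar> \<partial>M)" by simp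
    also have "\<dots> \<le> (\<integral>\<omega>. \<beta> * s\<^sup>2 * (H \<omega>)\<^sup>2 \<partial>M)"
      using iF iG integrable_H_power[of 2] lin by (intro integral_mono) auto
    finally have mu1: "\<bar>mu - f x\<bar> \<le> \<beta> * s\<^sup>2 * e" by (simp add: e_def)
    have "mu - f x = (\<integral>\<omega>. (?F \<omega> - f x) \<partial>M)"
      unfolding mu_def using iF by (simp add: prob_space)
    then have "\<bar>mu - f x\<bar> \<le> (\<integral>\<omega>. \<bar>?F \<omega> - f x\<bar> \<partial>M)" by simp
    also have "\<dots> \<le> (\<integral>\<omega>. s * H \<omega> \<partial>M)"
      using iF integrable_H lip by (intro integral_mono) auto
    finally have mu2: "\<bar>mu - f x\<bar> \<le> s * h0" by (simp add: h0_def)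
    have pt: "exp (\<theta> * (?F \<omega> - mu)) \<le> 1 + \<theta> * (?F \<omega> - mu) + \<theta>\<^sup>2 * s\<^sup>2 / 2 * (G \<omega>)\<^sup>2 + s ^ 3 * K \<omega>" for \<omega>
    proof -
      define D where "D = ?F \<omega> - mu"
      define E where "E = exp (H \<omega>)"
      have E1: "1 \<le> E" using H_nonneg by (simp add: E_def)
      have HE: "H \<omega> \<le> E" using exp_ge_add_one_self[of "H \<omega>"] unfolding E_def by linarith
      have D1: "\<bar>D - s * G \<omega>\<bar> \<le> s\<^sup>2 * (b * E)"
      proof -
        have "\<bar>D - s * G \<omega>\<bar> \<le> \<beta> * s\<^sup>2 * (H \<omega>)\<^sup>2 + \<beta> * s\<^sup>2 * e"
          using lin[of \<omega>] mu1 unfolding D_def by linarith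
        also have "\<dots> = \<beta> * s\<^sup>2 * ((H \<omega>)\<^sup>2 + e)" by (simp add: algebra_simps)
        also have "\<dots> \<le> \<beta> * s\<^sup>2 * (2 * E + e * E)"
          using \<beta> s e E1 power_le_fact_exp[OF H_nonneg, of \<omega> 2]
          by (intro mult_left_mono add_mono) (auto simp: E_def mult_le_cancel_left1)
        finally show ?thesis by (simp add: b_def algebra_simps)
      qed
      have D2: "\<bar>D\<bar> \<le> s * (H \<omega> + h0)"
        using lip[of \<omega>] mu2 unfolding D_def distrib_left by linarith
      \<comment> \<open>Since \<open>D\<close> is \<open>s * G \<omega>\<close> up to a remainder of
        order \<open>s\<^sup>2\<close>, the cross term has order \<open>s ^ 3\<close> and the
        squared remainder order \<open>s ^ 4\<close>, which \<open>s \<le> 1\<close> also brings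
        below \<open>s ^ 3\<close>.\<close>
      have "D\<^sup>2 \<le> s\<^sup>2 * (G \<omega>)\<^sup>2 + s ^ 3 * ((2 * b + b\<^sup>2) * E\<^sup>2)"
      proof -
        have "D\<^sup>2 = s\<^sup>2 * (G \<omega>)\<^sup>2 + 2 * s * (G \<omega> * (D - s * G \<omega>)) + (D - s * G \<omega>)\<^sup>2"
          by (simp add: power2_eq_square algebra_simps)
        moreover have "G \<omega> * (D - s * G \<omega>) \<le> E * (s\<^sup>2 * (b * E))"
        proof -
          have "G \<omega> * (D - s * G \<omega>) \<le> \<bar>G \<omega>\<bar> * \<bar>D - s * G \<omega>\<bar>" by (metis abs_ge_self abs_mult)
          also have "\<dots> \<le> E * (s\<^sup>2 * (b * E))" using D1 order.trans[OF G1 HE] E1 by (intro mult_mono) auto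
          finally show ?thesis .
        qed
        then have "2 * s * (G \<omega> * (D - s * G \<omega>)) \<le> 2 * s * (E * (s\<^sup>2 * (b * E)))"
          using s by (intro mult_left_mono) auto
        moreover have "(D - s * G \<omega>)\<^sup>2 \<le> s ^ 3 * (b\<^sup>2 * E\<^sup>2)"
        proof -
          have "(D - s * G \<omega>)\<^sup>2 \<le> (s\<^sup>2 * (b * E))\<^sup>2" using D1 by (metis abs_ge_zero power2_abs power_mono)
          also have "\<dots> = s ^ 4 * (b\<^sup>2 * E\<^sup>2)" by (simp add: power_mult_distrib flip: power_mult)
          also have "\<dots> \<le> s ^ 3 * (b\<^sup>2 * E\<^sup>2)" using s by (intro mult_right_mono power_decreasing) auto
          finally show ?thesis .
        qed
        ultimately show ?thesis by (simp add: algebra_simps power2_eq_square power3_eq_cube)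
      qed
      then have t1: "\<theta>\<^sup>2 * D\<^sup>2 / 2 \<le> \<theta>\<^sup>2 * s\<^sup>2 / 2 * (G \<omega>)\<^sup>2 + s ^ 3 * (A1 * E\<^sup>2)"
        using mult_left_mono[of "D\<^sup>2" "s\<^sup>2 * (G \<omega>)\<^sup>2 + s ^ 3 * ((2 * b + b\<^sup>2) * E\<^sup>2)" "\<theta>\<^sup>2 / 2"]
        by (simp add: A1_def algebra_simps)
      have t2: "\<bar>\<theta> * D\<bar> ^ 3 * exp \<bar>\<theta> * D\<bar> \<le> s ^ 3 * (A2 * exp ((1 + \<bar>\<theta>\<bar>) * H \<omega>))"
      proof -
        have Dle: "\<bar>D\<bar> \<le> H \<omega> + h0"
          using D2 s H_nonneg[of \<omega>] h0 by (meson add_nonneg_nonneg mult_left_le_one_le order.trans)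
        have "\<bar>\<theta> * D\<bar> ^ 3 * exp \<bar>\<theta> * D\<bar> = \<bar>\<theta>\<bar> ^ 3 * (\<bar>D\<bar> ^ 3 * exp (\<bar>\<theta>\<bar> * \<bar>D\<bar>))"
          by (simp add: abs_mult power_mult_distrib)
        also have "\<dots> \<le> \<bar>\<theta>\<bar> ^ 3 * ((s * (H \<omega> + h0)) ^ 3 * exp (\<bar>\<theta>\<bar> * (H \<omega> + h0)))"
          using D2 Dle s H_nonneg[of \<omega>] h0 by (intro mult_left_mono mult_mono power_mono) (auto intro!: mult_left_mono)
        also have "\<dots> = \<bar>\<theta>\<bar> ^ 3 * s ^ 3 * ((H \<omega> + h0) ^ 3 * exp (\<bar>\<theta>\<bar> * (H \<omega> + h0)))"
          by (simp add: power_mult_distrib)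
        also have "\<dots> \<le> \<bar>\<theta>\<bar> ^ 3 * s ^ 3 * ((6 * exp (H \<omega> + h0)) * exp (\<bar>\<theta>\<bar> * (H \<omega> + h0)))"
          using power_le_fact_exp[of "H \<omega> + h0" 3] s H_nonneg[of \<omega>] h0
          by (intro mult_left_mono mult_right_mono) (auto simp: fact_numeral)
        also have "\<dots> = s ^ 3 * (A2 * exp ((1 + \<bar>\<theta>\<bar>) * H \<omega>))"
          by (simp add: A2_def algebra_simps exp_add)
        finally show ?thesis .
      qed
      have "E\<^sup>2 = exp (2 * H \<omega>)" by (simp add: E_def exp_double)
      then show ?thesis
        using exp_le_cubic[of "\<theta> * D"] t1 t2 unfolding D_def[symmetric] K_def
        by (simp add: power_mult_distrib algebra_simps)
    qed
    have "(\<integral>\<omega>. exp (\<theta> * (?F \<omega> - mu)) \<partial>M) \<le>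
       (\<integral>\<omega>. 1 + \<theta> * (?F \<omega> - mu) + \<theta>\<^sup>2 * s\<^sup>2 / 2 * (G \<omega>)\<^sup>2 + s ^ 3 * K \<omega> \<partial>M)"
    proof (rule integral_mono)
      have "exp (\<theta> * (?F \<omega> - mu)) = exp (- (\<theta> * mu)) * exp (\<theta> * ?F \<omega>)" for \<omega>
        by (simp add: algebra_simps flip: exp_add)
      then show "integrable M (\<lambda>\<omega>. exp (\<theta> * (?F \<omega> - mu)))"
        using integrable_mult_right[OF iE, of "exp (- (\<theta> * mu))"] by simp
      show "integrable M (\<lambda>\<omega>. 1 + \<theta> * (?F \<omega> - mu) + \<theta>\<^sup>2 * s\<^sup>2 / 2 * (G \<omega>)\<^sup>2 + s ^ 3 * K \<omega>)"
        by (intro Bochner_Integration.integrable_add Bochner_Integration.integrable_diff integrable_mult_right iF iG2 iK integrable_const)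
    qed (rule pt)
    also have "\<dots> = 1 + \<theta>\<^sup>2 * s\<^sup>2 / 2 * (\<integral>\<omega>. (G \<omega>)\<^sup>2 \<partial>M) + s ^ 3 * C"
    proof -
      have F0: "(\<integral>\<omega>. ?F \<omega> \<partial>M) = mu" by (simp only: mu_def)
      have i1: "integrable M (\<lambda>\<omega>. 1 + \<theta> * (?F \<omega> - mu))" using iF by simp
      have i2: "integrable M (\<lambda>\<omega>. \<theta>\<^sup>2 * s\<^sup>2 / 2 * (G \<omega>)\<^sup>2)" by (intro integrable_mult_right iG2)
      have i3: "integrable M (\<lambda>\<omega>. s ^ 3 * K \<omega>)" by (intro integrable_mult_right iK)
      have e1: "(\<integral>\<omega>. 1 + \<theta> * (?F \<omega> - mu) \<partial>M) = 1" using iF F0 by (simp add: prob_space)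
      show ?thesis
        by (simp only: Bochner_Integration.integral_add[OF Bochner_Integration.integrable_add[OF i1 i2] i3]
          Bochner_Integration.integral_add[OF i1 i2] e1 integral_mult_right_zero C_def)
    qed
    also have "\<dots> \<le> 1 + (\<theta>\<^sup>2 * s\<^sup>2 / 2 * 1 + s ^ 3 * C)"
      using mult_left_mono[OF G2, of "\<theta>\<^sup>2 * s\<^sup>2 / 2"] by (simp only: add_le_cancel_left add.assoc add_le_cancel_right) auto
    also have "\<dots> \<le> exp (\<theta>\<^sup>2 * s\<^sup>2 / 2 + C * s ^ 3)"
      using exp_ge_add_one_self[of "\<theta>\<^sup>2 * s\<^sup>2 / 2 + C * s ^ 3"] by (simp add: mult.commute)
    finally have J: "(\<integral>\<omega>. exp (\<theta> * (?F \<omega> - mu)) \<partial>M) \<le> exp (\<theta>\<^sup>2 * s\<^sup>2 / 2 + C * s ^ 3)" .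
    have "(\<integral>\<omega>. exp (\<theta> * ?F \<omega>) \<partial>M) = (\<integral>\<omega>. exp (\<theta> * mu) * exp (\<theta> * (?F \<omega> - mu)) \<partial>M)"
      by (simp add: right_diff_distrib flip: exp_add)
    also have "\<dots> = exp (\<theta> * mu) * (\<integral>\<omega>. exp (\<theta> * (?F \<omega> - mu)) \<partial>M)"
      by (rule integral_mult_right_zero)
    also have "\<dots> \<le> exp (\<theta> * mu) * exp (\<theta>\<^sup>2 * s\<^sup>2 / 2 + C * s ^ 3)"
      using J by (rule mult_left_mono) simp
    finally show "(\<integral>\<omega>. exp (\<theta> * ?F \<omega>) \<partial>M) \<le> exp (\<theta> * (\<integral>\<omega>. ?F \<omega> \<partial>M) + \<theta>\<^sup>2 * s\<^sup>2 / 2 + C * s ^ 3)"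
      unfolding mu_def[symmetric] by (simp add: add.assoc flip: exp_add)
  qed
qed

text \<open>Characteristic functions of independent Gaussian combinations multiply, so the variance
  factors \<open>s\<^sup>2\<close> and \<open>t\<^sup>2\<close> add; agreement for every linear
  combination determines the joint law.\<close>

lemma sum_law:
  assumes "0 \<le> s" "0 \<le> t"
  shows "distr (M \<Otimes>\<^sub>M M) (\<Pi>\<^sub>M a\<in>I. borel) (\<lambda>p. \<lambda>a\<in>I. s * Z a (fst p) + t * Z a (snd p)) =
    distr M (\<Pi>\<^sub>M a\<in>I. borel) (\<lambda>\<omega>. \<lambda>a\<in>I. sqrt (s\<^sup>2 + t\<^sup>2) * Z a \<omega>)"
proof (rule finite_family_law_eq)
  interpret P: pair_prob_space M M ..
  show "prob_space (M \<Otimes>\<^sub>M M)" by (rule P.P.prob_space_axioms)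
  show "prob_space M" by (rule prob_space_M)
  fix c
  define L where "L \<omega> = (\<Sum>a\<in>I. c a * Z a \<omega>)" for \<omega>
  have gL: "centered_gaussian_rv M L" unfolding L_def[abs_def] by (rule gaussian)
  have [measurable]: "L \<in> borel_measurable M" by (rule cgrv_measurable[OF gL])
  note ch = cgrv_char[OF prob_space_M gL]
  have "(\<integral>p. iexp (\<Sum>a\<in>I. c a * (s * Z a (fst p) + t * Z a (snd p))) \<partial>(M \<Otimes>\<^sub>M M)) =
      (\<integral>p. iexp (s * L (fst p)) * iexp (t * L (snd p)) \<partial>(M \<Otimes>\<^sub>M M))"
    by (intro Bochner_Integration.integral_cong) (auto simp: L_def sum_distrib_left sum.distrib algebra_simps simp flip: exp_add)
  also have "\<dots> = (\<integral>\<omega>. (\<integral>\<omega>'. iexp (s * L \<omega>) * iexp (t * L \<omega>') \<partial>M) \<partial>M)"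
    by (subst P.integral_fst'[symmetric]) (auto intro!: P.P.integrable_const_bound[of _ 1] simp: norm_mult)
  also have "\<dots> = (\<integral>\<omega>. iexp (s * L \<omega>) \<partial>M) * (\<integral>\<omega>'. iexp (t * L \<omega>') \<partial>M)"
    by simp
  also have "\<dots> = (\<integral>\<omega>. iexp (sqrt (s\<^sup>2 + t\<^sup>2) * L \<omega>) \<partial>M)"
    unfolding ch by (simp add: algebra_simps add_divide_distrib flip: of_real_mult exp_add)
  also have "\<dots> = (\<integral>\<omega>. iexp (\<Sum>a\<in>I. c a * (sqrt (s\<^sup>2 + t\<^sup>2) * Z a \<omega>)) \<partial>M)"
    by (simp only: L_def sum_distrib_left mult.left_commute)
  finally show "(\<integral>p. iexp (\<Sum>a\<in>I. c a * (s * Z a (fst p) + t * Z a (snd p))) \<partial>(M \<Otimes>\<^sub>M M)) =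
     (\<integral>\<omega>. iexp (\<Sum>a\<in>I. c a * (sqrt (s\<^sup>2 + t\<^sup>2) * Z a \<omega>)) \<partial>M)" .
qed (use finite_I in auto)

text \<open>Fubini combined with \<open>sum_law\<close>. The function \<open>g\<close> must see only
  the coordinates in \<open>I\<close>, because the laws live on functions that are
  \<open>undefined\<close> elsewhere.\<close>

lemma semigroup:
  fixes g :: "('i \<Rightarrow> real) \<Rightarrow> real"
  assumes st: "0 \<le> s" "0 \<le> t"
    and g[measurable]: "(\<lambda>y. g (\<lambda>a. x a + y a)) \<in> borel_measurable (\<Pi>\<^sub>M a\<in>I. borel)"
    and gI: "\<And>y y'. (\<And>a. a \<in> I \<Longrightarrow> y a = y' a) \<Longrightarrow> g y = g y'"
    and int: "integrable M (\<lambda>\<omega>. g (\<lambda>a. x a + sqrt (s\<^sup>2 + t\<^sup>2) * Z a \<omega>))"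
  shows "integrable M (\<lambda>\<omega>. \<integral>\<omega>'. g (\<lambda>a. x a + (s * Z a \<omega> + t * Z a \<omega>')) \<partial>M)"
    and "(\<integral>\<omega>. (\<integral>\<omega>'. g (\<lambda>a. x a + (s * Z a \<omega> + t * Z a \<omega>')) \<partial>M) \<partial>M) =
       (\<integral>\<omega>. g (\<lambda>a. x a + sqrt (s\<^sup>2 + t\<^sup>2) * Z a \<omega>) \<partial>M)"
proof -
  interpret P: pair_prob_space M M ..
  let ?r = "sqrt (s\<^sup>2 + t\<^sup>2)"
  let ?V = "\<lambda>p. \<lambda>a\<in>I. s * Z a (fst p) + t * Z a (snd p)"
  let ?W = "\<lambda>\<omega>. \<lambda>a\<in>I. ?r * Z a \<omega>"
  let ?g = "\<lambda>y. g (\<lambda>a. x a + y a)"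
  have V[measurable]: "?V \<in> measurable (M \<Otimes>\<^sub>M M) (\<Pi>\<^sub>M a\<in>I. borel)" by (intro measurable_restrict) auto
  have W[measurable]: "?W \<in> measurable M (\<Pi>\<^sub>M a\<in>I. borel)" by (intro measurable_restrict) auto
  have gV: "?g (?V p) = g (\<lambda>a. x a + (s * Z a (fst p) + t * Z a (snd p)))" for p by (rule gI) auto
  have gW: "?g (?W \<omega>) = g (\<lambda>a. x a + ?r * Z a \<omega>)" for \<omega> by (rule gI) auto
  have "integrable M (\<lambda>\<omega>. ?g (?W \<omega>))" unfolding gW by (rule int)
  then have "integrable (distr M (\<Pi>\<^sub>M a\<in>I. borel) ?W) ?g" by (subst integrable_distr_eq) auto
  then have "integrable (distr (M \<Otimes>\<^sub>M M) (\<Pi>\<^sub>M a\<in>I. borel) ?V) ?g" by (simp only: sum_law[OF st])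
  then have "integrable (M \<Otimes>\<^sub>M M) (\<lambda>p. ?g (?V p))" by (subst (asm) integrable_distr_eq) auto
  then have iV: "integrable (M \<Otimes>\<^sub>M M) (\<lambda>p. g (\<lambda>a. x a + (s * Z a (fst p) + t * Z a (snd p))))" unfolding gV .
  show "integrable M (\<lambda>\<omega>. \<integral>\<omega>'. g (\<lambda>a. x a + (s * Z a \<omega> + t * Z a \<omega>')) \<partial>M)"
    using P.integrable_fst'[OF iV] by simp
  have "(\<integral>\<omega>. (\<integral>\<omega>'. g (\<lambda>a. x a + (s * Z a \<omega> + t * Z a \<omega>')) \<partial>M) \<partial>M) =
      (\<integral>p. ?g (?V p) \<partial>(M \<Otimes>\<^sub>M M))"
    using P.integral_fst'[OF iV] unfolding gV by simp
  also have "\<dots> = (\<integral>y. ?g y \<partial>distr (M \<Otimes>\<^sub>M M) (\<Pi>\<^sub>M a\<in>I. borel) ?V)"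
    by (subst integral_distr) auto
  also have "\<dots> = (\<integral>\<omega>. ?g (?W \<omega>) \<partial>M)"
    unfolding sum_law[OF st] by (subst integral_distr) auto
  finally show "(\<integral>\<omega>. (\<integral>\<omega>'. g (\<lambda>a. x a + (s * Z a \<omega> + t * Z a \<omega>')) \<partial>M) \<partial>M) =
       (\<integral>\<omega>. g (\<lambda>a. x a + ?r * Z a \<omega>) \<partial>M)" unfolding gW .
qed

end

text \<open>For \<open>y \<le> 0\<close> the product
  \<open>(1 - y) * (1 + y + y\<^sup>2) = 1 - y ^ 3\<close> is at least 1, and
  \<open>exp (- y)\<close> is at least \<open>1 - y\<close>.\<close>

lemma exp_le_quadratic_neg: "exp y \<le> 1 + y + y\<^sup>2" if "y \<le> 0" for y :: real
proof -
  have "1 \<le> (1 - y) * (1 + y + y\<^sup>2)"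
    using mult_nonpos_nonpos[OF that, of "- y\<^sup>2"] by (simp add: algebra_simps power2_eq_square)
  also have "\<dots> \<le> exp (- y) * (1 + y + y\<^sup>2)"
  proof (rule mult_right_mono)
    show "1 - y \<le> exp (- y)" using exp_ge_add_one_self[of "- y"] by simp
    have "0 \<le> (2 * y + 1)\<^sup>2 + 3" by (intro add_nonneg_nonneg) auto
    then show "0 \<le> 1 + y + y\<^sup>2" by (simp add: algebra_simps power2_eq_square)
  qed
  finally show ?thesis by (simp add: exp_minus field_simps)
qed

section \<open>Log-sum-exp as a smooth maximum and its Laplace transform\<close>

context finite_gaussian
begin

text \<open>Log-sum-exp at inverse temperature \<open>\<beta>\<close>; its gradient is
  \<open>softmax_weight \<beta>\<close>, the Gibbs distribution.\<close>

definition softmax :: "real \<Rightarrow> ('i \<Rightarrow> real) \<Rightarrow> real" where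
  "softmax \<beta> x = ln (\<Sum>a\<in>I. exp (\<beta> * x a)) / \<beta>"

definition softmax_weight :: "real \<Rightarrow> ('i \<Rightarrow> real) \<Rightarrow> 'i \<Rightarrow> real" where
  "softmax_weight \<beta> x a = exp (\<beta> * x a) / (\<Sum>b\<in>I. exp (\<beta> * x b))"

lemma sum_exp_pos: "0 < (\<Sum>a\<in>I. exp (x a))" for x :: "'i \<Rightarrow> real"
  using finite_I I_nonempty by (intro sum_pos) auto

lemma softmax_weight_nonneg: "0 \<le> softmax_weight \<beta> x a"
  unfolding softmax_weight_def by (intro divide_nonneg_nonneg sum_nonneg) auto

lemma sum_softmax_weight: "(\<Sum>a\<in>I. softmax_weight \<beta> x a) = 1"
  unfolding softmax_weight_def using sum_exp_pos[of "\<lambda>a. \<beta> * x a"] by (simp flip: sum_divide_distrib)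

lemma softmax_weight_le_1: "a \<in> I \<Longrightarrow> softmax_weight \<beta> x a \<le> 1"
  using member_le_sum[of a I "softmax_weight \<beta> x"] finite_I softmax_weight_nonneg sum_softmax_weight[of \<beta> x] by auto

lemma softmax_cong: "(\<And>a. a \<in> I \<Longrightarrow> y a = y' a) \<Longrightarrow> softmax \<beta> y = softmax \<beta> y'"
  unfolding softmax_def by (simp cong: sum.cong)

lemma softmax_measurable[measurable (raw)]:
  assumes [measurable]: "\<And>a. a \<in> I \<Longrightarrow> (\<lambda>\<omega>. f \<omega> a) \<in> borel_measurable K"
  shows "(\<lambda>\<omega>. softmax \<beta> (f \<omega>)) \<in> borel_measurable K"
  unfolding softmax_def by measurable

lemma softmax_weight_measurable[measurable (raw)]:
  assumes a: "a \<in> I" and [measurable]: "\<And>a. a \<in> I \<Longrightarrow> (\<lambda>\<omega>. f \<omega> a) \<in> borel_measurable K"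
  shows "(\<lambda>\<omega>. softmax_weight \<beta> (f \<omega>) a) \<in> borel_measurable K"
  unfolding softmax_weight_def using a by measurable

lemma abs_weighted_sum_le: "\<bar>\<Sum>a\<in>I. softmax_weight \<beta> x a * h a\<bar> \<le> (\<Sum>a\<in>I. \<bar>h a\<bar>)"
proof -
  have "\<bar>\<Sum>a\<in>I. softmax_weight \<beta> x a * h a\<bar> \<le> (\<Sum>a\<in>I. \<bar>softmax_weight \<beta> x a * h a\<bar>)" by (rule sum_abs)
  also have "\<dots> \<le> (\<Sum>a\<in>I. \<bar>h a\<bar>)"
    by (intro sum_mono) (auto simp: abs_mult softmax_weight_nonneg softmax_weight_le_1 mult_left_le_one_le)
  finally show ?thesis .
qed

text \<open>The increment is the logarithm of an exponential moment of \<open>h\<close> under the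
  Gibbs weights, so regularity follows from elementary bounds on \<open>exp\<close>, without
  differentiation.\<close>

lemma softmax_increment:
  assumes \<beta>: "0 < \<beta>"
  shows "\<beta> * (softmax \<beta> (\<lambda>a. x a + h a) - softmax \<beta> x) = ln (\<Sum>a\<in>I. softmax_weight \<beta> x a * exp (\<beta> * h a))"
proof -
  have "(\<Sum>a\<in>I. softmax_weight \<beta> x a * exp (\<beta> * h a)) = (\<Sum>a\<in>I. exp (\<beta> * (x a + h a))) / (\<Sum>b\<in>I. exp (\<beta> * x b))"
    by (simp add: softmax_weight_def sum_divide_distrib distrib_left exp_add)
  also have "ln \<dots> = ln (\<Sum>a\<in>I. exp (\<beta> * (x a + h a))) - ln (\<Sum>b\<in>I. exp (\<beta> * x b))"
    using sum_exp_pos[of "\<lambda>a. \<beta> * (x a + h a)"] sum_exp_pos[of "\<lambda>a. \<beta> * x a"] by (simp only: ln_div less_imp_neq[symmetric] simp_thms if_True)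
  finally show ?thesis using \<beta> by (simp add: softmax_def right_diff_distrib)
qed

lemma softmax_bounds:
  assumes \<beta>: "0 < \<beta>"
  shows "\<bar>softmax \<beta> (\<lambda>a. x a + h a) - softmax \<beta> x\<bar> \<le> (\<Sum>a\<in>I. \<bar>h a\<bar>)"
    and "\<bar>softmax \<beta> (\<lambda>a. x a + h a) - softmax \<beta> x - (\<Sum>a\<in>I. softmax_weight \<beta> x a * h a)\<bar>
         \<le> 2 * \<beta> * (\<Sum>a\<in>I. \<bar>h a\<bar>)\<^sup>2"
proof -
  let ?w = "softmax_weight \<beta> x"
  let ?D = "softmax \<beta> (\<lambda>a. x a + h a) - softmax \<beta> x"
  let ?m = "\<Sum>a\<in>I. ?w a * h a" and ?n = "\<Sum>a\<in>I. \<bar>h a\<bar>" and ?S = "\<Sum>a\<in>I. ?w a * exp (\<beta> * h a)"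
  have n0: "0 \<le> ?n" by (simp add: sum_nonneg)
  have hn: "\<bar>h a\<bar> \<le> ?n" if "a \<in> I" for a
    using member_le_sum[of a I "\<lambda>a. \<bar>h a\<bar>"] that finite_I by auto
  have m: "\<bar>?m\<bar> \<le> ?n" by (rule abs_weighted_sum_le)
  have D: "\<beta> * ?D = ln ?S" by (rule softmax_increment[OF \<beta>])
  \<comment> \<open>The weights sum to 1, so an affine function of \<open>h\<close> averages to its
    value at the mean \<open>?m\<close>. It is needed for the tangent at \<open>?m\<close> and for
    the quadratic bound below.\<close>
  have aff: "(\<Sum>a\<in>I. ?w a * (u + \<beta> * (h a - c))) = u + \<beta> * (?m - c)" for u c
  proof -
    have "(\<Sum>a\<in>I. ?w a * (u + \<beta> * (h a - c))) = (\<Sum>a\<in>I. (u - \<beta> * c) * ?w a + \<beta> * (?w a * h a))"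
      by (intro sum.cong refl) (simp add: algebra_simps)
    also have "\<dots> = (u - \<beta> * c) * (\<Sum>a\<in>I. ?w a) + \<beta> * ?m"
      by (simp only: sum.distrib sum_distrib_left)
    finally show ?thesis by (simp add: sum_softmax_weight right_diff_distrib)
  qed
  \<comment> \<open>Jensen's inequality by the tangent line at the mean.\<close>
  have "exp (\<beta> * ?m) = exp (\<beta> * ?m) * (1 + \<beta> * (?m - ?m))" by simp
  also have "\<dots> = exp (\<beta> * ?m) * (\<Sum>a\<in>I. ?w a * (1 + \<beta> * (h a - ?m)))" by (simp only: aff)
  also have "\<dots> \<le> exp (\<beta> * ?m) * (\<Sum>a\<in>I. ?w a * exp (\<beta> * (h a - ?m)))"
    by (intro mult_left_mono sum_mono softmax_weight_nonneg exp_ge_add_one_self) auto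
  also have "\<dots> = ?S" by (simp add: sum_distrib_left right_diff_distrib exp_diff)
  finally have S1: "exp (\<beta> * ?m) \<le> ?S" .
  have S0: "0 < ?S" using S1 exp_gt_zero[of "\<beta> * ?m"] by linarith
  have "\<beta> * ?m \<le> ln ?S" using S1 S0 by (simp add: ln_ge_iff)
  then have lo: "?m \<le> ?D" using \<beta> unfolding D[symmetric] by simp
  have "?S \<le> (\<Sum>a\<in>I. ?w a * exp (\<beta> * ?n))"
    using \<beta> hn by (intro sum_mono mult_left_mono softmax_weight_nonneg) (auto simp: abs_le_iff)
  then have "?S \<le> exp (\<beta> * ?n)" by (simp add: sum_softmax_weight flip: sum_distrib_right)
  then have "ln ?S \<le> ln (exp (\<beta> * ?n))" using S0 by (subst ln_le_cancel_iff) auto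
  then have "\<beta> * ?D \<le> \<beta> * ?n" unfolding D by simp
  then have hi: "?D \<le> ?n" using \<beta> by simp
  show lip: "\<bar>?D\<bar> \<le> ?n" using lo hi m by linarith
  \<comment> \<open>For small increments the quadratic bound on \<open>exp\<close> is available; for
    large ones the Lipschitz estimate \<open>2 * ?n\<close> already lies below the claim.\<close>
  have up: "?D - ?m \<le> 2 * \<beta> * ?n\<^sup>2"
  proof (cases "\<beta> * ?n \<le> 1")
    case True
    have bh: "\<bar>\<beta> * h a\<bar> \<le> \<beta> * ?n" if "a \<in> I" for a
      using hn[OF that] \<beta> by (simp add: abs_mult)
    have "?S \<le> (\<Sum>a\<in>I. ?w a * (1 + \<beta> * h a + (\<beta> * ?n)\<^sup>2))"
    proof (intro sum_mono mult_left_mono softmax_weight_nonneg)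
      fix a assume a: "a \<in> I"
      have "exp (\<beta> * h a) \<le> 1 + \<beta> * h a + (\<beta> * h a)\<^sup>2"
      proof (cases "\<beta> * h a \<ge> 0")
        case True then show ?thesis using bh[OF a] \<open>\<beta> * ?n \<le> 1\<close> by (intro exp_bound) auto
      next
        case False
        then show ?thesis by (intro exp_le_quadratic_neg) auto
      qed
      also have "(\<beta> * h a)\<^sup>2 \<le> (\<beta> * ?n)\<^sup>2" using bh[OF a] by (metis abs_ge_zero power2_abs power_mono)
      finally show "exp (\<beta> * h a) \<le> 1 + \<beta> * h a + (\<beta> * ?n)\<^sup>2" by simp
    qed
    also have "\<dots> = 1 + (\<beta> * ?m + (\<beta> * ?n)\<^sup>2)"
      using aff[of "1 + (\<beta> * ?n)\<^sup>2" 0] by (simp add: algebra_simps)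
    also have "\<dots> \<le> exp (\<beta> * ?m + (\<beta> * ?n)\<^sup>2)" by (rule exp_ge_add_one_self)
    finally have "ln ?S \<le> ln (exp (\<beta> * ?m + (\<beta> * ?n)\<^sup>2))" using S0 by (subst ln_le_cancel_iff) auto
    then have "\<beta> * ?D \<le> \<beta> * (?m + \<beta> * ?n\<^sup>2)" unfolding D by (simp add: power2_eq_square algebra_simps)
    then have "?D - ?m \<le> \<beta> * ?n\<^sup>2" using \<beta> by simp
    also have "\<dots> \<le> 2 * \<beta> * ?n\<^sup>2" using \<beta> by simp
    finally show ?thesis .
  next
    case False
    have "?D - ?m \<le> 2 * ?n" using hi m by linarith
    also have "\<dots> \<le> 2 * ?n * (\<beta> * ?n)" using False n0 mult_left_mono[of 1 "\<beta> * ?n" "2 * ?n"] by simp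
    finally show ?thesis by (simp add: power2_eq_square mult_ac)
  qed
  show "\<bar>?D - ?m\<bar> \<le> 2 * \<beta> * ?n\<^sup>2" using up lo by linarith
qed

lemma softmax_lipschitz: "0 < \<beta> \<Longrightarrow> lipschitz1 (softmax \<beta>)"
  unfolding lipschitz1_def using softmax_bounds(1) by blast

text \<open>The expected terminal value of a random walk at \<open>x\<close> whose remaining
  displacement has scale \<open>r\<close>.\<close>

definition smoothed :: "real \<Rightarrow> real \<Rightarrow> ('i \<Rightarrow> real) \<Rightarrow> real" where
  "smoothed \<beta> r x = (\<integral>\<omega>. softmax \<beta> (\<lambda>a. x a + r * Z a \<omega>) \<partial>M)"

lemma smoothed_measurable[measurable]: "(\<lambda>\<omega>. smoothed \<beta> r (\<lambda>a. x a + s * Z a \<omega>)) \<in> borel_measurable M"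
  unfolding smoothed_def softmax_def by measurable

lemma softmax_integrable:
  assumes "0 < \<beta>" "0 \<le> r"
  shows "integrable M (\<lambda>\<omega>. softmax \<beta> (\<lambda>a. x a + r * Z a \<omega>))"
    and "integrable M (\<lambda>\<omega>. exp (\<theta> * softmax \<beta> (\<lambda>a. x a + r * Z a \<omega>)))"
proof -
  have m: "(\<lambda>\<omega>. softmax \<beta> (\<lambda>a. x a + r * Z a \<omega>)) \<in> borel_measurable M" by measurable
  show "integrable M (\<lambda>\<omega>. softmax \<beta> (\<lambda>a. x a + r * Z a \<omega>))"
    and "integrable M (\<lambda>\<omega>. exp (\<theta> * softmax \<beta> (\<lambda>a. x a + r * Z a \<omega>)))"
    using lipschitz1_integrable[OF softmax_lipschitz[OF assms(1)] m assms(2)] by blast+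
qed

text \<open>Averaging over translates preserves both classes with constants that do not involve
  \<open>r\<close>; the new gradient is the mean of the Gibbs weights.\<close>

lemma smoothed_regular:
  assumes \<beta>: "0 < \<beta>" and r: "0 \<le> r"
  shows "lipschitz1 (smoothed \<beta> r)" and "smooth_max (2 * \<beta>) (smoothed \<beta> r)"
proof -
  have comm: "softmax \<beta> (\<lambda>a. x a + h a + r * Z a \<omega>) = softmax \<beta> (\<lambda>a. (x a + r * Z a \<omega>) + h a)" for x h \<omega>
    by (rule softmax_cong) simp
  note int = softmax_integrable(1)[OF \<beta> r]
  have diff: "smoothed \<beta> r (\<lambda>a. x a + h a) - smoothed \<beta> r x =
      (\<integral>\<omega>. softmax \<beta> (\<lambda>a. (x a + r * Z a \<omega>) + h a) - softmax \<beta> (\<lambda>a. x a + r * Z a \<omega>) \<partial>M)" for x h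
    unfolding smoothed_def comm[symmetric] using int[of "\<lambda>a. x a + h a"] int[of x] by simp
  have intd: "integrable M (\<lambda>\<omega>. softmax \<beta> (\<lambda>a. (x a + r * Z a \<omega>) + h a) - softmax \<beta> (\<lambda>a. x a + r * Z a \<omega>))" for x h
    unfolding comm[symmetric] using int[of "\<lambda>a. x a + h a"] int[of x] by simp
  show "lipschitz1 (smoothed \<beta> r)"
    unfolding lipschitz1_def diff
  proof (intro allI)
    fix x h :: "'i \<Rightarrow> real"
    let ?d = "\<lambda>\<omega>. softmax \<beta> (\<lambda>a. (x a + r * Z a \<omega>) + h a) - softmax \<beta> (\<lambda>a. x a + r * Z a \<omega>)"
    have "\<bar>\<integral>\<omega>. ?d \<omega> \<partial>M\<bar> \<le> (\<integral>\<omega>. \<bar>?d \<omega>\<bar> \<partial>M)" by simp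
    also have "\<dots> \<le> (\<integral>\<omega>. (\<Sum>a\<in>I. \<bar>h a\<bar>) \<partial>M)"
      using intd by (intro integral_mono integrable_abs integrable_const softmax_bounds(1)[OF \<beta>])
    finally show "\<bar>\<integral>\<omega>. ?d \<omega> \<partial>M\<bar> \<le> (\<Sum>a\<in>I. \<bar>h a\<bar>)" by (simp add: prob_space)
  qed
  show "smooth_max (2 * \<beta>) (smoothed \<beta> r)"
    unfolding smooth_max_def
  proof
    fix x :: "'i \<Rightarrow> real"
    let ?w = "\<lambda>a \<omega>. softmax_weight \<beta> (\<lambda>a. x a + r * Z a \<omega>) a"
    have iw: "integrable M (?w a)" if a: "a \<in> I" for a
      using a softmax_weight_nonneg softmax_weight_le_1 by (intro integrable_const_bound[of _ 1]) auto
    show "\<exists>q. (\<forall>a\<in>I. 0 \<le> q a) \<and> sum q I = 1 \<and> (\<forall>h. \<bar>smoothed \<beta> r (\<lambda>a. x a + h a) - smoothed \<beta> r x - (\<Sum>a\<in>I. q a * h a)\<bar>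
          \<le> 2 * \<beta> * (\<Sum>a\<in>I. \<bar>h a\<bar>)\<^sup>2)"
    proof (intro exI conjI allI ballI)
      show "0 \<le> (\<integral>\<omega>. ?w a \<omega> \<partial>M)" for a by (simp add: softmax_weight_nonneg)
      show "(\<Sum>a\<in>I. \<integral>\<omega>. ?w a \<omega> \<partial>M) = 1"
        using iw by (subst Bochner_Integration.integral_sum[symmetric]) (auto simp: sum_softmax_weight prob_space)
      fix h :: "'i \<Rightarrow> real"
      let ?d = "\<lambda>\<omega>. softmax \<beta> (\<lambda>a. (x a + r * Z a \<omega>) + h a) - softmax \<beta> (\<lambda>a. x a + r * Z a \<omega>)"
      let ?l = "\<lambda>\<omega>. \<Sum>a\<in>I. ?w a \<omega> * h a"
      have il: "integrable M ?l" using iw by (intro Bochner_Integration.integrable_sum integrable_mult_left)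
      have "(\<Sum>a\<in>I. (\<integral>\<omega>. ?w a \<omega> \<partial>M) * h a) = (\<integral>\<omega>. ?l \<omega> \<partial>M)"
        using iw by (subst Bochner_Integration.integral_sum) auto
      then have eq: "smoothed \<beta> r (\<lambda>a. x a + h a) - smoothed \<beta> r x - (\<Sum>a\<in>I. (\<integral>\<omega>. ?w a \<omega> \<partial>M) * h a) = (\<integral>\<omega>. ?d \<omega> - ?l \<omega> \<partial>M)"
        unfolding diff using Bochner_Integration.integral_diff[OF intd il] by simp
      have "\<bar>\<integral>\<omega>. ?d \<omega> - ?l \<omega> \<partial>M\<bar> \<le> (\<integral>\<omega>. \<bar>?d \<omega> - ?l \<omega>\<bar> \<partial>M)" by (rule integral_abs_bound)
      also have "\<dots> \<le> (\<integral>\<omega>. 2 * \<beta> * (\<Sum>a\<in>I. \<bar>h a\<bar>)\<^sup>2 \<partial>M)"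
        by (intro integral_mono integrable_abs integrable_const softmax_bounds(2)[OF \<beta>] Bochner_Integration.integrable_diff[OF intd il])
      finally show "\<bar>smoothed \<beta> r (\<lambda>a. x a + h a) - smoothed \<beta> r x - (\<Sum>a\<in>I. (\<integral>\<omega>. ?w a \<omega> \<partial>M) * h a)\<bar>
          \<le> 2 * \<beta> * (\<Sum>a\<in>I. \<bar>h a\<bar>)\<^sup>2" unfolding eq by (simp add: prob_space)
    qed
  qed
qed

text \<open>Induction on the number of steps, isolating the first one. From the displaced point the
  induction hypothesis leaves the exponential of \<open>smoothed\<close> at the remaining scale.
  That function is regular, so averaging over the first step costs one more \<open>c\<close>, and
  the semigroup property identifies its mean.\<close>

lemma laplace_steps:
  assumes \<beta>: "0 < \<beta>" and s: "0 \<le> s" "s \<le> 1"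
    and step: "\<And>f x. lipschitz1 f \<Longrightarrow> smooth_max (2 * \<beta>) f \<Longrightarrow>
      (\<lambda>\<omega>. f (\<lambda>a. x a + s * Z a \<omega>)) \<in> borel_measurable M \<Longrightarrow>
      (\<integral>\<omega>. exp (\<theta> * f (\<lambda>a. x a + s * Z a \<omega>)) \<partial>M) \<le> exp (\<theta> * (\<integral>\<omega>. f (\<lambda>a. x a + s * Z a \<omega>) \<partial>M) + c)"
  shows "(\<integral>\<omega>. exp (\<theta> * softmax \<beta> (\<lambda>a. x a + sqrt (real j * s\<^sup>2) * Z a \<omega>)) \<partial>M)
     \<le> exp (\<theta> * smoothed \<beta> (sqrt (real j * s\<^sup>2)) x + real j * c)"
proof (induction j arbitrary: x)
  case 0
  then show ?case by (simp add: smoothed_def prob_space)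
next
  case (Suc j)
  let ?t = "sqrt (real j * s\<^sup>2)"
  let ?r = "sqrt (real (Suc j) * s\<^sup>2)"
  have t: "0 \<le> ?t" and r: "0 \<le> ?r" by auto
  have rt: "sqrt (s\<^sup>2 + ?t\<^sup>2) = ?r" by (simp add: algebra_simps)
  have assoc: "softmax \<beta> (\<lambda>a. x a + (s * Z a \<omega> + ?t * Z a \<omega>')) = softmax \<beta> (\<lambda>a. (x a + s * Z a \<omega>) + ?t * Z a \<omega>')" for \<omega> \<omega>'
    by (rule softmax_cong) simp
  have mg: "(\<lambda>y. softmax \<beta> (\<lambda>a. x a + y a)) \<in> borel_measurable (\<Pi>\<^sub>M a\<in>I. borel)" by measurable
  have mge: "(\<lambda>y. exp (\<theta> * softmax \<beta> (\<lambda>a. x a + y a))) \<in> borel_measurable (\<Pi>\<^sub>M a\<in>I. borel)" by measurable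
  have ce: "exp (\<theta> * softmax \<beta> y) = exp (\<theta> * softmax \<beta> y')" if "\<And>a. a \<in> I \<Longrightarrow> y a = y' a" for y y'
    using softmax_cong[of y y'] that by simp
  note A = semigroup[OF s(1) t mge ce, unfolded rt, OF _ softmax_integrable(2)[OF \<beta> r]]
  note B = semigroup[OF s(1) t mg softmax_cong, unfolded rt, OF _ softmax_integrable(1)[OF \<beta> r]]
  note L = smoothed_regular[OF \<beta> t]
  have "(\<integral>\<omega>. exp (\<theta> * softmax \<beta> (\<lambda>a. x a + ?r * Z a \<omega>)) \<partial>M) =
     (\<integral>\<omega>. (\<integral>\<omega>'. exp (\<theta> * softmax \<beta> (\<lambda>a. (x a + s * Z a \<omega>) + ?t * Z a \<omega>')) \<partial>M) \<partial>M)"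
    using A(2) unfolding assoc by simp
  also have "\<dots> \<le> (\<integral>\<omega>. exp (real j * c) * exp (\<theta> * smoothed \<beta> ?t (\<lambda>a. x a + s * Z a \<omega>)) \<partial>M)"
  proof (rule integral_mono)
    show "integrable M (\<lambda>\<omega>. \<integral>\<omega>'. exp (\<theta> * softmax \<beta> (\<lambda>a. (x a + s * Z a \<omega>) + ?t * Z a \<omega>')) \<partial>M)"
      using A(1) unfolding assoc .
    show "integrable M (\<lambda>\<omega>. exp (real j * c) * exp (\<theta> * smoothed \<beta> ?t (\<lambda>a. x a + s * Z a \<omega>)))"
      by (intro integrable_mult_right lipschitz1_integrable(2)[OF L(1) _ s(1)]) simp
    show "(\<integral>\<omega>'. exp (\<theta> * softmax \<beta> (\<lambda>a. (x a + s * Z a \<omega>) + ?t * Z a \<omega>')) \<partial>M) \<le>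
        exp (real j * c) * exp (\<theta> * smoothed \<beta> ?t (\<lambda>a. x a + s * Z a \<omega>))" for \<omega>
      using Suc.IH[of "\<lambda>a. x a + s * Z a \<omega>"] by (simp add: exp_add mult.commute)
  qed
  also have "\<dots> = exp (real j * c) * (\<integral>\<omega>. exp (\<theta> * smoothed \<beta> ?t (\<lambda>a. x a + s * Z a \<omega>)) \<partial>M)"
    by (rule integral_mult_right_zero)
  also have "\<dots> \<le> exp (real j * c) * exp (\<theta> * (\<integral>\<omega>. smoothed \<beta> ?t (\<lambda>a. x a + s * Z a \<omega>) \<partial>M) + c)"
    by (intro mult_left_mono step L smoothed_measurable) auto
  also have "\<dots> = exp (\<theta> * smoothed \<beta> ?r x + real (Suc j) * c)"
  proof -
    have "(\<integral>\<omega>. smoothed \<beta> ?t (\<lambda>a. x a + s * Z a \<omega>) \<partial>M) = smoothed \<beta> ?r x"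
      using B(2) unfolding assoc smoothed_def .
    then show ?thesis by (simp add: algebra_simps flip: exp_add)
  qed
  finally show ?case .
qed

text \<open>With \<open>K\<close> steps of size \<open>1 / sqrt K\<close> the quadratic costs add up
  to \<open>\<theta>\<^sup>2 / 2\<close> and the cubic ones to \<open>C / sqrt K\<close>, which
  disappears in the limit.\<close>

lemma laplace_softmax:
  assumes \<beta>: "0 < \<beta>"
  shows "(\<integral>\<omega>. exp (\<theta> * softmax \<beta> (\<lambda>a. Z a \<omega>)) \<partial>M) \<le> exp (\<theta> * (\<integral>\<omega>. softmax \<beta> (\<lambda>a. Z a \<omega>) \<partial>M) + \<theta>\<^sup>2 / 2)"
proof -
  obtain C where C: "0 \<le> C" "\<And>f x s. lipschitz1 f \<Longrightarrow> smooth_max (2 * \<beta>) f \<Longrightarrow>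
      (\<lambda>\<omega>. f (\<lambda>a. x a + s * Z a \<omega>)) \<in> borel_measurable M \<Longrightarrow> 0 \<le> s \<Longrightarrow> s \<le> 1 \<Longrightarrow>
      (\<integral>\<omega>. exp (\<theta> * f (\<lambda>a. x a + s * Z a \<omega>)) \<partial>M)
        \<le> exp (\<theta> * (\<integral>\<omega>. f (\<lambda>a. x a + s * Z a \<omega>) \<partial>M) + \<theta>\<^sup>2 * s\<^sup>2 / 2 + C * s ^ 3)"
    using laplace_small_step[of "2 * \<beta>" \<theta>] \<beta> by auto
  let ?L = "\<integral>\<omega>. exp (\<theta> * softmax \<beta> (\<lambda>a. Z a \<omega>)) \<partial>M" and ?m = "\<integral>\<omega>. softmax \<beta> (\<lambda>a. Z a \<omega>) \<partial>M"
  have K: "?L \<le> exp (\<theta> * ?m + \<theta>\<^sup>2 / 2 + C / sqrt (real K))" if K: "K \<ge> 1" for K :: nat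
  proof -
    define s where "s = 1 / sqrt (real K)"
    have s: "0 \<le> s" "s \<le> 1" using K by (auto simp: s_def)
    have s2: "real K * s\<^sup>2 = 1" using K by (simp add: s_def power_divide)
    have "?L \<le> exp (\<theta> * ?m + real K * (\<theta>\<^sup>2 * s\<^sup>2 / 2 + C * s ^ 3))"
      using laplace_steps[OF \<beta> s, where \<theta>=\<theta> and c="\<theta>\<^sup>2 * s\<^sup>2 / 2 + C * s ^ 3" and j=K and x="\<lambda>_. 0"] C(2)[of _ _ s] s s2
      by (simp add: smoothed_def add.assoc)
    moreover have "real K * (\<theta>\<^sup>2 * s\<^sup>2 / 2 + C * s ^ 3) = \<theta>\<^sup>2 / 2 * (real K * s\<^sup>2) + C * s * (real K * s\<^sup>2)"
      by (simp add: algebra_simps power2_eq_square power3_eq_cube)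
    moreover have "\<theta>\<^sup>2 / 2 * (real K * s\<^sup>2) + C * s * (real K * s\<^sup>2) = \<theta>\<^sup>2 / 2 + C / sqrt (real K)"
      unfolding s2 by (simp add: s_def)
    ultimately show ?thesis by (simp add: add.assoc)
  qed
  have "(\<lambda>K. exp (\<theta> * ?m + \<theta>\<^sup>2 / 2 + C / sqrt (real K))) \<longlonglongrightarrow> exp (\<theta> * ?m + \<theta>\<^sup>2 / 2 + 0)"
    by (intro tendsto_intros) real_asymp
  then show ?thesis
    using K by (intro LIMSEQ_le_const) auto
qed

section \<open>Laplace transform and tails of the maximum itself\<close>

definition maxZ :: "'w \<Rightarrow> real" where "maxZ \<omega> = Max ((\<lambda>a. Z a \<omega>) ` I)"

lemma maxZ_measurable[measurable]: "maxZ \<in> borel_measurable M"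
  unfolding maxZ_def[abs_def] using finite_I by measurable

lemma maxZ_softmax:
  assumes \<beta>: "0 < \<beta>"
  shows "maxZ \<omega> \<le> softmax \<beta> (\<lambda>a. Z a \<omega>)" "softmax \<beta> (\<lambda>a. Z a \<omega>) \<le> maxZ \<omega> + ln (card I) / \<beta>"
proof -
  let ?S = "\<Sum>a\<in>I. exp (\<beta> * Z a \<omega>)"
  have "maxZ \<omega> \<in> (\<lambda>a. Z a \<omega>) ` I" unfolding maxZ_def using finite_I I_nonempty by (intro Max_in) auto
  then obtain a where a: "a \<in> I" "maxZ \<omega> = Z a \<omega>" by auto
  have le: "Z b \<omega> \<le> maxZ \<omega>" if "b \<in> I" for b unfolding maxZ_def using finite_I that by auto
  have c: "card I > 0" using finite_I I_nonempty by (simp add: card_gt_0_iff)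
  have "exp (\<beta> * maxZ \<omega>) \<le> ?S"
    using a member_le_sum[of a I "\<lambda>a. exp (\<beta> * Z a \<omega>)"] finite_I by auto
  then have "\<beta> * maxZ \<omega> \<le> ln ?S" using sum_exp_pos[of "\<lambda>a. \<beta> * Z a \<omega>"] by (simp add: ln_ge_iff)
  then show "maxZ \<omega> \<le> softmax \<beta> (\<lambda>a. Z a \<omega>)" using \<beta> by (simp add: softmax_def field_simps)
  have "?S \<le> (\<Sum>a\<in>I. exp (\<beta> * maxZ \<omega>))" using \<beta> le by (intro sum_mono) auto
  then have "?S \<le> card I * exp (\<beta> * maxZ \<omega>)" by simp
  then have "ln ?S \<le> ln (card I * exp (\<beta> * maxZ \<omega>))"
    using sum_exp_pos[of "\<lambda>a. \<beta> * Z a \<omega>"] c by (subst ln_le_cancel_iff) auto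
  also have "\<dots> = ln (card I) + \<beta> * maxZ \<omega>" using c by (simp add: ln_mult)
  finally show "softmax \<beta> (\<lambda>a. Z a \<omega>) \<le> maxZ \<omega> + ln (card I) / \<beta>" using \<beta> by (simp add: softmax_def field_simps)
qed

lemma abs_maxZ_le: "\<bar>maxZ \<omega>\<bar> \<le> H \<omega>"
proof -
  have "maxZ \<omega> \<in> (\<lambda>a. Z a \<omega>) ` I" unfolding maxZ_def using finite_I I_nonempty by (intro Max_in) auto
  then obtain a where a: "a \<in> I" "maxZ \<omega> = Z a \<omega>" by auto
  then show ?thesis unfolding H_def using member_le_sum[of a I "\<lambda>a. \<bar>Z a \<omega>\<bar>"] finite_I by auto
qed

lemma maxZ_integrable: "integrable M maxZ" "integrable M (\<lambda>\<omega>. exp (\<theta> * maxZ \<omega>))"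
proof -
  show "integrable M maxZ"
    by (rule Bochner_Integration.integrable_bound[OF integrable_H]) (use abs_maxZ_le H_nonneg in auto)
  have "\<theta> * maxZ \<omega> \<le> \<bar>\<theta>\<bar> * H \<omega>" for \<omega>
  proof -
    have "\<theta> * maxZ \<omega> \<le> \<bar>\<theta>\<bar> * \<bar>maxZ \<omega>\<bar>" by (metis abs_ge_self abs_mult)
    also have "\<dots> \<le> \<bar>\<theta>\<bar> * H \<omega>" by (intro mult_left_mono abs_maxZ_le) auto
    finally show ?thesis .
  qed
  then show "integrable M (\<lambda>\<omega>. exp (\<theta> * maxZ \<omega>))"
    by (intro integrable_dominated[where A=1 and c="\<bar>\<theta>\<bar>"]) auto
qed

text \<open>The excess \<open>\<theta>\<^sup>2 / 2\<close> in the estimate for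
  \<open>softmax\<close> does not involve \<open>\<beta>\<close>, so \<open>\<beta>\<close> may tend
  to infinity. The approximation error enters twice, in the exponent and in the mean, hence the
  factor 2.\<close>

lemma laplace_max: "(\<integral>\<omega>. exp (\<theta> * maxZ \<omega>) \<partial>M) \<le> exp (\<theta> * (\<integral>\<omega>. maxZ \<omega> \<partial>M) + \<theta>\<^sup>2 / 2)"
proof -
  let ?m = "\<integral>\<omega>. maxZ \<omega> \<partial>M"
  have B: "(\<integral>\<omega>. exp (\<theta> * maxZ \<omega>) \<partial>M) \<le> exp (\<theta> * ?m + \<theta>\<^sup>2 / 2 + 2 * \<bar>\<theta>\<bar> * (ln (card I) / real n))" if n: "n \<ge> 1" for n :: nat
  proof -
    let ?\<beta> = "real n"
    have \<beta>: "0 < ?\<beta>" using n by simp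
    let ?e = "ln (card I) / ?\<beta>"
    let ?f = "\<lambda>\<omega>. softmax ?\<beta> (\<lambda>a. Z a \<omega>)"
    have if1: "integrable M ?f" and if2: "integrable M (\<lambda>\<omega>. exp (\<theta> * ?f \<omega>))"
      using softmax_integrable[OF \<beta>, where r=1 and x="\<lambda>_. 0"] by simp_all
    note b = maxZ_softmax[OF \<beta>]
    have near: "\<theta> * u \<le> \<theta> * v + \<bar>\<theta>\<bar> * ?e" if "\<bar>u - v\<bar> \<le> ?e" for u v
    proof -
      have "\<theta> * (u - v) \<le> \<bar>\<theta>\<bar> * \<bar>u - v\<bar>" by (metis abs_ge_self abs_mult)
      also have "\<dots> \<le> \<bar>\<theta>\<bar> * ?e" using that by (rule mult_left_mono) simp
      finally show ?thesis by (simp add: algebra_simps)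
    qed
    have m: "?m \<le> (\<integral>\<omega>. ?f \<omega> \<partial>M)" using b by (intro integral_mono if1 maxZ_integrable)
    have "(\<integral>\<omega>. ?f \<omega> \<partial>M) \<le> (\<integral>\<omega>. maxZ \<omega> + ?e \<partial>M)" using b by (intro integral_mono if1 Bochner_Integration.integrable_add maxZ_integrable integrable_const)
    then have m': "(\<integral>\<omega>. ?f \<omega> \<partial>M) \<le> ?m + ?e" using maxZ_integrable by (simp add: prob_space)
    have "(\<integral>\<omega>. exp (\<theta> * maxZ \<omega>) \<partial>M) \<le> (\<integral>\<omega>. exp (\<bar>\<theta>\<bar> * ?e) * exp (\<theta> * ?f \<omega>) \<partial>M)"
    proof (intro integral_mono maxZ_integrable integrable_mult_right if2)
      fix \<omega>
      have "\<bar>maxZ \<omega> - ?f \<omega>\<bar> \<le> ?e" using b[of \<omega>] by linarith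
      from near[OF this] show "exp (\<theta> * maxZ \<omega>) \<le> exp (\<bar>\<theta>\<bar> * ?e) * exp (\<theta> * ?f \<omega>)" by (simp add: add.commute flip: exp_add)
    qed
    also have "\<dots> = exp (\<bar>\<theta>\<bar> * ?e) * (\<integral>\<omega>. exp (\<theta> * ?f \<omega>) \<partial>M)" by (rule integral_mult_right_zero)
    also have "\<dots> \<le> exp (\<bar>\<theta>\<bar> * ?e) * exp (\<theta> * (\<integral>\<omega>. ?f \<omega> \<partial>M) + \<theta>\<^sup>2 / 2)"
      by (intro mult_left_mono laplace_softmax \<beta>) simp
    also have "\<dots> = exp (\<bar>\<theta>\<bar> * ?e + \<theta> * (\<integral>\<omega>. ?f \<omega> \<partial>M) + \<theta>\<^sup>2 / 2)" by (simp add: algebra_simps flip: exp_add)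
    also have "\<dots> \<le> exp (\<theta> * ?m + \<theta>\<^sup>2 / 2 + 2 * \<bar>\<theta>\<bar> * ?e)"
    proof -
      have "\<bar>(\<integral>\<omega>. ?f \<omega> \<partial>M) - ?m\<bar> \<le> ?e" using m m' by linarith
      from near[OF this] show ?thesis by simp
    qed
    finally show ?thesis .
  qed
  have "(\<lambda>n. exp (\<theta> * ?m + \<theta>\<^sup>2 / 2 + 2 * \<bar>\<theta>\<bar> * (ln (card I) / real n))) \<longlonglongrightarrow> exp (\<theta> * ?m + \<theta>\<^sup>2 / 2 + 2 * \<bar>\<theta>\<bar> * 0)"
    by (intro tendsto_intros)
  then show ?thesis using B by (intro LIMSEQ_le_const) auto
qed

text \<open>Chernoff's bound at the optimal parameter \<open>\<theta> = v\<close>.\<close>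

lemma borell_upper:
  assumes v: "0 \<le> v"
  shows "measure M {\<omega>\<in>space M. maxZ \<omega> \<ge> (\<integral>\<omega>. maxZ \<omega> \<partial>M) + v} \<le> exp (- v\<^sup>2 / 2)"
proof -
  let ?m = "\<integral>\<omega>. maxZ \<omega> \<partial>M"
  let ?A = "{\<omega>\<in>space M. maxZ \<omega> \<ge> ?m + v}"
  have "measure M ?A = (\<integral>\<omega>. indicator ?A \<omega> \<partial>M)" by (simp add: Int_absorb2 subset_eq)
  also have "\<dots> \<le> (\<integral>\<omega>. exp (- v * (?m + v)) * exp (v * maxZ \<omega>) \<partial>M)"
  proof (intro integral_mono integrable_mult_right maxZ_integrable)
    show "integrable M (indicator ?A :: _ \<Rightarrow> real)" by (simp add: emeasure_eq_measure)
    show "indicator ?A \<omega> \<le> exp (- v * (?m + v)) * exp (v * maxZ \<omega>)" for \<omega>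
      using v mult_left_mono[of "?m + v" "maxZ \<omega>" v] by (auto split: split_indicator simp flip: exp_add)
  qed
  also have "\<dots> = exp (- v * (?m + v)) * (\<integral>\<omega>. exp (v * maxZ \<omega>) \<partial>M)" by (rule integral_mult_right_zero)
  also have "\<dots> \<le> exp (- v * (?m + v)) * exp (v * ?m + v\<^sup>2 / 2)"
    by (intro mult_left_mono laplace_max) simp
  also have "\<dots> = exp (- v\<^sup>2 / 2)" by (simp add: algebra_simps power2_eq_square flip: exp_add)
  finally show ?thesis .
qed

text \<open>Chernoff's bound at \<open>\<theta> = - v\<close>. The lower tail serves to bound the
  mean of a maximum by a quantile.\<close>

lemma borell_lower:
  assumes v: "0 \<le> v"
  shows "measure M {\<omega>\<in>space M. maxZ \<omega> \<le> (\<integral>\<omega>. maxZ \<omega> \<partial>M) - v} \<le> exp (- v\<^sup>2 / 2)"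
proof -
  let ?m = "\<integral>\<omega>. maxZ \<omega> \<partial>M"
  let ?A = "{\<omega>\<in>space M. maxZ \<omega> \<le> ?m - v}"
  have "measure M ?A = (\<integral>\<omega>. indicator ?A \<omega> \<partial>M)" by (simp add: Int_absorb2 subset_eq)
  also have "\<dots> \<le> (\<integral>\<omega>. exp (v * (?m - v)) * exp ((- v) * maxZ \<omega>) \<partial>M)"
  proof (intro integral_mono integrable_mult_right maxZ_integrable)
    show "integrable M (indicator ?A :: _ \<Rightarrow> real)" by (simp add: emeasure_eq_measure)
    show "indicator ?A \<omega> \<le> exp (v * (?m - v)) * exp ((- v) * maxZ \<omega>)" for \<omega>
      using v mult_left_mono[of "maxZ \<omega>" "?m - v" v] by (auto split: split_indicator simp flip: exp_add)
  qed
  also have "\<dots> = exp (v * (?m - v)) * (\<integral>\<omega>. exp ((- v) * maxZ \<omega>) \<partial>M)" by (rule integral_mult_right_zero)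
  also have "\<dots> \<le> exp (v * (?m - v)) * exp ((- v) * ?m + (- v)\<^sup>2 / 2)"
    by (intro mult_left_mono laplace_max) simp
  also have "\<dots> = exp (- v\<^sup>2 / 2)" by (simp add: algebra_simps power2_eq_square flip: exp_add)
  finally show ?thesis .
qed

end

section \<open>Countable families\<close>

definition gaussian_family :: "'w measure \<Rightarrow> 'i set \<Rightarrow> ('i \<Rightarrow> 'w \<Rightarrow> real) \<Rightarrow> bool" where
  "gaussian_family M A Z \<longleftrightarrow>
     (\<forall>F c. finite F \<and> F \<subseteq> A \<longrightarrow> centered_gaussian_rv M (\<lambda>\<omega>. \<Sum>a\<in>F. c a * Z a \<omega>))"

lemma gaussian_familyD: "gaussian_family M A Z \<Longrightarrow> finite F \<Longrightarrow> F \<subseteq> A \<Longrightarrow> centered_gaussian_rv M (\<lambda>\<omega>. \<Sum>a\<in>F. c a * Z a \<omega>)"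
  unfolding gaussian_family_def by blast

lemma gaussian_family_subset: "gaussian_family M A Z \<Longrightarrow> B \<subseteq> A \<Longrightarrow> gaussian_family M B Z"
  unfolding gaussian_family_def by blast

lemma gaussian_family_single: "gaussian_family M A Z \<Longrightarrow> a \<in> A \<Longrightarrow> centered_gaussian_rv M (Z a)"
  using gaussian_familyD[of M A Z "{a}" "\<lambda>_. 1"] by simp

lemma gaussian_family_scale: "gaussian_family M A Z \<Longrightarrow> gaussian_family M A (\<lambda>a \<omega>. Z a \<omega> / \<sigma>)"
  unfolding gaussian_family_def
proof (intro allI impI)
  fix F and c :: "'b \<Rightarrow> real"
  assume *: "\<forall>F c. finite F \<and> F \<subseteq> A \<longrightarrow> centered_gaussian_rv M (\<lambda>\<omega>. \<Sum>a\<in>F. c a * Z a \<omega>)" and F: "finite F \<and> F \<subseteq> A"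
  have "centered_gaussian_rv M (\<lambda>\<omega>. \<Sum>a\<in>F. (c a / \<sigma>) * Z a \<omega>)"
    using *[rule_format, OF F, of "\<lambda>a. c a / \<sigma>"] .
  then show "centered_gaussian_rv M (\<lambda>\<omega>. \<Sum>a\<in>F. c a * (Z a \<omega> / \<sigma>))" by simp
qed

lemma gaussian_family_diff:
  assumes Z: "gaussian_family M A Z" and a0: "a0 \<in> A"
  shows "gaussian_family M A (\<lambda>a \<omega>. Z a \<omega> - Z a0 \<omega>)"
  unfolding gaussian_family_def
proof (intro allI impI)
  fix F and c :: "'b \<Rightarrow> real"
  assume F: "finite F \<and> F \<subseteq> A"
  \<comment> \<open>The coefficient of \<open>a0\<close> receives minus the sum of all coefficients;
    the two separate conditionals also cover the case \<open>a0 \<in> F\<close>.\<close>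
  let ?c = "\<lambda>a. (if a \<in> F then c a else 0) - (if a = a0 then (\<Sum>b\<in>F. c b) else 0)"
  have "centered_gaussian_rv M (\<lambda>\<omega>. \<Sum>a\<in>insert a0 F. ?c a * Z a \<omega>)"
    using F a0 by (intro gaussian_familyD[OF Z]) auto
  moreover have "(\<Sum>a\<in>insert a0 F. ?c a * z a) = (\<Sum>a\<in>F. c a * (z a - z a0))" for z :: "'b \<Rightarrow> real"
  proof -
    have "(\<Sum>a\<in>insert a0 F. ?c a * z a) = (\<Sum>a\<in>insert a0 F. (if a \<in> F then c a * z a else 0)) -
        (\<Sum>a\<in>insert a0 F. if a = a0 then (\<Sum>b\<in>F. c b) * z a0 else 0)"
      unfolding sum_subtractf[symmetric] by (intro sum.cong refl) (auto simp: left_diff_distrib)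
    moreover have "(\<Sum>a\<in>insert a0 F. (if a \<in> F then c a * z a else 0)) = (\<Sum>a\<in>F. c a * z a)"
      using F by (intro sum.mono_neutral_cong_right) auto
    moreover have "(\<Sum>a\<in>insert a0 F. if a = a0 then (\<Sum>b\<in>F. c b) * z a0 else 0) = (\<Sum>b\<in>F. c b) * z a0"
      using F by simp
    ultimately show ?thesis by (simp only: right_diff_distrib sum_subtractf sum_distrib_right)
  qed
  ultimately show "centered_gaussian_rv M (\<lambda>\<omega>. \<Sum>a\<in>F. c a * (Z a \<omega> - Z a0 \<omega>))" by simp
qed

lemma finite_gaussianI:
  assumes "prob_space M" "gaussian_family M A Z" "\<And>a. a \<in> A \<Longrightarrow> (\<integral>\<omega>. (Z a \<omega>)\<^sup>2 \<partial>M) \<le> 1"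
    "finite F" "F \<noteq> {}" "F \<subseteq> A"
  shows "finite_gaussian M F Z"
  using assms gaussian_familyD[OF assms(2,4,6)]
  by (intro finite_gaussian.intro finite_gaussian_axioms.intro) auto

text \<open>The finite bound depends on the number of variables only through the mean, which
  \<open>m\<close> controls uniformly. Exhaustion of \<open>A\<close> by finite sets and continuity
  from below do the rest, so the expectation of the full supremum never appears.\<close>

lemma borell_countable:
  assumes M: "prob_space M" and Z: "gaussian_family M A Z" and A: "countable A"
    and var: "\<And>a. a \<in> A \<Longrightarrow> (\<integral>\<omega>. (Z a \<omega>)\<^sup>2 \<partial>M) \<le> 1"
    and m: "\<And>F. finite F \<Longrightarrow> F \<noteq> {} \<Longrightarrow> F \<subseteq> A \<Longrightarrow> (\<integral>\<omega>. Max ((\<lambda>a. Z a \<omega>) ` F) \<partial>M) \<le> m"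
    and v: "0 \<le> v"
  shows "measure M {\<omega>\<in>space M. \<exists>a\<in>A. Z a \<omega> > m + v} \<le> exp (- v\<^sup>2 / 2)"
proof (cases "A = {}")
  case True
  then show ?thesis by simp
next
  case False
  interpret prob_space M by fact
  have [measurable]: "a \<in> A \<Longrightarrow> Z a \<in> borel_measurable M" for a
    using cgrv_measurable[OF gaussian_family_single[OF Z]] .
  define F where "F n = from_nat_into A ` {..n}" for n
  have F: "finite (F n)" "F n \<noteq> {}" "F n \<subseteq> A" for n
    using from_nat_into[OF False] by (auto simp: F_def)
  have FA: "(\<Union>n. F n) = A"
    using from_nat_into_surj[OF A] from_nat_into[OF False] by (fastforce simp: F_def)
  define E where "E n = {\<omega>\<in>space M. \<exists>a\<in>F n. Z a \<omega> > m + v}" for n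
  have mF: "a \<in> F n \<Longrightarrow> Z a \<in> borel_measurable M" for a n
    using F(3) cgrv_measurable[OF gaussian_family_single[OF Z]] by blast
  have Em: "E n \<in> events" for n
  proof -
    have "E n = (\<Union>a\<in>F n. {\<omega>\<in>space M. Z a \<omega> > m + v})" by (auto simp: E_def)
    also have "\<dots> \<in> events" using F(1) mF by (intro sets.finite_UN) (auto intro: borel_measurable_less)
    finally show ?thesis .
  qed
  have inc: "incseq E"
  proof (rule incseq_SucI)
    show "E n \<subseteq> E (Suc n)" for n by (auto simp: E_def F_def)
  qed
  have UE: "(\<Union>n. E n) = {\<omega>\<in>space M. \<exists>a\<in>A. Z a \<omega> > m + v}"
    unfolding FA[symmetric] by (auto simp: E_def)
  have bound: "measure M (E n) \<le> exp (- v\<^sup>2 / 2)" for n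
  proof -
    interpret G: finite_gaussian M "F n" Z by (rule finite_gaussianI[OF M Z var F])
    have "measure M (E n) \<le> measure M {\<omega>\<in>space M. G.maxZ \<omega> \<ge> (\<integral>\<omega>. G.maxZ \<omega> \<partial>M) + v}"
    proof (rule finite_measure_mono)
      show "E n \<subseteq> {\<omega>\<in>space M. G.maxZ \<omega> \<ge> (\<integral>\<omega>. G.maxZ \<omega> \<partial>M) + v}"
      proof
        fix \<omega> assume "\<omega> \<in> E n"
        then obtain a where a: "a \<in> F n" "Z a \<omega> > m + v" "\<omega> \<in> space M" by (auto simp: E_def)
        have "Z a \<omega> \<le> G.maxZ \<omega>" unfolding G.maxZ_def using a F by auto
        then show "\<omega> \<in> {\<omega>\<in>space M. G.maxZ \<omega> \<ge> (\<integral>\<omega>. G.maxZ \<omega> \<partial>M) + v}"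
          using a m[OF F, of n] unfolding G.maxZ_def by auto
      qed
    qed measurable
    also have "\<dots> \<le> exp (- v\<^sup>2 / 2)" by (rule G.borell_upper[OF v])
    finally show ?thesis .
  qed
  have "(\<lambda>n. measure M (E n)) \<longlonglongrightarrow> measure M (\<Union>n. E n)"
    using Em inc by (intro finite_Lim_measure_incseq) auto
  then have "measure M (\<Union>n. E n) \<le> exp (- v\<^sup>2 / 2)"
    by (rule LIMSEQ_le_const2) (use bound in auto)
  then show ?thesis unfolding UE .
qed

text \<open>If a finite maximum had mean above \<open>q + 2 * \<sigma>\<close>, the lower tail at
  distance 2, in units of \<open>\<sigma>\<close>, would leave the event in \<open>half\<close> a
  probability of at most \<open>exp (- 2)\<close>, which is below 1/2.\<close>

lemma expectation_max_le:
  assumes M: "prob_space M" and Z: "gaussian_family M A Z"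
    and \<sigma>: "0 < \<sigma>" and var: "\<And>a. a \<in> A \<Longrightarrow> (\<integral>\<omega>. (Z a \<omega>)\<^sup>2 \<partial>M) \<le> \<sigma>\<^sup>2"
    and A: "countable A" and half: "1/2 \<le> measure M {\<omega>\<in>space M. \<forall>a\<in>A. Z a \<omega> \<le> q}"
    and F: "finite F" "F \<noteq> {}" "F \<subseteq> A"
  shows "(\<integral>\<omega>. Max ((\<lambda>a. Z a \<omega>) ` F) \<partial>M) \<le> q + 2 * \<sigma>"
proof (rule ccontr)
  assume neg: "\<not> ?thesis"
  interpret prob_space M by fact
  have [measurable]: "a \<in> A \<Longrightarrow> Z a \<in> borel_measurable M" for a
    using cgrv_measurable[OF gaussian_family_single[OF Z]] .
  have v1: "(\<integral>\<omega>. (Z a \<omega> / \<sigma>)\<^sup>2 \<partial>M) \<le> 1" if "a \<in> A" for a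
    using var[OF that] \<sigma> by (simp add: power_divide divide_le_eq_1)
  interpret G: finite_gaussian M F "\<lambda>a \<omega>. Z a \<omega> / \<sigma>"
    by (rule finite_gaussianI[OF M gaussian_family_scale[OF Z] v1 F])
  have mx: "G.maxZ \<omega> = Max ((\<lambda>a. Z a \<omega>) ` F) / \<sigma>" for \<omega>
    unfolding G.maxZ_def using F \<sigma>
    by (subst mono_Max_commute[of "\<lambda>x. x / \<sigma>"]) (auto simp: image_image mono_def divide_right_mono)
  have E: "(\<integral>\<omega>. G.maxZ \<omega> \<partial>M) > q / \<sigma> + 2"
  proof -
    have "(q + 2 * \<sigma>) / \<sigma> < (\<integral>\<omega>. Max ((\<lambda>a. Z a \<omega>) ` F) \<partial>M) / \<sigma>"
      using neg \<sigma> by (intro divide_strict_right_mono) auto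
    then show ?thesis unfolding mx using \<sigma> by (simp add: add_divide_distrib)
  qed
  have "1/2 \<le> measure M {\<omega>\<in>space M. \<forall>a\<in>A. Z a \<omega> \<le> q}" by (rule half)
  also have "\<dots> \<le> measure M {\<omega>\<in>space M. G.maxZ \<omega> \<le> (\<integral>\<omega>. G.maxZ \<omega> \<partial>M) - 2}"
  proof (rule finite_measure_mono)
    show "{\<omega>\<in>space M. \<forall>a\<in>A. Z a \<omega> \<le> q} \<subseteq> {\<omega>\<in>space M. G.maxZ \<omega> \<le> (\<integral>\<omega>. G.maxZ \<omega> \<partial>M) - 2}"
    proof safe
      fix \<omega> assume "\<omega> \<in> space M" "\<forall>a\<in>A. Z a \<omega> \<le> q"
      then have "Max ((\<lambda>a. Z a \<omega>) ` F) \<le> q" using F by auto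
      then have "G.maxZ \<omega> \<le> q / \<sigma>" unfolding mx using \<sigma> by (simp add: divide_right_mono)
      then show "G.maxZ \<omega> \<le> (\<integral>\<omega>. G.maxZ \<omega> \<partial>M) - 2" using E by linarith
    qed
  qed measurable
  also have "\<dots> \<le> exp (- 2\<^sup>2 / 2)" by (rule G.borell_lower) simp
  also have "\<dots> < 1/2"
  proof -
    have "3 \<le> exp (2::real)" using exp_ge_add_one_self[of 2] by simp
    then show ?thesis by (simp add: exp_minus field_simps)
  qed
  finally show False by simp
qed

text \<open>Subtracting the centred variable \<open>Z a0\<close> does not change the expected maximum. This is what lets
  small pieces of the index set contribute only \<open>O(\<epsilon>)\<close>, although \<open>Z\<close> itself is not small there.\<close>

lemma expectation_max_le_oscillation:
  assumes M: "prob_space M" and Z: "gaussian_family M (insert a0 A) Z"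
    and A: "countable A" and \<epsilon>: "0 < \<epsilon>"
    and half: "1/2 \<le> measure M {\<omega>\<in>space M. \<forall>a\<in>A. \<bar>Z a \<omega> - Z a0 \<omega>\<bar> \<le> \<epsilon>}"
    and F: "finite F" "F \<noteq> {}" "F \<subseteq> A"
  shows "(\<integral>\<omega>. Max ((\<lambda>a. Z a \<omega>) ` F) \<partial>M) \<le> 5 * \<epsilon>"
proof -
  interpret prob_space M by fact
  let ?V = "\<lambda>a \<omega>. Z a \<omega> - Z a0 \<omega>"
  have V: "gaussian_family M A ?V"
    using gaussian_family_subset[OF gaussian_family_diff[OF Z]] by blast
  have g0: "centered_gaussian_rv M (Z a0)" using gaussian_family_single[OF Z] by simp
  have mV[measurable]: "a \<in> A \<Longrightarrow> ?V a \<in> borel_measurable M" for a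
    using cgrv_measurable[OF gaussian_family_single[OF V]] .
  have mZ: "a \<in> A \<Longrightarrow> centered_gaussian_rv M (Z a)" for a using gaussian_family_single[OF Z] by simp
  \<comment> \<open>The same event also controls the variances of the differences, through the
    quantile bound for a single Gaussian variable.\<close>
  have var: "(\<integral>\<omega>. (?V a \<omega>)\<^sup>2 \<partial>M) \<le> (2 * \<epsilon>)\<^sup>2" if a: "a \<in> A" for a
  proof -
    have "1/2 \<le> measure M {\<omega>\<in>space M. \<bar>?V a \<omega>\<bar> \<le> \<epsilon>}"
      using a mV[OF a] by (intro order.trans[OF half] finite_measure_mono) auto
    then have "sqrt (\<integral>\<omega>. (?V a \<omega>)\<^sup>2 \<partial>M) \<le> 2 * \<epsilon>"
      by (intro cgrv_sd_le_median M gaussian_family_single[OF V a] \<epsilon>)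
    then show ?thesis using \<epsilon> real_sqrt_le_iff by (metis abs_of_pos mult_pos_pos real_sqrt_abs zero_less_numeral)
  qed
  have half': "1/2 \<le> measure M {\<omega>\<in>space M. \<forall>a\<in>A. ?V a \<omega> \<le> \<epsilon>}"
  proof (rule order.trans[OF half finite_measure_mono])
    show "{\<omega>\<in>space M. \<forall>a\<in>A. ?V a \<omega> \<le> \<epsilon>} \<in> events"
      using A mV by (intro sets.sets_Collect_countable_All') (auto intro!: borel_measurable_le)
  qed (auto simp: abs_le_iff)
  \<comment> \<open>The quantile is \<open>\<epsilon>\<close> and the standard deviations are at
    most \<open>2 * \<epsilon>\<close>; this is where the constant 5 comes from.\<close>
  have "(\<integral>\<omega>. Max ((\<lambda>a. ?V a \<omega>) ` F) \<partial>M) \<le> \<epsilon> + 2 * (2 * \<epsilon>)"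
    using expectation_max_le[OF M V _ var A half' F] \<epsilon> by simp
  moreover have "(\<integral>\<omega>. Max ((\<lambda>a. ?V a \<omega>) ` F) \<partial>M) = (\<integral>\<omega>. Max ((\<lambda>a. Z a \<omega>) ` F) \<partial>M)"
  proof -
    have "Max ((\<lambda>a. ?V a \<omega>) ` F) = Max ((\<lambda>a. Z a \<omega>) ` F) - Z a0 \<omega>" for \<omega>
      using F by (subst mono_Max_commute[of "\<lambda>x. x - Z a0 \<omega>"]) (auto simp: image_image mono_def)
    moreover have "integrable M (\<lambda>\<omega>. Max ((\<lambda>a. Z a \<omega>) ` F))"
    proof (rule Bochner_Integration.integrable_bound[of _ "\<lambda>\<omega>. \<Sum>a\<in>F. \<bar>Z a \<omega>\<bar>"])
      show "integrable M (\<lambda>\<omega>. \<Sum>a\<in>F. \<bar>Z a \<omega>\<bar>)"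
        using F mZ by (intro Bochner_Integration.integrable_sum integrable_abs cgrv_mean(1) M) auto
      show "(\<lambda>\<omega>. Max ((\<lambda>a. Z a \<omega>) ` F)) \<in> borel_measurable M"
        using F mZ cgrv_measurable by (intro borel_measurable_Max) auto
      show "AE \<omega> in M. norm (Max ((\<lambda>a. Z a \<omega>) ` F)) \<le> norm (\<Sum>a\<in>F. \<bar>Z a \<omega>\<bar>)"
      proof (rule AE_I2)
        fix \<omega>
        have "Max ((\<lambda>a. Z a \<omega>) ` F) \<in> (\<lambda>a. Z a \<omega>) ` F" using F by (intro Max_in) auto
        then obtain a where "a \<in> F" "Max ((\<lambda>a. Z a \<omega>) ` F) = Z a \<omega>" by auto
        then show "norm (Max ((\<lambda>a. Z a \<omega>) ` F)) \<le> norm (\<Sum>a\<in>F. \<bar>Z a \<omega>\<bar>)"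
          using member_le_sum[of a F "\<lambda>a. \<bar>Z a \<omega>\<bar>"] F by (auto simp: sum_nonneg)
      qed
    qed
    ultimately show ?thesis using cgrv_mean[OF M g0] by simp
  qed
  ultimately show ?thesis by simp
qed

text \<open>Up to a constant the terms are \<open>exp (- \<epsilon> * sqrt (2 * ln n)) / n\<close>,
  which no \<open>n powr (- 1 - c)\<close> with \<open>c > 0\<close> dominates. Cauchy condensation
  removes the factor \<open>1 / n\<close> and leaves an exponential in
  \<open>sqrt n\<close>.\<close>

lemma summable_gaussian_tail:
  assumes \<epsilon>: "0 < \<epsilon>"
  shows "summable (\<lambda>n. exp (- (sqrt (2 * ln (real n)) + \<epsilon>)\<^sup>2 / 2))"
proof -
  let ?f = "\<lambda>n. exp (- (sqrt (2 * ln (real n)) + \<epsilon>)\<^sup>2 / 2)"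
  have "summable ?f \<longleftrightarrow> summable (\<lambda>n. 2 ^ n * ?f (2 ^ n))"
  proof (rule condensation_test)
    fix m :: nat assume "0 < m"
    then show "?f (Suc m) \<le> ?f m"
      using \<epsilon> by (auto intro!: power_mono add_mono)
  qed simp
  moreover have "summable (\<lambda>n. 2 ^ n * ?f (2 ^ n))"
  proof (rule summable_comparison_test_ev)
    have eq: "2 ^ n * ?f (2 ^ n) = exp (- \<epsilon> * sqrt (2 * (ln 2 * real n)) - \<epsilon>\<^sup>2 / 2)" for n
    proof -
      have l: "ln (real (2 ^ n)) = ln 2 * real n" by (simp add: ln_realpow)
      have "(2::real) ^ n = exp (ln 2 * real n)" by (simp add: exp_of_nat2_mult)
      moreover define r where "r = sqrt (2 * (ln 2 * real n))"
      have "r\<^sup>2 = 2 * (ln 2 * real n)" unfolding r_def by (rule real_sqrt_pow2) simp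
      then have "- (r + \<epsilon>)\<^sup>2 / 2 = - (ln 2 * real n) + (- \<epsilon> * r - \<epsilon>\<^sup>2 / 2)"
        by (simp add: power2_sum field_simps)
      ultimately show ?thesis unfolding l r_def[symmetric] by (simp flip: exp_add)
    qed
    show "\<forall>\<^sub>F n in sequentially. norm (2 ^ n * ?f (2 ^ n)) \<le> real n powr (-2)"
      unfolding eq real_norm_def using \<epsilon> by real_asymp
    show "summable (\<lambda>n. real n powr (-2))" by (simp add: summable_real_powr_iff)
  qed
  ultimately show ?thesis by simp
qed

section \<open>Square roots of positive semidefinite matrices\<close>

lemma quadratic_nonneg_linear_zero:
  fixes b c :: real
  assumes "\<And>t. 0 \<le> 2 * t * b + t\<^sup>2 * c"
  shows "b = 0"
proof -
  \<comment> \<open>The polynomial is evaluated at \<open>t = - b / k\<close>; taking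
    \<open>k\<close> larger than \<open>\<bar>c\<bar>\<close> makes its value negative for either
    sign of \<open>c\<close> unless \<open>b = 0\<close>.\<close>
  define k where "k = \<bar>c\<bar> + 1"
  have k: "0 < k" "c \<le> k" by (auto simp: k_def)
  have "0 \<le> 2 * (- b / k) * b + (- b / k)\<^sup>2 * c" by (rule assms)
  also have "\<dots> \<le> 2 * (- b / k) * b + (- b / k)\<^sup>2 * k" using k by (intro add_left_mono mult_left_mono) auto
  also have "\<dots> = - (b\<^sup>2 / k)" using k by (simp add: power2_eq_square field_simps)
  finally have "b\<^sup>2 / k \<le> 0" by simp
  then show ?thesis using k by (simp add: divide_le_0_iff)
qed

text \<open>The spectral theorem by induction on the dimension: a maximiser of the quadratic form on
  the unit sphere of \<open>S\<close> is an eigenvector, and its orthogonal complement in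
  \<open>S\<close> is invariant. The last clause makes the root from the smaller subspace vanish at
  the eigenvector, so that the rank one part can simply be added.\<close>

lemma sqrt_on_subspace:
  fixes f :: "'a::euclidean_space \<Rightarrow> 'a"
  assumes f: "linear f" and sym: "\<And>x y. f x \<bullet> y = x \<bullet> f y" and pos: "\<And>x. 0 \<le> f x \<bullet> x"
    and S: "subspace S" "\<And>x. x \<in> S \<Longrightarrow> f x \<in> S"
  shows "\<exists>g. linear g \<and> (\<forall>x y. g x \<bullet> y = x \<bullet> g y) \<and> (\<forall>x. 0 \<le> g x \<bullet> x) \<and>
     (\<forall>x\<in>S. g (g x) = f x) \<and> (\<forall>x. (\<forall>y\<in>S. x \<bullet> y = 0) \<longrightarrow> g x = 0)"
  using S
proof (induction "dim S" arbitrary: S rule: less_induct)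
  case less
  show ?case
  proof (cases "S \<subseteq> {0}")
    case True
    then show ?thesis using f by (intro exI[of _ "\<lambda>_. 0"]) (auto simp: linear_0 module_hom_zero linear_iff)
  next
    case False
    then obtain x0 where x0: "x0 \<in> S" "x0 \<noteq> 0" by auto
    have "compact (sphere 0 1 \<inter> S)"
      using closed_subspace[OF less.prems(1)] by (intro compact_Int_closed) auto
    moreover have cont: "continuous_on (sphere 0 1 \<inter> S) (\<lambda>x. f x \<bullet> x)"
      using f by (intro continuous_on_inner linear_continuous_on continuous_on_id) (simp add: linear_conv_bounded_linear)
    moreover have "x0 /\<^sub>R norm x0 \<in> sphere 0 1 \<inter> S"
      using x0 less.prems(1) by (auto simp: subspace_scale)
    ultimately obtain v where v: "v \<in> sphere 0 1 \<inter> S" "\<And>x. x \<in> sphere 0 1 \<inter> S \<Longrightarrow> f x \<bullet> x \<le> f v \<bullet> v"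
      using continuous_attains_sup[OF _ _ cont] by blast
    define l where "l = f v \<bullet> v"
    have l: "0 \<le> l" unfolding l_def by (rule pos)
    have vS: "v \<in> S" and vv: "v \<bullet> v = 1" using v by (auto simp: norm_eq_1)
    have le: "f x \<bullet> x \<le> l * (x \<bullet> x)" if x: "x \<in> S" for x
    proof (cases "x = 0")
      case False
      let ?y = "x /\<^sub>R norm x"
      have "f ?y \<bullet> ?y \<le> l" unfolding l_def
        by (rule v(2)) (use x False less.prems(1) in \<open>auto simp: subspace_scale\<close>)
      moreover have "f ?y \<bullet> ?y = (f x \<bullet> x) / (x \<bullet> x)"
        using f by (simp add: linear_cmul dot_square_norm power2_eq_square divide_inverse mult_ac)
      ultimately show ?thesis using False by (simp add: pos_divide_le_eq)
    qed (simp add: f linear_0)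
    \<comment> \<open>First order optimality: \<open>l * (x \<bullet> x) - f x \<bullet> x\<close>
      is nonnegative on \<open>S\<close> and zero at \<open>v\<close>, so its linear part at
      \<open>v\<close> vanishes in every direction of \<open>S\<close>.\<close>
    have fv: "f v = l *\<^sub>R v"
    proof -
      have "l * (v \<bullet> w) - f v \<bullet> w = 0" if w: "w \<in> S" for w
      proof (rule quadratic_nonneg_linear_zero[where c="l * (w \<bullet> w) - f w \<bullet> w"])
        fix t :: real
        have "v + t *\<^sub>R w \<in> S" using vS w less.prems(1) by (intro subspace_add subspace_scale)
        from le[OF this] have "0 \<le> l * ((v + t *\<^sub>R w) \<bullet> (v + t *\<^sub>R w)) - f (v + t *\<^sub>R w) \<bullet> (v + t *\<^sub>R w)" by simp
        also have "f (v + t *\<^sub>R w) = f v + t *\<^sub>R f w" using f by (simp add: linear_add linear_cmul)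
        also have "l * ((v + t *\<^sub>R w) \<bullet> (v + t *\<^sub>R w)) - (f v + t *\<^sub>R f w) \<bullet> (v + t *\<^sub>R w)
           = 2 * t * (l * (v \<bullet> w) - f v \<bullet> w) + t\<^sup>2 * (l * (w \<bullet> w) - f w \<bullet> w)"
          using sym[of w v] vv by (simp add: inner_simps inner_commute l_def power2_eq_square algebra_simps)
        finally show "0 \<le> 2 * t * (l * (v \<bullet> w) - f v \<bullet> w) + t\<^sup>2 * (l * (w \<bullet> w) - f w \<bullet> w)" .
      qed
      then have "(l *\<^sub>R v - f v) \<bullet> w = 0" if "w \<in> S" for w using that by (simp add: inner_diff_left)
      moreover have "l *\<^sub>R v - f v \<in> S" using vS less.prems by (intro subspace_diff subspace_scale)
      ultimately have "(l *\<^sub>R v - f v) \<bullet> (l *\<^sub>R v - f v) = 0" by blast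
      then show ?thesis by simp
    qed
    define S' where "S' = {x \<in> S. x \<bullet> v = 0}"
    have S': "subspace S'"
      using less.prems(1) by (auto simp: S'_def subspace_def inner_add_left)
    have inv: "f x \<in> S'" if "x \<in> S'" for x
      using that less.prems(2) sym[of x v] fv by (auto simp: S'_def)
    have "span S' \<subset> span S"
    proof -
      have "span S' = S'" "span S = S" using S' less.prems(1) by (simp_all only: span_eq_iff)
      moreover have "v \<notin> S'" "S' \<subseteq> S" using vv by (auto simp: S'_def)
      ultimately show ?thesis using vS by (simp only:) blast
    qed
    then have "dim S' < dim S" by (rule dim_psubset)
    from less.hyps[OF this S' inv] obtain g' where g': "linear g'" "\<And>x y. g' x \<bullet> y = x \<bullet> g' y" "\<And>x. 0 \<le> g' x \<bullet> x"
      "\<And>x. x \<in> S' \<Longrightarrow> g' (g' x) = f x" "\<And>x. (\<forall>y\<in>S'. x \<bullet> y = 0) \<Longrightarrow> g' x = 0" by blast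
    have g'v: "g' v = 0" by (rule g'(5)) (auto simp: S'_def inner_commute)
    have vg': "v \<bullet> g' x = 0" for x using g'(2)[of v x] g'v by simp
    define g where "g x = g' x + (sqrt l * (v \<bullet> x)) *\<^sub>R v" for x
    show ?thesis
    proof (intro exI[of _ g] conjI allI ballI impI)
      show "linear g" unfolding g_def
        using g'(1) by (auto simp: linear_iff inner_add_right algebra_simps)
      show "g x \<bullet> y = x \<bullet> g y" for x y
      proof -
        have "g x \<bullet> y = g' x \<bullet> y + sqrt l * (v \<bullet> x) * (v \<bullet> y)" by (simp add: g_def inner_add_left)
        moreover have "x \<bullet> g y = x \<bullet> g' y + sqrt l * (v \<bullet> y) * (v \<bullet> x)"
          by (simp add: g_def inner_add_right inner_commute[of x v])
        ultimately show ?thesis using g'(2)[of x y] by simp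
      qed
      show "0 \<le> g x \<bullet> x" for x
        using g'(3)[of x] l by (simp add: g_def inner_add_left mult.assoc)
      show "g (g x) = f x" if x: "x \<in> S" for x
      proof -
        define y where "y = x - (v \<bullet> x) *\<^sub>R v"
        have "y \<in> S" unfolding y_def using x vS less.prems(1) by (intro subspace_diff subspace_scale)
        moreover have "y \<bullet> v = 0" by (simp add: y_def inner_diff_left vv inner_commute[of x v])
        ultimately have y: "y \<in> S'" by (simp add: S'_def)
        have xy: "x = y + (v \<bullet> x) *\<^sub>R v" by (simp add: y_def)
        have "g' x = g' y" by (subst xy) (simp add: linear_add[OF g'(1)] linear_cmul[OF g'(1)] g'v)
        then have "g (g x) = g' (g' y) + (sqrt l * sqrt l * (v \<bullet> x)) *\<^sub>R v"
          using vv by (simp add: g_def linear_add[OF g'(1)] linear_cmul[OF g'(1)] g'v inner_add_right vg' mult_ac)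
        also have "\<dots> = f y + (v \<bullet> x) *\<^sub>R f v" using l by (simp add: g'(4)[OF y] fv mult.commute)
        also have "\<dots> = f (y + (v \<bullet> x) *\<^sub>R v)" by (simp add: linear_add[OF f] linear_cmul[OF f])
        also have "\<dots> = f x" by (simp flip: xy)
        finally show ?thesis .
      qed
      show "g x = 0" if "\<forall>y\<in>S. x \<bullet> y = 0" for x
        using that vS g'(5)[of x] by (auto simp: g_def S'_def inner_commute)
    qed
  qed
qed

lemma symmetric_matrix_inner:
  fixes A :: "real ^ 'n ^ 'n"
  assumes "transpose A = A"
  shows "(A *v x) \<bullet> y = x \<bullet> (A *v y)"
  using dot_lmul_matrix[of x A y] assms by (simp add: transpose_matrix_vector[symmetric])

text \<open>Nonnegativity of the form along the line \<open>x + t *\<^sub>R y\<close> forces its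
  linear coefficient in \<open>t\<close> to vanish.\<close>

lemma pos_semidef_zero:
  assumes A: "pos_semidef A" and x: "(A *v x) \<bullet> x = 0"
  shows "A *v x = 0"
proof -
  have sym: "(A *v x) \<bullet> y = x \<bullet> (A *v y)" for x y using A by (intro symmetric_matrix_inner) (simp add: pos_semidef_def)
  have "(A *v x) \<bullet> y = 0" for y
  proof (rule quadratic_nonneg_linear_zero[where c="(A *v y) \<bullet> y"])
    fix t :: real
    have "0 \<le> (A *v (x + t *\<^sub>R y)) \<bullet> (x + t *\<^sub>R y)" using A by (simp add: pos_semidef_def)
    also have "\<dots> = 2 * t * ((A *v x) \<bullet> y) + t\<^sup>2 * ((A *v y) \<bullet> y)"
      using x sym[of x y] by (simp add: matrix_vector_right_distrib matrix_vector_mult_scaleR inner_simps inner_commute power2_eq_square algebra_simps)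
    finally show "0 \<le> 2 * t * ((A *v x) \<bullet> y) + t\<^sup>2 * ((A *v y) \<bullet> y)" .
  qed
  then show ?thesis by (metis inner_eq_zero_iff)
qed

text \<open>With \<open>D = S - T\<close> the hypothesis gives \<open>D ** S = - (T ** D)\<close>,
  so \<open>D ** S ** D\<close> and \<open>D ** T ** D\<close> have opposite traces. Both are
  positive semidefinite, so both traces are 0; then \<open>S ** D\<close> and \<open>T ** D\<close>
  vanish, and with them \<open>D ** D\<close>.\<close>

lemma pos_semidef_sqrt_unique:
  assumes S: "pos_semidef S" and T: "pos_semidef T" and ST: "S ** S = T ** T"
  shows "S = T"
proof -
  define D where "D = S - T"
  have symD: "transpose D = D"
    using S T by (simp add: D_def pos_semidef_def transpose_def vec_eq_iff)
  note iD = symmetric_matrix_inner[OF symD]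
  have z: "D *v (S *v x) = - (T *v (D *v x))" for x
    using ST[THEN arg_cong[where f="\<lambda>A. A *v x"]]
    by (simp add: D_def matrix_vector_mult_diff_rdistrib matrix_vector_mult_diff_distrib flip: matrix_vector_mul_assoc)
  have tr: "trace A = (\<Sum>i\<in>UNIV. (A *v axis i 1) \<bullet> axis i 1)" for A :: "real^'a^'a"
    by (simp add: trace_def matrix_vector_mult_basis column_def inner_axis)
  have "(\<Sum>i\<in>UNIV. (S *v (D *v axis i 1)) \<bullet> (D *v axis i 1)) = (\<Sum>i\<in>UNIV. (D *v (S *v (D *v axis i 1))) \<bullet> axis i 1)"
    by (simp add: iD)
  also have "\<dots> = - trace ((T ** D) ** D)"
    unfolding tr z by (simp add: sum_negf flip: matrix_vector_mul_assoc)
  also have "\<dots> = - trace (D ** (T ** D))" by (intro arg_cong[where f=uminus] trace_mul_sym)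
  also have "\<dots> = - (\<Sum>i\<in>UNIV. (T *v (D *v axis i 1)) \<bullet> (D *v axis i 1))"
    unfolding tr by (simp add: iD flip: matrix_vector_mul_assoc)
  finally have diag: "(\<Sum>i\<in>UNIV. (S *v (D *v axis i 1)) \<bullet> (D *v axis i 1)) =
      - (\<Sum>i\<in>UNIV. (T *v (D *v axis i 1)) \<bullet> (D *v axis i 1))" .
  have nn: "0 \<le> (S *v (D *v axis i 1)) \<bullet> (D *v axis i 1)" "0 \<le> (T *v (D *v axis i 1)) \<bullet> (D *v axis i 1)" for i
    using S T by (auto simp: pos_semidef_def)
  then have "0 \<le> (\<Sum>i\<in>UNIV. (S *v (D *v axis i 1)) \<bullet> (D *v axis i 1))" "0 \<le> (\<Sum>i\<in>UNIV. (T *v (D *v axis i 1)) \<bullet> (D *v axis i 1))"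
    by (auto intro: sum_nonneg)
  then have "(\<Sum>i\<in>UNIV. (S *v (D *v axis i 1)) \<bullet> (D *v axis i 1)) = 0" "(\<Sum>i\<in>UNIV. (T *v (D *v axis i 1)) \<bullet> (D *v axis i 1)) = 0"
    using diag by linarith+
  then have "(S *v (D *v axis i 1)) \<bullet> (D *v axis i 1) = 0" "(T *v (D *v axis i 1)) \<bullet> (D *v axis i 1) = 0" for i
    using nn by (auto simp: sum_nonneg_eq_0_iff)
  then have "S *v (D *v axis i 1) = 0" "T *v (D *v axis i 1) = 0" for i
    using pos_semidef_zero[OF S] pos_semidef_zero[OF T] by auto
  then have "D *v (D *v axis i 1) = 0" for i
    by (simp add: D_def matrix_vector_mult_diff_rdistrib)
  then have "(D *v axis i 1) \<bullet> (D *v axis i 1) = 0" for i using iD[of "axis i 1" "D *v axis i 1"] by simp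
  then have "column i D = 0" for i by (simp add: matrix_vector_mult_basis)
  then have "D = 0" by (simp add: column_def vec_eq_iff)
  then show ?thesis by (simp add: D_def)
qed

lemma matrix_sqrt:
  assumes A: "pos_semidef A"
  shows "pos_semidef (matrix_sqrt A)" "matrix_sqrt A ** matrix_sqrt A = A"
proof -
  have sym: "(A *v x) \<bullet> y = x \<bullet> (A *v y)" for x y using A by (intro symmetric_matrix_inner) (simp add: pos_semidef_def)
  obtain g where g: "linear g" "\<And>x y. g x \<bullet> y = x \<bullet> g y" "\<And>x. 0 \<le> g x \<bullet> x" "\<And>x. g (g x) = A *v x"
    using sqrt_on_subspace[of "(*v) A" UNIV] sym A by (auto simp: pos_semidef_def)
  have gm: "matrix g *v x = g x" for x
    using matrix_works[of g x] g(1) by (simp add: linear_matrix_vector_mul_eq)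
  have "pos_semidef (matrix g)"
    unfolding pos_semidef_def
  proof
    have "matrix g $ i $ j = matrix g $ j $ i" for i j
      using g(2)[of "axis j 1" "axis i 1"] by (simp add: matrix_def inner_axis inner_commute inner_axis')
    then show "transpose (matrix g) = matrix g" by (simp add: transpose_def vec_eq_iff)
    show "\<forall>x. 0 \<le> (matrix g *v x) \<bullet> x" unfolding gm using g(3) by blast
  qed
  moreover have "matrix g ** matrix g = A"
    by (simp add: matrix_eq gm g flip: matrix_vector_mul_assoc)
  ultimately have "\<exists>!S. pos_semidef S \<and> S ** S = A"
    using pos_semidef_sqrt_unique by metis
  from theI'[OF this] show "pos_semidef (matrix_sqrt A)" "matrix_sqrt A ** matrix_sqrt A = A"
    by (auto simp: matrix_sqrt_def)
qed

lemma norm_matrix_sqrt: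
  assumes "pos_semidef A"
  shows "norm (matrix_sqrt A *v x) = sqrt ((A *v x) \<bullet> x)"
proof -
  have "(matrix_sqrt A *v x) \<bullet> (matrix_sqrt A *v x) = (A *v x) \<bullet> x"
    using symmetric_matrix_inner[of "matrix_sqrt A" "matrix_sqrt A *v x" x] matrix_sqrt[OF assms]
    by (simp add: pos_semidef_def matrix_vector_mul_assoc)
  then show ?thesis by (simp add: norm_eq_sqrt_inner)
qed

text \<open>The image of the unit ball under a symmetric matrix has as support function the norm of
  the image of \<open>u\<close>: Cauchy-Schwarz and its equality case.\<close>

lemma ellipsoid_support:
  assumes A: "pos_semidef A"
  shows "x \<in> (\<lambda>y. matrix_sqrt A *v y) ` cball 0 1 \<Longrightarrow> x \<bullet> u \<le> sqrt ((A *v u) \<bullet> u)"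
    and "\<exists>x \<in> (\<lambda>y. matrix_sqrt A *v y) ` cball 0 1. x \<bullet> u = sqrt ((A *v u) \<bullet> u)"
proof -
  let ?S = "matrix_sqrt A"
  have sym: "(?S *v x) \<bullet> y = x \<bullet> (?S *v y)" for x y
    using matrix_sqrt[OF A] by (intro symmetric_matrix_inner) (simp add: pos_semidef_def)
  note n = norm_matrix_sqrt[OF A, of u, symmetric]
  show "x \<bullet> u \<le> sqrt ((A *v u) \<bullet> u)" if "x \<in> (\<lambda>y. ?S *v y) ` cball 0 1"
  proof -
    obtain y where y: "norm y \<le> 1" "x = ?S *v y" using \<open>x \<in> _\<close> by auto
    have "x \<bullet> u = y \<bullet> (?S *v u)" unfolding y(2) by (rule sym)
    also have "\<dots> \<le> norm y * norm (?S *v u)" by (rule norm_cauchy_schwarz)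
    also have "\<dots> \<le> 1 * norm (?S *v u)" using y by (intro mult_right_mono) auto
    finally show ?thesis unfolding n by simp
  qed
  show "\<exists>x \<in> (\<lambda>y. ?S *v y) ` cball 0 1. x \<bullet> u = sqrt ((A *v u) \<bullet> u)"
  proof (cases "?S *v u = 0")
    case True
    have "?S *v 0 \<in> (\<lambda>y. ?S *v y) ` cball 0 1" by (rule imageI) simp
    then show ?thesis unfolding n using True by (intro bexI[of _ "?S *v 0"]) auto
  next
    case False
    let ?y = "(?S *v u) /\<^sub>R norm (?S *v u)"
    have "(?S *v ?y) \<bullet> u = ?y \<bullet> (?S *v u)" by (rule sym)
    also have "\<dots> = norm (?S *v u)" using False by (simp add: dot_square_norm power2_eq_square)
    finally show ?thesis unfolding n using False by (intro bexI[of _ "?S *v ?y"]) auto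
  qed
qed

section \<open>Hausdorff distance and support functions\<close>

text \<open>Neighbourhoods are open, so \<open>\<delta>\<close> itself may fail to be admissible
  although every larger number is. The existence of an admissible number also underlies the lower
  bound, the infimum of the empty set being unspecified.\<close>

lemma hausdorff_distance_bounds:
  assumes ne: "A \<noteq> {}" "B \<noteq> {}" and \<delta>: "0 \<le> \<delta>"
    and AB: "\<And>a. a \<in> A \<Longrightarrow> \<exists>b\<in>B. dist a b \<le> \<delta>" and BA: "\<And>b. b \<in> B \<Longrightarrow> \<exists>a\<in>A. dist a b \<le> \<delta>"
  shows "0 \<le> hausdorff_distance A B" "hausdorff_distance A B \<le> \<delta>"
proof -
  have *: "0 \<le> Inf {\<epsilon>. \<epsilon> > 0 \<and> C \<subseteq> nbhd D \<epsilon>} \<and> Inf {\<epsilon>. \<epsilon> > 0 \<and> C \<subseteq> nbhd D \<epsilon>} \<le> \<delta>"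
    if CD: "\<And>c. c \<in> C \<Longrightarrow> \<exists>d\<in>D. dist c d \<le> \<delta>" for C D :: "'a set"
  proof -
    let ?E = "{\<epsilon>. \<epsilon> > 0 \<and> C \<subseteq> nbhd D \<epsilon>}"
    have mem: "\<epsilon> \<in> ?E" if "\<epsilon> > \<delta>" for \<epsilon>
    proof -
      have "C \<subseteq> nbhd D \<epsilon>"
      proof
        fix c assume "c \<in> C"
        then obtain d where "d \<in> D" "dist c d \<le> \<delta>" using CD by blast
        then show "c \<in> nbhd D \<epsilon>" using that by (auto simp: nbhd_def dist_commute intro!: bexI[of _ d])
      qed
      then show ?thesis using that \<delta> by auto
    qed
    have "0 \<le> Inf ?E" using mem[of "\<delta> + 1"] by (intro cInf_greatest) auto
    moreover have "Inf ?E \<le> \<epsilon>" if "\<epsilon> > \<delta>" for \<epsilon>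
      using mem[OF that] by (intro cInf_lower) (auto intro!: bdd_belowI[of _ 0])
    then have "Inf ?E \<le> \<delta>" by (rule dense_ge)
    ultimately show ?thesis by simp
  qed
  have "\<And>b. b \<in> B \<Longrightarrow> \<exists>a\<in>A. dist b a \<le> \<delta>" using BA by (simp add: dist_commute)
  from *[of A B, OF AB] *[of B A, OF this]
  show "0 \<le> hausdorff_distance A B" "hausdorff_distance A B \<le> \<delta>"
    by (auto simp: hausdorff_distance_def)
qed

text \<open>For \<open>x\<close> outside \<open>B\<close> only the direction from the closest point
  to \<open>x\<close> matters: there the closest point maximises the linear functional over
  \<open>B\<close>. The slack \<open>\<eta>\<close> allows for suprema known only
  approximately.\<close>

lemma near_convex_set:
  fixes B :: "'a::euclidean_space set"
  assumes B: "closed B" "convex B" "B \<noteq> {}" and \<delta>: "0 \<le> \<delta>"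
    and sup: "\<And>u \<eta>. norm u = 1 \<Longrightarrow> 0 < \<eta> \<Longrightarrow> \<exists>b\<in>B. x \<bullet> u \<le> b \<bullet> u + \<delta> + \<eta>"
  shows "\<exists>b\<in>B. dist x b \<le> \<delta>"
proof (cases "x \<in> B")
  case True
  then show ?thesis using \<delta> by (intro bexI[of _ x]) auto
next
  case False
  define c where "c = closest_point B x"
  have c: "c \<in> B" unfolding c_def using B by (intro closest_point_in_set)
  then have ne: "x - c \<noteq> 0" using False by auto
  define u where "u = (x - c) /\<^sub>R norm (x - c)"
  have u: "norm u = 1" using ne by (simp add: u_def)
  have le: "b \<bullet> u \<le> c \<bullet> u" if "b \<in> B" for b
  proof -
    have "(x - c) \<bullet> (b - c) \<le> 0" unfolding c_def by (rule closest_point_dot[OF B(2,1) that])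
    then have "u \<bullet> (b - c) \<le> 0" unfolding u_def by (simp add: mult_nonneg_nonpos)
    then show ?thesis by (simp add: inner_diff_right inner_commute)
  qed
  have "norm (x - c) = x \<bullet> u - c \<bullet> u"
  proof -
    have "x \<bullet> u - c \<bullet> u = (x - c) \<bullet> u" by (simp add: inner_diff_left)
    also have "\<dots> = norm (x - c)" using ne by (simp add: u_def dot_square_norm power2_eq_square)
    finally show ?thesis by simp
  qed
  moreover have "x \<bullet> u \<le> c \<bullet> u + \<delta>"
  proof (rule field_le_epsilon)
    fix \<eta> :: real assume "0 < \<eta>"
    from sup[OF u this] obtain b where "b \<in> B" "x \<bullet> u \<le> b \<bullet> u + \<delta> + \<eta>" by auto
    then show "x \<bullet> u \<le> c \<bullet> u + \<delta> + \<eta>" using le[of b] by linarith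
  qed
  ultimately have "dist x c \<le> \<delta>" by (simp add: dist_norm)
  then show ?thesis using c by blast
qed

lemma closed_convex_hull_inner_le:
  assumes x: "x \<in> closed_convex_hull S" and le: "\<And>s. s \<in> S \<Longrightarrow> s \<bullet> u \<le> c"
  shows "x \<bullet> u \<le> c"
proof -
  have "convex hull S \<subseteq> {x. u \<bullet> x \<le> c}"
    using le by (intro hull_minimal convex_halfspace_le) (auto simp: inner_commute)
  then have "closed_convex_hull S \<subseteq> {x. u \<bullet> x \<le> c}"
    unfolding closed_convex_hull_def by (intro closure_minimal closed_halfspace_le)
  then show ?thesis using x by (auto simp: inner_commute)
qed

lemma closed_convex_hull_superset: "S \<subseteq> closed_convex_hull S"
  unfolding closed_convex_hull_def by (rule order.trans[OF hull_subset closure_subset])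

lemma closed_convex_hull_convex_bodies:
  "bounded S \<Longrightarrow> S \<noteq> {} \<Longrightarrow> closed_convex_hull S \<in> convex_bodies"
  unfolding convex_bodies_def closed_convex_hull_def
  by (auto simp: compact_closure bounded_convex_hull convex_closure)

text \<open>Converts an almost sure qualitative property, such as boundedness or continuity of
  paths, into a quantitative one with probability at least 1/2.\<close>

lemma (in prob_space) incseq_half:
  assumes B: "\<And>n. B n \<in> events" "incseq B" and ae: "AE \<omega> in M. \<exists>n. \<omega> \<in> B n"
  shows "\<exists>n. 1/2 \<le> prob (B n)"
proof -
  have "(\<lambda>n. prob (B n)) \<longlonglongrightarrow> prob (\<Union>n. B n)"
    using B by (intro finite_Lim_measure_incseq) auto
  moreover have "prob (\<Union>n. B n) = 1"
    using B ae by (subst prob_eq_1) auto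
  ultimately have "\<forall>\<^sub>F n in sequentially. 1/2 < prob (B n)"
    by (intro order_tendstoD) auto
  then show ?thesis
    by (metis (mono_tags, lifting) eventually_happens sequentially_bot less_imp_le)
qed

section \<open>The process and its copies\<close>

locale gaussian_copies =
  fixes T :: "'t::metric_space set"
    and M :: "'w measure" and X :: "'t \<Rightarrow> 'w \<Rightarrow> real ^ 'd"
    and N :: "'v measure" and Y :: "nat \<Rightarrow> 't \<Rightarrow> 'v \<Rightarrow> real ^ 'd"
  assumes T_nonempty: "T \<noteq> {}"
    and prob_M: "prob_space M" and prob_N: "prob_space N"
    and gaussian: "centered_gaussian_process M T X"
    and X_separable: "separable_process M T X" and X_bounded: "bounded_process M T X"
    and copies: "iid_copies N T Y M X"
    and Y_separable: "\<And>i. i \<ge> 1 \<Longrightarrow> separable_process N T (Y i)"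
    and Y_bounded: "\<And>i. i \<ge> 1 \<Longrightarrow> bounded_process N T (Y i)"
begin

sublocale M: prob_space M by (rule prob_M)

sublocale N: prob_space N by (rule prob_N)

section \<open>Measurability and transfer of events to the copies\<close>

lemma X_measurable[measurable]: "t \<in> T \<Longrightarrow> X t \<in> borel_measurable M"
  using gaussian by (simp add: centered_gaussian_process_def)

lemma sample_path_X[measurable]: "sample_path T X \<in> measurable M (process_space T)"
  unfolding sample_path_def[abs_def] process_space_def by (intro measurable_restrict) simp

lemma sample_path_Y: "i \<ge> 1 \<Longrightarrow> sample_path T (Y i) \<in> measurable N (process_space T)"
  using copies unfolding iid_copies_def N.indep_vars_def by auto

lemma coordinate_measurable: "t \<in> T \<Longrightarrow> (\<lambda>x. x t) \<in> borel_measurable (process_space T)"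
  unfolding process_space_def by measurable

lemma law_transfer:
  assumes i: "i \<ge> 1" and E: "E \<in> sets (process_space T)"
  shows "measure N {\<omega>\<in>space N. sample_path T (Y i) \<omega> \<in> E} = measure M {\<omega>\<in>space M. sample_path T X \<omega> \<in> E}"
proof -
  have "distr N (process_space T) (sample_path T (Y i)) = distr M (process_space T) (sample_path T X)"
    using copies i unfolding iid_copies_def process_law_def by auto
  then have "measure (distr N (process_space T) (sample_path T (Y i))) E = measure (distr M (process_space T) (sample_path T X)) E"
    by simp
  then show ?thesis
    using E by (simp add: measure_distr[OF sample_path_Y[OF i]] measure_distr[OF sample_path_X] vimage_def Int_def conj_commute)
qed

lemma halfspace_event: "t \<in> T \<Longrightarrow> {x \<in> space (process_space T). a < x t \<bullet> (u :: real ^ 'd)} \<in> sets (process_space T)"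
  by (intro borel_measurable_less borel_measurable_const borel_measurable_inner coordinate_measurable)

text \<open>Equality of laws concerns events of the product sigma-algebra; countability of
  \<open>A\<close> keeps the exceedance event inside it.\<close>

lemma exists_exceeds_transfer:
  assumes i: "i \<ge> 1" and A: "countable A" "A \<subseteq> UNIV \<times> T"
  shows "{\<omega>\<in>space N. \<exists>a\<in>A. b < Y i (snd a) \<omega> \<bullet> fst a} \<in> sets N"
    and "measure N {\<omega>\<in>space N. \<exists>a\<in>A. b < Y i (snd a) \<omega> \<bullet> fst a} = measure M {\<omega>\<in>space M. \<exists>a\<in>A. b < X (snd a) \<omega> \<bullet> fst a}"
proof -
  let ?E = "{x \<in> space (process_space T). \<exists>a\<in>A. b < x (snd a) \<bullet> fst a}"
  have E: "?E \<in> sets (process_space T)"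
  proof (intro sets.sets_Collect_countable_Ex' A(1))
    fix a assume "a \<in> A"
    then have "snd a \<in> T" using A(2) by auto
    then show "{x \<in> space (process_space T). b < x (snd a) \<bullet> fst a} \<in> sets (process_space T)"
      by (rule halfspace_event)
  qed
  have eq: "{\<omega>\<in>space K. sample_path T V \<omega> \<in> ?E} = {\<omega>\<in>space K. \<exists>a\<in>A. b < V (snd a) \<omega> \<bullet> fst a}"
    for K :: "'k measure" and V
    using A by (force simp: sample_path_def process_space_def space_PiM)
  show "{\<omega>\<in>space N. \<exists>a\<in>A. b < Y i (snd a) \<omega> \<bullet> fst a} \<in> sets N"
    using measurable_sets[OF sample_path_Y[OF i] E] unfolding eq[symmetric] by (simp add: vimage_def Int_def conj_commute)
  show "measure N {\<omega>\<in>space N. \<exists>a\<in>A. b < Y i (snd a) \<omega> \<bullet> fst a} = measure M {\<omega>\<in>space M. \<exists>a\<in>A. b < X (snd a) \<omega> \<bullet> fst a}"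
    using law_transfer[OF i E] unfolding eq .
qed

text \<open>A direction and a time form one index, so a joint supremum over both is the supremum of
  a single Gaussian family. A finite combination is regrouped by time to match the definition of the
  process.\<close>

lemma family: "gaussian_family M (UNIV \<times> T) (\<lambda>a \<omega>. X (snd a) \<omega> \<bullet> fst a)"
  unfolding gaussian_family_def
proof (intro allI impI)
  fix F :: "((real^'d) \<times> 't) set" and c
  assume F: "finite F \<and> F \<subseteq> UNIV \<times> T"
  have "centered_gaussian_rv M (\<lambda>\<omega>. \<Sum>t\<in>snd ` F. (\<Sum>a\<in>{a\<in>F. snd a = t}. c a *\<^sub>R fst a) \<bullet> X t \<omega>)"
  proof (rule conjunct2[OF gaussian[unfolded centered_gaussian_process_def], rule_format])
    show "finite (snd ` F) \<and> snd ` F \<subseteq> T" using F by auto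
  qed
  moreover have "(\<Sum>t\<in>snd ` F. (\<Sum>a\<in>{a\<in>F. snd a = t}. c a *\<^sub>R fst a) \<bullet> X t \<omega>) = (\<Sum>a\<in>F. c a * (X (snd a) \<omega> \<bullet> fst a))" for \<omega>
  proof -
    have "(\<Sum>a\<in>F. c a * (X (snd a) \<omega> \<bullet> fst a)) = (\<Sum>t\<in>snd ` F. \<Sum>a\<in>{a\<in>F. snd a = t}. c a * (X (snd a) \<omega> \<bullet> fst a))"
      using F by (intro sum.image_gen) simp
    also have "\<dots> = (\<Sum>t\<in>snd ` F. (\<Sum>a\<in>{a\<in>F. snd a = t}. c a *\<^sub>R fst a) \<bullet> X t \<omega>)"
      unfolding inner_sum_left by (intro sum.cong refl) (auto simp: inner_commute)
    finally show ?thesis by simp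
  qed
  ultimately show "centered_gaussian_rv M (\<lambda>\<omega>. \<Sum>a\<in>F. c a * (X (snd a) \<omega> \<bullet> fst a))" by simp
qed

section \<open>Variances of projections and concentration ellipsoids\<close>

lemma gaussian_inner: "t \<in> T \<Longrightarrow> centered_gaussian_rv M (\<lambda>\<omega>. X t \<omega> \<bullet> u)"
  using gaussian_family_single[OF family, of "(u, t)"] by simp

text \<open>As a function of \<open>u\<close> this is the support function of the ellipsoid of
  \<open>X t\<close>, as \<open>ellipsoid_sd\<close> shows.\<close>

definition sd :: "real ^ 'd \<Rightarrow> 't \<Rightarrow> real" where
  "sd u t = sqrt (\<integral>\<omega>. (X t \<omega> \<bullet> u)\<^sup>2 \<partial>M)"

definition cov_root :: "'t \<Rightarrow> real ^ 'd ^ 'd" where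
  "cov_root t = matrix_sqrt (covariance_matrix M (X t))"

lemma covariance_quadratic_form:
  assumes t: "t \<in> T"
  shows "(covariance_matrix M (X t) *v u) \<bullet> u = (\<integral>\<omega>. (X t \<omega> \<bullet> u)\<^sup>2 \<partial>M)"
proof -
  have comp: "centered_gaussian_rv M (\<lambda>\<omega>. X t \<omega> $ i)" for i
    using gaussian_inner[OF t, of "axis i 1"] by (simp add: inner_axis)
  have mean: "(\<integral>\<omega>. X t \<omega> $ i \<partial>M) = 0" for i by (rule cgrv_mean[OF prob_M comp])
  have int: "integrable M (\<lambda>\<omega>. X t \<omega> $ i * X t \<omega> $ j)" for i j
  proof (rule Bochner_Integration.integrable_bound)
    show "integrable M (\<lambda>\<omega>. (X t \<omega> $ i)\<^sup>2 + (X t \<omega> $ j)\<^sup>2)"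
      by (intro Bochner_Integration.integrable_add cgrv_integrable_square[OF prob_M comp])
    show "(\<lambda>\<omega>. X t \<omega> $ i * X t \<omega> $ j) \<in> borel_measurable M"
      using cgrv_measurable[OF comp] by (intro borel_measurable_times)
    have "\<bar>a * b\<bar> \<le> \<bar>a\<^sup>2 + b\<^sup>2\<bar>" for a b :: real
    proof -
      have "2 * \<bar>a * b\<bar> \<le> a\<^sup>2 + b\<^sup>2" using sum_squares_bound[of "\<bar>a\<bar>" "\<bar>b\<bar>"] by (simp add: abs_mult)
      then show ?thesis by linarith
    qed
    then show "AE \<omega> in M. norm (X t \<omega> $ i * X t \<omega> $ j) \<le> norm ((X t \<omega> $ i)\<^sup>2 + (X t \<omega> $ j)\<^sup>2)" by simp
  qed
  have "(covariance_matrix M (X t) *v u) \<bullet> u = (\<Sum>i\<in>UNIV. \<Sum>j\<in>UNIV. (\<integral>\<omega>. X t \<omega> $ i * X t \<omega> $ j \<partial>M) * (u $ j * u $ i))"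
    by (simp add: covariance_matrix_def mean matrix_vector_mult_def inner_vec_def sum_distrib_right sum_distrib_left mult_ac)
  also have "\<dots> = (\<integral>\<omega>. (\<Sum>i\<in>UNIV. \<Sum>j\<in>UNIV. (X t \<omega> $ i * X t \<omega> $ j) * (u $ j * u $ i)) \<partial>M)"
    using int by simp
  also have "\<dots> = (\<integral>\<omega>. (X t \<omega> \<bullet> u)\<^sup>2 \<partial>M)"
    by (intro Bochner_Integration.integral_cong refl) (simp add: inner_vec_def power2_eq_square sum_product mult_ac)
  finally show ?thesis .
qed

lemma covariance_pos_semidef: "t \<in> T \<Longrightarrow> pos_semidef (covariance_matrix M (X t))"
  unfolding pos_semidef_def
proof
  show "transpose (covariance_matrix M (X t)) = covariance_matrix M (X t)"
    by (simp add: covariance_matrix_def transpose_def vec_eq_iff mult.commute)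
qed (simp add: covariance_quadratic_form)

lemma sd_cov_root: "t \<in> T \<Longrightarrow> sd u t = norm (cov_root t *v u)"
  unfolding sd_def cov_root_def by (simp add: norm_matrix_sqrt[OF covariance_pos_semidef] covariance_quadratic_form)

lemma sd_nonneg: "0 \<le> sd u t" by (simp add: sd_def)

lemma sd_square: "(\<integral>\<omega>. (X t \<omega> \<bullet> u)\<^sup>2 \<partial>M) = (sd u t)\<^sup>2" by (simp add: sd_def)

lemma ellipsoid_sd:
  assumes t: "t \<in> T"
  shows "x \<in> concentration_ellipsoid M (X t) \<Longrightarrow> x \<bullet> u \<le> sd u t"
    and "\<exists>x\<in>concentration_ellipsoid M (X t). x \<bullet> u = sd u t"
  using ellipsoid_support(1)[OF covariance_pos_semidef[OF t], of x u]
    ellipsoid_support(2)[OF covariance_pos_semidef[OF t], of u]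
  unfolding concentration_ellipsoid_def covariance_quadratic_form[OF t] sd_def by blast+

text \<open>Limits of sequences stay in closed sets, so closed constraints extend from a separant to
  \<open>T\<close>. This form of separability passes to larger sets, which allows the union of the
  separants of \<open>X\<close> and of all copies.\<close>

lemma separating_set: "\<exists>C. countable C \<and> C \<subseteq> T \<and> C \<noteq> {} \<and>
    (AE \<omega> in M. \<forall>K. closed K \<longrightarrow> (\<forall>t\<in>C. X t \<omega> \<in> K) \<longrightarrow> (\<forall>t\<in>T. X t \<omega> \<in> K)) \<and>
    (\<forall>i\<ge>1. AE \<omega> in N. \<forall>K. closed K \<longrightarrow> (\<forall>t\<in>C. Y i t \<omega> \<in> K) \<longrightarrow> (\<forall>t\<in>T. Y i t \<omega> \<in> K))"
proof -
  have sep: "\<forall>K. closed K \<longrightarrow> (\<forall>t\<in>D. V t \<in> K) \<longrightarrow> (\<forall>t\<in>T. V t \<in> K)"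
    if V: "\<forall>t\<in>T. \<exists>s. (\<forall>k. s k \<in> T0) \<and> s \<longlonglongrightarrow> t \<and> (\<lambda>k. V (s k)) \<longlonglongrightarrow> V t" "T0 \<subseteq> D" for V :: "'t \<Rightarrow> real ^ 'd" and T0 D
  proof (intro allI impI ballI)
    fix K t assume K: "closed K" "\<forall>t\<in>D. V t \<in> K" "t \<in> T"
    obtain s where s: "\<forall>k. s k \<in> T0" "(\<lambda>k. V (s k)) \<longlonglongrightarrow> V t" using bspec[OF V(1) K(3)] by blast
    have "V (s k) \<in> K" for k using s(1) V(2) K(2) by (meson subsetD)
    then show "V t \<in> K" by (rule closed_sequentially[OF K(1) _ s(2)])
  qed
  obtain T0 where T0: "countable T0" "T0 \<subseteq> T"
    "AE \<omega> in M. \<forall>t\<in>T. \<exists>s. (\<forall>k. s k \<in> T0) \<and> s \<longlonglongrightarrow> t \<and> (\<lambda>k. X (s k) \<omega>) \<longlonglongrightarrow> X t \<omega>"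
    using X_separable unfolding separable_process_def by blast
  have "\<forall>i. \<exists>T1. i \<ge> 1 \<longrightarrow> countable T1 \<and> T1 \<subseteq> T \<and>
     (AE \<omega> in N. \<forall>t\<in>T. \<exists>s. (\<forall>k. s k \<in> T1) \<and> s \<longlonglongrightarrow> t \<and> (\<lambda>k. Y i (s k) \<omega>) \<longlonglongrightarrow> Y i t \<omega>)"
    (is "\<forall>i. ?Q i")
  proof
    fix i
    show "?Q i"
    proof (cases "i \<ge> 1")
      case True
      show ?thesis using Y_separable[OF True, unfolded separable_process_def] by (simp only: True simp_thms)
    qed simp
  qed
  from choice[OF this] obtain T1 where T1: "\<forall>i. i \<ge> 1 \<longrightarrow> countable (T1 i) \<and> T1 i \<subseteq> T \<and>
     (AE \<omega> in N. \<forall>t\<in>T. \<exists>s. (\<forall>k. s k \<in> T1 i) \<and> s \<longlonglongrightarrow> t \<and> (\<lambda>k. Y i (s k) \<omega>) \<longlonglongrightarrow> Y i t \<omega>)" ..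
  obtain t0 where t0: "t0 \<in> T" using T_nonempty by auto
  define C where "C = insert t0 (T0 \<union> (\<Union>i\<in>{1..}. T1 i))"
  show ?thesis
  proof (intro exI[of _ C] conjI allI impI)
    show "countable C" unfolding C_def using T0 T1 by auto
    show "C \<subseteq> T" unfolding C_def using T0 T1 t0 by auto
    show "C \<noteq> {}" by (simp add: C_def)
    show "AE \<omega> in M. \<forall>K. closed K \<longrightarrow> (\<forall>t\<in>C. X t \<omega> \<in> K) \<longrightarrow> (\<forall>t\<in>T. X t \<omega> \<in> K)"
      using T0(3) by eventually_elim (erule sep, auto simp: C_def)
    show "AE \<omega> in N. \<forall>K. closed K \<longrightarrow> (\<forall>t\<in>C. Y i t \<omega> \<in> K) \<longrightarrow> (\<forall>t\<in>T. Y i t \<omega> \<in> K)" if "i \<ge> 1" for i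
      using conjunct2[OF conjunct2[OF T1[rule_format, OF that]]]
      by eventually_elim (erule sep, use that in \<open>auto simp: C_def\<close>)
  qed
qed

text \<open>A countable separating set, common to \<open>X\<close> and to all its copies.\<close>

definition C :: "'t set" where
  "C = (SOME C. countable C \<and> C \<subseteq> T \<and> C \<noteq> {} \<and>
    (AE \<omega> in M. \<forall>K. closed K \<longrightarrow> (\<forall>t\<in>C. X t \<omega> \<in> K) \<longrightarrow> (\<forall>t\<in>T. X t \<omega> \<in> K)) \<and>
    (\<forall>i\<ge>1. AE \<omega> in N. \<forall>K. closed K \<longrightarrow> (\<forall>t\<in>C. Y i t \<omega> \<in> K) \<longrightarrow> (\<forall>t\<in>T. Y i t \<omega> \<in> K)))"

lemma C: "countable C" "C \<subseteq> T" "C \<noteq> {}"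
    "AE \<omega> in M. \<forall>K. closed K \<longrightarrow> (\<forall>t\<in>C. X t \<omega> \<in> K) \<longrightarrow> (\<forall>t\<in>T. X t \<omega> \<in> K)"
    "AE \<omega> in N. \<forall>i\<ge>1. \<forall>K. closed K \<longrightarrow> (\<forall>t\<in>C. Y i t \<omega> \<in> K) \<longrightarrow> (\<forall>t\<in>T. Y i t \<omega> \<in> K)"
proof -
  let ?P = "\<lambda>C. countable C \<and> C \<subseteq> T \<and> C \<noteq> {} \<and>
    (AE \<omega> in M. \<forall>K. closed K \<longrightarrow> (\<forall>t\<in>C. X t \<omega> \<in> K) \<longrightarrow> (\<forall>t\<in>T. X t \<omega> \<in> K)) \<and>
    (\<forall>i\<ge>1. AE \<omega> in N. \<forall>K. closed K \<longrightarrow> (\<forall>t\<in>C. Y i t \<omega> \<in> K) \<longrightarrow> (\<forall>t\<in>T. Y i t \<omega> \<in> K))"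
  have P: "?P C" unfolding C_def by (rule someI_ex[OF separating_set])
  then show "countable C" "C \<subseteq> T" "C \<noteq> {}"
    "AE \<omega> in M. \<forall>K. closed K \<longrightarrow> (\<forall>t\<in>C. X t \<omega> \<in> K) \<longrightarrow> (\<forall>t\<in>T. X t \<omega> \<in> K)" by blast+
  have "AE \<omega> in N. i \<ge> 1 \<longrightarrow> (\<forall>K. closed K \<longrightarrow> (\<forall>t\<in>C. Y i t \<omega> \<in> K) \<longrightarrow> (\<forall>t\<in>T. Y i t \<omega> \<in> K))" for i
    using P by (cases "i \<ge> 1") auto
  then show "AE \<omega> in N. \<forall>i\<ge>1. \<forall>K. closed K \<longrightarrow> (\<forall>t\<in>C. Y i t \<omega> \<in> K) \<longrightarrow> (\<forall>t\<in>T. Y i t \<omega> \<in> K)"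
    by (simp add: AE_all_countable)
qed

lemma norm_quantile: "\<exists>q\<ge>1. 1/2 \<le> measure M {\<omega>\<in>space M. \<forall>t\<in>C. norm (X t \<omega>) \<le> q}"
proof -
  have "\<exists>n::nat. 1/2 \<le> measure M {\<omega>\<in>space M. \<forall>t\<in>C. norm (X t \<omega>) \<le> real n + 1}"
  proof (rule M.incseq_half)
    fix n :: nat
    have "{\<omega>\<in>space M. norm (X t \<omega>) \<le> real n + 1} \<in> sets M" if "t \<in> C" for t
      using that C(2) X_measurable by (intro borel_measurable_le) auto
    then show "{\<omega>\<in>space M. \<forall>t\<in>C. norm (X t \<omega>) \<le> real n + 1} \<in> sets M"
      using C(1) by (intro sets.sets_Collect_countable_All') auto
  next
    show "incseq (\<lambda>n::nat. {\<omega>\<in>space M. \<forall>t\<in>C. norm (X t \<omega>) \<le> real n + 1})"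
      by (rule incseq_SucI) (auto intro: order.trans)
    show "AE \<omega> in M. \<exists>n::nat. \<omega> \<in> {\<omega>\<in>space M. \<forall>t\<in>C. norm (X t \<omega>) \<le> real n + 1}"
      using X_bounded unfolding bounded_process_def
    proof (rule AE_mp, intro AE_I2 impI)
      fix \<omega> assume \<omega>: "\<omega> \<in> space M" and "bounded ((\<lambda>t. X t \<omega>) ` T)"
      then obtain b where b: "\<And>t. t \<in> T \<Longrightarrow> norm (X t \<omega>) \<le> b" by (auto simp: bounded_iff)
      obtain n :: nat where n: "b \<le> real n" using real_arch_simple by blast
      have "\<forall>t\<in>C. norm (X t \<omega>) \<le> real n + 1"
      proof
        fix t assume "t \<in> C"
        then have "t \<in> T" using C(2) by auto
        from b[OF this] n show "norm (X t \<omega>) \<le> real n + 1" by linarith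
      qed
      then show "\<exists>n::nat. \<omega> \<in> {\<omega>\<in>space M. \<forall>t\<in>C. norm (X t \<omega>) \<le> real n + 1}" using \<omega> by auto
    qed
  qed
  then obtain n :: nat where "1/2 \<le> measure M {\<omega>\<in>space M. \<forall>t\<in>C. norm (X t \<omega>) \<le> real n + 1}" by blast
  then show ?thesis by (intro exI[of _ "real n + 1"]) auto
qed

text \<open>A level for the paths on \<open>C\<close> that is respected with probability at least
  1/2; \<open>1 \<le> q\<close> makes it a safe divisor. All later constants derive from it.\<close>

definition q where "q = (SOME q. q \<ge> 1 \<and> 1/2 \<le> measure M {\<omega>\<in>space M. \<forall>t\<in>C. norm (X t \<omega>) \<le> q})"

lemma q: "1 \<le> q" "1/2 \<le> measure M {\<omega>\<in>space M. \<forall>t\<in>C. norm (X t \<omega>) \<le> q}"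
  using someI_ex[of "\<lambda>q. q \<ge> 1 \<and> 1/2 \<le> measure M {\<omega>\<in>space M. \<forall>t\<in>C. norm (X t \<omega>) \<le> q}"] norm_quantile
  unfolding q_def by blast+

text \<open>The event behind \<open>q\<close> bounds each projection with probability at least 1/2,
  which for a Gaussian variable bounds the standard deviation. The closed ball is the constraint
  that passes from \<open>C\<close> to an arbitrary \<open>t\<close>.\<close>

lemma sd_le: assumes t: "t \<in> T" shows "sd u t \<le> 2 * q * norm u"
proof (cases "u = 0")
  case False
  have "1/2 \<le> measure M {\<omega>\<in>space M. \<forall>t\<in>C. norm (X t \<omega>) \<le> q}" by (rule q)
  also have "\<dots> \<le> measure M {\<omega>\<in>space M. \<bar>X t \<omega> \<bullet> u\<bar> \<le> q * norm u}"
  proof (rule M.finite_measure_mono_AE)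
    show "AE \<omega> in M. \<omega> \<in> {\<omega>\<in>space M. \<forall>t\<in>C. norm (X t \<omega>) \<le> q} \<longrightarrow> \<omega> \<in> {\<omega>\<in>space M. \<bar>X t \<omega> \<bullet> u\<bar> \<le> q * norm u}"
      using C(4)
    proof (rule AE_mp, intro AE_I2 impI)
      fix \<omega> assume K: "\<forall>K. closed K \<longrightarrow> (\<forall>t\<in>C. X t \<omega> \<in> K) \<longrightarrow> (\<forall>t\<in>T. X t \<omega> \<in> K)"
        and \<omega>: "\<omega> \<in> {\<omega>\<in>space M. \<forall>t\<in>C. norm (X t \<omega>) \<le> q}"
      have "X t \<omega> \<in> cball 0 q" using K[rule_format, of "cball 0 q" t] \<omega> t by auto
      then have "\<bar>X t \<omega> \<bullet> u\<bar> \<le> q * norm u"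
        using Cauchy_Schwarz_ineq2[of "X t \<omega>" u] by (auto intro: order.trans[OF _ mult_right_mono])
      then show "\<omega> \<in> {\<omega>\<in>space M. \<bar>X t \<omega> \<bullet> u\<bar> \<le> q * norm u}" using \<omega> by auto
    qed
    show "{\<omega>\<in>space M. \<bar>X t \<omega> \<bullet> u\<bar> \<le> q * norm u} \<in> sets M"
      using X_measurable[OF t] by measurable
  qed
  finally have "sqrt (\<integral>\<omega>. (X t \<omega> \<bullet> u)\<^sup>2 \<partial>M) \<le> 2 * (q * norm u)"
    using False q(1) by (intro cgrv_sd_le_median prob_M gaussian_inner t) auto
  then show ?thesis by (simp add: sd_def)
qed (simp add: sd_def)

text \<open>The support function of the limit body. It may vanish on a subspace \<open>Ker\<close>, the orthogonal
  complement of the limit body; the paths almost surely stay orthogonal to \<open>Ker\<close>.\<close>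

definition p :: "real ^ 'd \<Rightarrow> real" where "p u = (SUP t\<in>T. sd u t)"

lemma sd_le_p: "t \<in> T \<Longrightarrow> sd u t \<le> p u"
  unfolding p_def by (intro cSUP_upper bdd_aboveI2[OF sd_le])

lemma p_least: "(\<And>t. t \<in> T \<Longrightarrow> sd u t \<le> b) \<Longrightarrow> p u \<le> b"
  unfolding p_def by (intro cSUP_least T_nonempty)

lemma p_nonneg: "0 \<le> p u"
  using T_nonempty sd_le_p sd_nonneg order.trans by blast

lemma p_le: "p u \<le> 2 * q * norm u"
  by (intro p_least sd_le)

lemma p_approx: "0 < \<eta> \<Longrightarrow> \<exists>t\<in>T. p u - \<eta> < sd u t"
  using p_least[of u "p u - \<eta>"] by (meson not_le diff_less_eq less_add_same_cancel1)

lemma p_triangle: "p (u + v) \<le> p u + p v"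
proof (rule p_least)
  fix t assume t: "t \<in> T"
  have "sd (u + v) t \<le> sd u t + sd v t"
    using norm_triangle_ineq[of "cov_root t *v u" "cov_root t *v v"] by (simp add: sd_cov_root[OF t] matrix_vector_right_distrib)
  also have "\<dots> \<le> p u + p v" by (intro add_mono sd_le_p t)
  finally show "sd (u + v) t \<le> p u + p v" .
qed

lemma p_scale: assumes c: "0 \<le> c" shows "p (c *\<^sub>R u) = c * p u"
proof -
  have s: "sd (c *\<^sub>R u) t = c * sd u t" if "t \<in> T" "0 \<le> c" for c t u
    using that by (simp add: sd_cov_root matrix_vector_mult_scaleR)
  have le: "p (c *\<^sub>R u) \<le> c * p u" if "0 \<le> c" for c u
    using that by (intro p_least) (auto simp: s intro: mult_left_mono sd_le_p)
  show ?thesis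
  proof (cases "c = 0")
    case True
    then show ?thesis using le[of 0 u] p_nonneg[of 0] by simp
  next
    case False
    then have "p u \<le> inverse c * p (c *\<^sub>R u)" using le[of "inverse c" "c *\<^sub>R u"] c by simp
    then have "c * p u \<le> p (c *\<^sub>R u)" using False c by (simp add: field_simps)
    then show ?thesis using le[OF c, of u] by simp
  qed
qed

lemma p_lipschitz: "p u \<le> p v + 2 * q * norm (u - v)"
  using p_triangle[of v "u - v"] p_le[of "u - v"] by simp

lemma p_continuous: "continuous_on S p"
proof (rule continuous_onI)
  fix x :: "real ^ 'd" and e :: real assume "0 < e"
  have d: "dist (p u) (p x) \<le> 2 * q * dist u x" for u
    using p_lipschitz[of u x] p_lipschitz[of x u] by (simp add: dist_norm norm_minus_commute abs_le_iff)
  have "dist (p u) (p x) \<le> e" if "dist u x < e / (2 * q)" for u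
    using d[of u] that q(1) by (simp add: field_simps)
  then show "\<exists>d>0. \<forall>x'\<in>S. dist x' x < d \<longrightarrow> dist (p x') (p x) \<le> e"
    using \<open>0 < e\<close> q(1) by (intro exI[of _ "e / (2 * q)"]) auto
qed

section \<open>The limit body and its support function\<close>

lemma limit_body_le: "x \<in> limit_body M T X \<Longrightarrow> x \<bullet> u \<le> p u"
  unfolding limit_body_def
  by (erule closed_convex_hull_inner_le) (auto intro: order.trans[OF ellipsoid_sd(1) sd_le_p])

lemma limit_body_approx: assumes "0 < \<eta>" shows "\<exists>x\<in>limit_body M T X. p u - \<eta> < x \<bullet> u"
proof -
  obtain t where t: "t \<in> T" "p u - \<eta> < sd u t" using p_approx[OF assms] by blast
  obtain x where x: "x \<in> concentration_ellipsoid M (X t)" "x \<bullet> u = sd u t" using ellipsoid_sd(2)[OF t(1)] by blast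
  have "x \<in> limit_body M T X"
    unfolding limit_body_def by (rule subsetD[OF closed_convex_hull_superset UN_I]) (rule t x)+
  then show ?thesis using x t by (intro bexI[of _ x]) simp_all
qed

lemma limit_body_convex_bodies: "limit_body M T X \<in> convex_bodies"
  unfolding limit_body_def
proof (rule closed_convex_hull_convex_bodies)
  show "bounded (\<Union>t\<in>T. concentration_ellipsoid M (X t))"
    unfolding bounded_iff
  proof (intro exI[of _ "2 * q"] ballI)
    fix x assume "x \<in> (\<Union>t\<in>T. concentration_ellipsoid M (X t))"
    then obtain t where t: "t \<in> T" "x \<in> concentration_ellipsoid M (X t)" by auto
    \<comment> \<open>The ellipsoid is tested in the direction \<open>x\<close> itself.\<close>
    have "norm x * norm x \<le> 2 * q * norm x"
      using ellipsoid_sd(1)[OF t, of x] sd_le[OF t(1), of x] by (simp add: dot_square_norm power2_eq_square)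
    then show "norm x \<le> 2 * q" using q(1) by (cases "norm x = 0") auto
  qed
  obtain t where t: "t \<in> T" using T_nonempty by auto
  obtain x where "x \<in> concentration_ellipsoid M (X t)" using ellipsoid_sd(2)[OF t] by blast
  then show "(\<Union>t\<in>T. concentration_ellipsoid M (X t)) \<noteq> {}" using t by auto
qed

end

section \<open>Upper bound\<close>

definition rate :: "nat \<Rightarrow> real" where "rate n = sqrt (2 * ln (real n))"

lemma rate_nonneg: "0 \<le> rate n" unfolding rate_def by (cases n) auto

lemma rate_mono: "1 \<le> i \<Longrightarrow> i \<le> n \<Longrightarrow> rate i \<le> rate n"
  unfolding rate_def by simp

lemma rate_at_top: "filterlim rate at_top sequentially"
  unfolding rate_def by real_asymp

lemma eventually_rate_ge: "\<forall>\<^sub>F n in sequentially. b \<le> rate n"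
  using rate_at_top by (simp add: filterlim_at_top)

context gaussian_copies
begin

lemma AE_paths_bounded: "AE \<omega> in N. \<forall>i\<ge>1. \<exists>b. \<forall>t\<in>T. norm (Y i t \<omega>) \<le> b"
proof -
  have "AE \<omega> in N. i \<ge> 1 \<longrightarrow> (\<exists>b. \<forall>t\<in>T. norm (Y i t \<omega>) \<le> b)" for i
  proof (cases "i \<ge> 1")
    case True
    from Y_bounded[OF this] show ?thesis unfolding bounded_process_def
      by eventually_elim (auto simp: bounded_iff)
  qed simp
  then show ?thesis by (simp add: AE_all_countable)
qed

text \<open>Borel-Cantelli is applied to single copies, the \<open>i\<close>-th at the level of
  \<open>rate i\<close>, and monotonicity of \<open>rate\<close> then covers all
  \<open>i \<le> n\<close>. The finitely many exceptional copies are absorbed because their paths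
  are bounded and \<open>rate\<close> tends to infinity.\<close>

lemma upper_eventually:
  assumes A: "countable A" "A \<subseteq> UNIV \<times> T"
    and \<rho>: "\<And>a. a \<in> A \<Longrightarrow> norm (fst a) \<le> \<rho>" and var: "\<And>a. a \<in> A \<Longrightarrow> sd (fst a) (snd a) \<le> 1"
    and m: "\<And>F. finite F \<Longrightarrow> F \<noteq> {} \<Longrightarrow> F \<subseteq> A \<Longrightarrow> (\<integral>\<omega>. Max ((\<lambda>a. X (snd a) \<omega> \<bullet> fst a) ` F) \<partial>M) \<le> m"
    and \<epsilon>: "0 < \<epsilon>"
  shows "AE \<omega> in N. \<forall>\<^sub>F n in sequentially. \<forall>i\<in>{1..n}. \<forall>a\<in>A. Y i (snd a) \<omega> \<bullet> fst a \<le> rate n + m + \<epsilon>"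
proof -
  define B where "B i = (if i = 0 then {} else {\<omega>\<in>space N. \<exists>a\<in>A. m + (rate i + \<epsilon>) < Y i (snd a) \<omega> \<bullet> fst a})" for i
  have B: "B i \<in> sets N" for i
    unfolding B_def using exists_exceeds_transfer(1)[OF _ A, of i] by simp
  have var': "(\<integral>\<omega>. (X (snd a) \<omega> \<bullet> fst a)\<^sup>2 \<partial>M) \<le> 1" if "a \<in> A" for a
    unfolding sd_square using var[OF that] sd_nonneg by (simp add: power_le_one)
  have Bm: "measure N (B i) \<le> exp (- (sqrt (2 * ln (real i)) + \<epsilon>)\<^sup>2 / 2)" for i
  proof (cases "i = 0")
    case True
    then show ?thesis by (simp add: B_def)
  next
    case False
    have "measure N (B i) = measure M {\<omega>\<in>space M. \<exists>a\<in>A. m + (rate i + \<epsilon>) < X (snd a) \<omega> \<bullet> fst a}"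
      unfolding B_def using False exists_exceeds_transfer(2)[OF _ A, of i] by simp
    also have "\<dots> \<le> exp (- (rate i + \<epsilon>)\<^sup>2 / 2)"
      using rate_nonneg \<epsilon>
      by (intro borell_countable prob_M gaussian_family_subset[OF family A(2)] A(1) var' m) (auto intro: add_nonneg_nonneg)
    finally show ?thesis by (simp add: rate_def)
  qed
  have "AE \<omega> in N. \<forall>\<^sub>F i in sequentially. \<omega> \<in> space N - B i"
  proof (rule borel_cantelli_AE1)
    show "summable (\<lambda>i. measure N (B i))"
      by (rule summable_comparison_test'[OF summable_gaussian_tail[OF \<epsilon>]]) (use Bm in simp)
  qed (use B in \<open>auto simp: N.emeasure_eq_measure\<close>)
  then show ?thesis
    using AE_paths_bounded
  proof eventually_elim
    case (elim \<omega>)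
    obtain i0 where i0: "\<And>i. i \<ge> i0 \<Longrightarrow> \<omega> \<in> space N - B i"
      using elim(1) unfolding eventually_sequentially by blast
    obtain b where b: "\<And>i t. i \<ge> 1 \<Longrightarrow> t \<in> T \<Longrightarrow> norm (Y i t \<omega>) \<le> b i"
      using elim(2) by metis
    \<comment> \<open>Bounds the paths of all copies that may violate their own level, those with
      index below \<open>i0\<close>.\<close>
    define \<beta> where "\<beta> = (\<Sum>i\<le>i0. \<bar>b i\<bar>)"
    have \<beta>: "norm (Y i t \<omega>) \<le> \<beta>" if "1 \<le> i" "i \<le> i0" "t \<in> T" for i t
    proof -
      have "\<bar>b i\<bar> \<le> \<beta>" unfolding \<beta>_def using that(2) by (intro member_le_sum[of i "{..i0}" "\<lambda>i. \<bar>b i\<bar>"]) auto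
      then show ?thesis using b[OF that(1,3)] by linarith
    qed
    from eventually_rate_ge[of "\<beta> * \<bar>\<rho>\<bar> - m - \<epsilon>"] show ?case
    proof eventually_elim
      case (elim n)
      show ?case
      proof (intro ballI)
        fix i a assume i: "i \<in> {1..n}" and a: "a \<in> A"
        show "Y i (snd a) \<omega> \<bullet> fst a \<le> rate n + m + \<epsilon>"
        proof (cases "i \<ge> i0")
          case True
          have "\<not> m + (rate i + \<epsilon>) < Y i (snd a) \<omega> \<bullet> fst a"
            using i0[OF True] i a by (auto simp: B_def split: if_splits)
          then show ?thesis using rate_mono[of i n] i by simp
        next
          case False
          have "snd a \<in> T" using A(2) a by auto
          have "Y i (snd a) \<omega> \<bullet> fst a \<le> norm (Y i (snd a) \<omega>) * norm (fst a)" by (rule norm_cauchy_schwarz)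
          also have "\<dots> \<le> \<beta> * \<bar>\<rho>\<bar>"
            using \<beta>[of i "snd a"] \<rho>[OF a] i False \<open>snd a \<in> T\<close>
            by (intro mult_mono) (auto intro: order.trans[OF norm_ge_zero])
          finally show ?thesis using elim by linarith
        qed
      qed
    qed
  qed
qed

section \<open>Degenerate directions and normalised directions\<close>

definition Ker :: "(real ^ 'd) set" where "Ker = {u. p u = 0}"
definition V :: "(real ^ 'd) set" where "V = {v. \<forall>w\<in>Ker. orthogonal v w}"
text \<open>On \<open>V\<close> the function \<open>p\<close> is a norm and \<open>U\<close> is its
  unit sphere: compact, with all variances at most 1. Every direction outside \<open>Ker\<close> is
  a positive multiple of a point of \<open>U\<close> up to an element of \<open>Ker\<close>.\<close>

definition U :: "(real ^ 'd) set" where "U = {v\<in>V. p v = 1}"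

lemma Ker_cov_root: "u \<in> Ker \<longleftrightarrow> (\<forall>t\<in>T. cov_root t *v u = 0)"
proof
  assume "u \<in> Ker"
  show "\<forall>t\<in>T. cov_root t *v u = 0"
  proof
    fix t assume t: "t \<in> T"
    have "sd u t \<le> 0" using sd_le_p[OF t, of u] \<open>u \<in> Ker\<close> by (simp add: Ker_def)
    then show "cov_root t *v u = 0" by (simp add: sd_cov_root[OF t])
  qed
next
  assume "\<forall>t\<in>T. cov_root t *v u = 0"
  then have "p u \<le> 0" by (intro p_least) (simp add: sd_cov_root)
  then show "u \<in> Ker" using p_nonneg[of u] by (simp add: Ker_def)
qed

lemma subspace_Ker: "subspace Ker"
proof (rule subspaceI)
  show "0 \<in> Ker" unfolding Ker_cov_root by simp
  show "x + y \<in> Ker" if "x \<in> Ker" "y \<in> Ker" for x y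
    using that unfolding Ker_cov_root by (simp add: matrix_vector_right_distrib)
  show "c *\<^sub>R x \<in> Ker" if "x \<in> Ker" for c x
    using that unfolding Ker_cov_root by (simp add: matrix_vector_mult_scaleR)
qed

lemma subspace_V: "subspace V"
  unfolding V_def subspace_def by (auto simp: orthogonal_def inner_add_left)

lemma p_add_Ker: assumes w: "w \<in> Ker" shows "p (v + w) = p v"
proof -
  have "- w \<in> Ker" using subspace_neg[OF subspace_Ker w] .
  then have "p v \<le> p (v + w)" using p_triangle[of "v + w" "- w"] by (simp add: Ker_def)
  moreover have "p (v + w) \<le> p v" using p_triangle[of v w] w by (simp add: Ker_def)
  ultimately show ?thesis by simp
qed

lemma decomposition: obtains v w where "v \<in> V" "w \<in> Ker" "u = v + w"
proof -
  obtain w v where w: "w \<in> span Ker" and v: "\<And>x. x \<in> span Ker \<Longrightarrow> orthogonal v x" and u: "u = w + v"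
    using orthogonal_subspace_decomp_exists[of Ker u] by metis
  have "span Ker = Ker" using subspace_Ker by (simp only: span_eq_iff)
  then have "w \<in> Ker" "v \<in> V" using w v unfolding V_def by (simp_all only:) blast
  then show ?thesis using u by (intro that[of v w]) (simp_all add: add.commute)
qed

lemma V_Ker: "v \<in> V \<Longrightarrow> p v = 0 \<Longrightarrow> v = 0"
  unfolding V_def Ker_def by (auto simp: orthogonal_def)

text \<open>Equivalence of norms on \<open>V\<close>: the minimum of \<open>p\<close> over the
  Euclidean unit sphere of \<open>V\<close> is positive. If \<open>V\<close> is trivial, that sphere
  is empty and any constant works.\<close>

lemma p_lower_bound: obtains c where "0 < c" "\<And>v. v \<in> V \<Longrightarrow> c * norm v \<le> p v"
proof (cases "sphere 0 1 \<inter> V = {}")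
  case True
  have "v = 0" if "v \<in> V" for v
  proof (rule ccontr)
    assume "v \<noteq> 0"
    then have "v /\<^sub>R norm v \<in> sphere 0 1 \<inter> V" using that subspace_V by (auto simp: subspace_scale)
    then show False using True by auto
  qed
  then show ?thesis using p_nonneg by (intro that[of 1]) force+
next
  case False
  have "compact (sphere 0 1 \<inter> V)" using closed_subspace[OF subspace_V] by (intro compact_Int_closed) auto
  then obtain v0 where v0: "v0 \<in> sphere 0 1 \<inter> V" "\<And>v. v \<in> sphere 0 1 \<inter> V \<Longrightarrow> p v0 \<le> p v"
    using continuous_attains_inf[OF _ False p_continuous] by blast
  show ?thesis
  proof (rule that[of "p v0"])
    have "v0 \<noteq> 0" using v0(1) by auto
    then have "p v0 \<noteq> 0" using V_Ker[of v0] v0(1) by auto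
    then show "0 < p v0" using p_nonneg[of v0] by simp
    fix v assume v: "v \<in> V"
    show "p v0 * norm v \<le> p v"
    proof (cases "v = 0")
      case False
      then have "v /\<^sub>R norm v \<in> sphere 0 1 \<inter> V" using v subspace_V by (auto simp: subspace_scale)
      from v0(2)[OF this] have "p v0 \<le> inverse (norm v) * p v" by (simp add: p_scale)
      then show ?thesis using False by (simp add: field_simps)
    qed (simp add: p_nonneg)
  qed
qed

lemma U_bounded: obtains \<rho> where "0 < \<rho>" "\<And>v. v \<in> U \<Longrightarrow> norm v \<le> \<rho>"
proof -
  obtain c where c: "0 < c" "\<And>v. v \<in> V \<Longrightarrow> c * norm v \<le> p v" using p_lower_bound by blast
  show thesis
  proof (rule that[of "1 / c"])
    show "norm v \<le> 1 / c" if "v \<in> U" for v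
      using c(2)[of v] that c(1) by (simp add: U_def field_simps)
  qed (use c in simp)
qed

lemma compact_U: "compact U"
proof -
  obtain \<rho> where "\<And>v. v \<in> U \<Longrightarrow> norm v \<le> \<rho>" using U_bounded by blast
  then have "bounded U" by (auto simp: bounded_iff)
  moreover have "closed (V \<inter> {v. p v = 1})"
    using closed_subspace[OF subspace_V] by (intro closed_Int closed_Collect_eq p_continuous) auto
  then have "closed U" by (simp add: U_def Int_def)
  ultimately show ?thesis by (simp add: compact_eq_bounded_closed)
qed

lemma sd_U: "v \<in> U \<Longrightarrow> t \<in> T \<Longrightarrow> sd v t \<le> 1"
  using sd_le_p[of t v] by (simp add: U_def)

text \<open>A centred Gaussian variable of variance 0 vanishes almost surely. Countably many times
  and a finite basis of \<open>Ker\<close> yield one null set; closedness extends the equations to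
  \<open>T\<close>, linearity to \<open>Ker\<close>.\<close>

lemma AE_inner_Ker: "AE \<omega> in N. \<forall>i\<ge>1. \<forall>t\<in>T. \<forall>w\<in>Ker. Y i t \<omega> \<bullet> w = 0"
proof -
  obtain B where B: "B \<subseteq> Ker" "independent B" "Ker \<subseteq> span B" using basis_exists[of Ker] by metis
  have fB: "finite B" using B(2) by (rule independent_imp_finite)
  have single: "AE \<omega> in N. Y i t \<omega> \<bullet> w = 0" if i: "i \<ge> 1" and t: "t \<in> T" and w: "w \<in> Ker" for i :: nat and t w
  proof -
    \<comment> \<open>The directions \<open>w\<close> and \<open>- w\<close> together express a
      nonzero projection as an exceedance of 0, the kind of event that transfers to the
      copies.\<close>
    let ?A = "{(w, t), (- w, t)}"
    have A: "countable ?A" "?A \<subseteq> UNIV \<times> T" using t by auto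
    have "sd w t \<le> 0" using sd_le_p[OF t, of w] w by (simp add: Ker_def)
    then have "(\<integral>\<omega>. (X t \<omega> \<bullet> w)\<^sup>2 \<partial>M) = 0" using sd_nonneg[of w t] by (simp add: sd_square)
    from cgrv_variance_zero[OF prob_M gaussian_inner[OF t] this]
    have "AE \<omega> in M. \<not> (\<exists>a\<in>?A. 0 < X (snd a) \<omega> \<bullet> fst a)" by eventually_elim simp
    then have "measure M {\<omega>\<in>space M. \<exists>a\<in>?A. 0 < X (snd a) \<omega> \<bullet> fst a} = 0"
      by (intro M.prob_eq_0_AE) 
    then have "measure N {\<omega>\<in>space N. \<exists>a\<in>?A. 0 < Y i (snd a) \<omega> \<bullet> fst a} = 0"
      using exists_exceeds_transfer(2)[OF i A, of 0] by simp
    then have "AE \<omega> in N. \<not> (\<exists>a\<in>?A. 0 < Y i (snd a) \<omega> \<bullet> fst a)"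
      using exists_exceeds_transfer(1)[OF i A, of 0] N.prob_eq_0[of "{\<omega>\<in>space N. \<exists>a\<in>?A. 0 < Y i (snd a) \<omega> \<bullet> fst a}"]
      by (auto elim: AE_mp)
    then show ?thesis by eventually_elim auto
  qed
  have "AE \<omega> in N. \<forall>i::nat. i \<ge> 1 \<longrightarrow> (\<forall>t\<in>C. \<forall>w\<in>B. Y i t \<omega> \<bullet> w = 0)"
  proof (subst AE_all_countable, rule allI)
    fix i :: nat
    show "AE \<omega> in N. i \<ge> 1 \<longrightarrow> (\<forall>t\<in>C. \<forall>w\<in>B. Y i t \<omega> \<bullet> w = 0)"
    proof (cases "i \<ge> 1")
      case True
      have "AE \<omega> in N. \<forall>t\<in>C. \<forall>w\<in>B. Y i t \<omega> \<bullet> w = 0"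
        using True C B by (intro AE_ball_countable[THEN iffD2] C(1) ballI countable_finite fB single) auto
      then show ?thesis by eventually_elim simp
    qed simp
  qed
  then show ?thesis
    using C(5)
  proof eventually_elim
    case (elim \<omega>)
    show ?case
    proof (intro allI impI ballI)
      fix i :: nat and t w assume i: "1 \<le> i" and t: "t \<in> T" and w: "w \<in> Ker"
      have "closed (\<Inter>w\<in>B. {x. x \<bullet> w = 0})" by (intro closed_INT ballI closed_Collect_eq continuous_intros)
      moreover have "\<forall>t\<in>C. Y i t \<omega> \<in> (\<Inter>w\<in>B. {x. x \<bullet> w = 0})" using elim(1) i by auto
      ultimately have "Y i t \<omega> \<in> (\<Inter>w\<in>B. {x. x \<bullet> w = 0})" using elim(2) i t by blast
      then have "B \<subseteq> {w. Y i t \<omega> \<bullet> w = 0}" by auto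
      then have "span B \<subseteq> {w. Y i t \<omega> \<bullet> w = 0}" by (intro span_minimal subspace_hyperplane)
      then show "Y i t \<omega> \<bullet> w = 0" using B(3) w by auto
    qed
  qed
qed

section \<open>Upper bounds in all directions and at all times\<close>

lemma bound_all_directions:
  assumes K: "\<forall>w\<in>Ker. x \<bullet> w = 0" and b: "\<And>v. v \<in> U \<Longrightarrow> x \<bullet> v \<le> b"
  shows "x \<bullet> u \<le> p u * b"
proof -
  obtain v w where vw: "v \<in> V" "w \<in> Ker" "u = v + w" by (rule decomposition)
  have pu: "p u = p v" using p_add_Ker[OF vw(2)] vw(3) by simp
  have xu: "x \<bullet> u = x \<bullet> v" using K vw by (simp add: inner_add_right)
  show ?thesis
  proof (cases "p v = 0")
    case True
    then have "v = 0" by (rule V_Ker[OF vw(1)])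
    then show ?thesis using True by (simp add: pu xu)
  next
    case False
    then have pos: "0 < p v" using p_nonneg[of v] by simp
    have "inverse (p v) *\<^sub>R v \<in> U"
      using vw(1) pos subspace_V by (auto simp: U_def p_scale subspace_scale)
    from b[OF this] have "inverse (p v) * (x \<bullet> v) \<le> b" by simp
    then show ?thesis using pos by (simp add: pu xu field_simps)
  qed
qed

text \<open>Each piece has its own almost sure bound, so the number of pieces costs nothing and
  \<open>m\<close> has to be good only on each piece separately. Continuity extends the bound from
  \<open>U0\<close> to its closure, separability from \<open>C\<close> to \<open>T\<close>, and
  homogeneity of \<open>p\<close> from \<open>U\<close> to all directions.\<close>

lemma upper_pieces:
  assumes U0: "countable U0" "U0 \<subseteq> U" "U \<subseteq> closure U0" and J: "finite J"
    and cover: "U0 \<times> C \<subseteq> (\<Union>j\<in>J. A j)" and A: "\<And>j. j \<in> J \<Longrightarrow> A j \<subseteq> U0 \<times> C"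
    and m: "\<And>j F. j \<in> J \<Longrightarrow> finite F \<Longrightarrow> F \<noteq> {} \<Longrightarrow> F \<subseteq> A j \<Longrightarrow> (\<integral>\<omega>. Max ((\<lambda>a. X (snd a) \<omega> \<bullet> fst a) ` F) \<partial>M) \<le> m"
    and \<epsilon>: "0 < \<epsilon>"
  shows "AE \<omega> in N. \<forall>\<^sub>F n in sequentially. \<forall>i\<in>{1..n}. \<forall>t\<in>T. \<forall>u. Y i t \<omega> \<bullet> u \<le> p u * (rate n + (m + \<epsilon>))"
proof -
  obtain \<rho> where \<rho>: "\<And>v. v \<in> U \<Longrightarrow> norm v \<le> \<rho>" using U_bounded by blast
  have "AE \<omega> in N. \<forall>\<^sub>F n in sequentially. \<forall>i\<in>{1..n}. \<forall>a\<in>A j. Y i (snd a) \<omega> \<bullet> fst a \<le> rate n + m + \<epsilon>" if j: "j \<in> J" for j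
  proof (rule upper_eventually[where \<rho>=\<rho>])
    have "countable (U0 \<times> C)" using U0(1) C(1) by simp
    then show "countable (A j)" using A[OF j] by (rule countable_subset[rotated])
    have sub: "fst a \<in> U" "snd a \<in> T" if "a \<in> A j" for a using subsetD[OF A[OF j] that] U0(2) C(2) by auto
    show "A j \<subseteq> UNIV \<times> T" using sub by (auto intro: SigmaI)
    show "norm (fst a) \<le> \<rho>" if "a \<in> A j" for a using sub[OF that] \<rho> by auto
    show "sd (fst a) (snd a) \<le> 1" if "a \<in> A j" for a using sub[OF that] by (intro sd_U)
  qed (use m[OF j] \<epsilon> in auto)
  then have "AE \<omega> in N. \<forall>j\<in>J. \<forall>\<^sub>F n in sequentially. \<forall>i\<in>{1..n}. \<forall>a\<in>A j. Y i (snd a) \<omega> \<bullet> fst a \<le> rate n + m + \<epsilon>"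
    by (intro AE_finite_allI J)
  then show ?thesis
    using AE_inner_Ker C(5)
  proof eventually_elim
    case (elim \<omega>)
    have "\<forall>\<^sub>F n in sequentially. \<forall>j\<in>J. \<forall>i\<in>{1..n}. \<forall>a\<in>A j. Y i (snd a) \<omega> \<bullet> fst a \<le> rate n + m + \<epsilon>"
      using elim(1) by (intro eventually_ball_finite J) auto
    then show ?case
    proof eventually_elim
      case (elim n)
      show ?case
      proof (intro ballI allI)
        fix i t u assume i: "i \<in> {1..n}" and t: "t \<in> T"
        then have i1: "1 \<le> i" by simp
        show "Y i t \<omega> \<bullet> u \<le> p u * (rate n + (m + \<epsilon>))"
        proof (rule bound_all_directions)
          show "\<forall>w\<in>Ker. Y i t \<omega> \<bullet> w = 0"
            using \<open>\<forall>i\<ge>1. \<forall>t\<in>T. \<forall>w\<in>Ker. Y i t \<omega> \<bullet> w = 0\<close> i1 t by blast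
          have U0le: "Y i t \<omega> \<bullet> v \<le> rate n + (m + \<epsilon>)" if v: "v \<in> U0" for v
          proof -
            have "Y i t' \<omega> \<in> {x. x \<bullet> v \<le> rate n + (m + \<epsilon>)}" if "t' \<in> C" for t'
            proof -
              obtain j where j: "j \<in> J" "(v, t') \<in> A j" using cover v \<open>t' \<in> C\<close> by blast
              have "Y i (snd (v, t')) \<omega> \<bullet> fst (v, t') \<le> rate n + m + \<epsilon>"
                using elim i j by blast
              then show ?thesis by simp
            qed
            moreover have "closed {x. x \<bullet> v \<le> rate n + (m + \<epsilon>)}" by (intro closed_Collect_le continuous_intros)
            ultimately have "Y i t \<omega> \<in> {x. x \<bullet> v \<le> rate n + (m + \<epsilon>)}"
              using \<open>\<forall>i\<ge>1. \<forall>K. closed K \<longrightarrow> (\<forall>t\<in>C. Y i t \<omega> \<in> K) \<longrightarrow> (\<forall>t\<in>T. Y i t \<omega> \<in> K)\<close> i1 t by meson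
            then show ?thesis by simp
          qed
          have "closure U0 \<subseteq> {v. Y i t \<omega> \<bullet> v \<le> rate n + (m + \<epsilon>)}"
            using U0le by (intro closure_minimal closed_halfspace_le) auto
          then show "Y i t \<omega> \<bullet> v \<le> rate n + (m + \<epsilon>)" if "v \<in> U" for v using that U0(3) by auto
        qed
      qed
    qed
  qed
qed

text \<open>The whole index set is one piece. The quantile \<open>q * \<rho>\<close> and standard
  deviations at most 1 give \<open>m = q * \<rho> + 2\<close>, and \<open>\<delta>\<close> adds a
  slack of 1.\<close>

lemma upper_bounded:
  "\<exists>\<delta>\<ge>0. AE \<omega> in N. \<forall>\<^sub>F n in sequentially. \<forall>i\<in>{1..n}. \<forall>t\<in>T. \<forall>u. Y i t \<omega> \<bullet> u \<le> p u * (rate n + \<delta>)"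
proof -
  obtain \<rho> where \<rho>: "0 < \<rho>" "\<And>v. v \<in> U \<Longrightarrow> norm v \<le> \<rho>" using U_bounded by blast
  obtain U0 where U0: "countable U0" "U0 \<subseteq> U" "U \<subseteq> closure U0" using separable[of U] by metis
  have cAC: "countable (U0 \<times> C)" using U0(1) C(1) by simp
  have sub: "U0 \<times> C \<subseteq> UNIV \<times> T" using C(2) by auto
  have m: "(\<integral>\<omega>. Max ((\<lambda>a. X (snd a) \<omega> \<bullet> fst a) ` F) \<partial>M) \<le> q * \<rho> + 2 * 1"
    if F: "finite F" "F \<noteq> {}" "F \<subseteq> U0 \<times> C" for F
  proof (rule expectation_max_le[OF prob_M gaussian_family_subset[OF family sub] _ _ cAC _ F])
    show "(\<integral>\<omega>. (X (snd a) \<omega> \<bullet> fst a)\<^sup>2 \<partial>M) \<le> 1\<^sup>2" if "a \<in> U0 \<times> C" for a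
    proof -
      have "fst a \<in> U" "snd a \<in> T" using that U0(2) C(2) by auto
      then have "(sd (fst a) (snd a))\<^sup>2 \<le> 1\<^sup>2" using sd_U sd_nonneg by (intro power_mono)
      then show ?thesis unfolding sd_square .
    qed
    show "1/2 \<le> measure M {\<omega>\<in>space M. \<forall>a\<in>U0 \<times> C. X (snd a) \<omega> \<bullet> fst a \<le> q * \<rho>}"
    proof (rule order.trans[OF q(2) M.finite_measure_mono])
      show "{\<omega>\<in>space M. \<forall>t\<in>C. norm (X t \<omega>) \<le> q} \<subseteq> {\<omega>\<in>space M. \<forall>a\<in>U0 \<times> C. X (snd a) \<omega> \<bullet> fst a \<le> q * \<rho>}"
      proof safe
        fix \<omega> v t assume *: "\<forall>t\<in>C. norm (X t \<omega>) \<le> q" "v \<in> U0" "t \<in> C"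
        have "X t \<omega> \<bullet> v \<le> norm (X t \<omega>) * norm v" by (rule norm_cauchy_schwarz)
        also have "\<dots> \<le> q * \<rho>" using * \<rho>(2)[of v] U0(2) q(1) by (intro mult_mono) auto
        finally show "X (snd (v, t)) \<omega> \<bullet> fst (v, t) \<le> q * \<rho>" by simp
      qed
      show "{\<omega>\<in>space M. \<forall>a\<in>U0 \<times> C. X (snd a) \<omega> \<bullet> fst a \<le> q * \<rho>} \<in> sets M"
      proof (intro sets.sets_Collect_countable_All' cAC)
        fix a assume "a \<in> U0 \<times> C"
        then have "X (snd a) \<in> borel_measurable M" using C(2) X_measurable by auto
        then show "{\<omega>\<in>space M. X (snd a) \<omega> \<bullet> fst a \<le> q * \<rho>} \<in> sets M"
          by (intro borel_measurable_le borel_measurable_inner borel_measurable_const)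
      qed
    qed
  qed simp
  have "AE \<omega> in N. \<forall>\<^sub>F n in sequentially. \<forall>i\<in>{1..n}. \<forall>t\<in>T. \<forall>u. Y i t \<omega> \<bullet> u \<le> p u * (rate n + (q * \<rho> + 2 * 1 + 1))"
    by (rule upper_pieces[OF U0, of "{0::nat}" "\<lambda>_. U0 \<times> C"]) (use m in auto)
  then show ?thesis using q(1) \<rho>(1) by (intro exI[of _ "q * \<rho> + 2 * 1 + 1"]) auto
qed

lemma upper_continuous:
  assumes T: "compact T" and cont: "continuous_process M T X" and \<delta>: "0 < \<delta>"
  shows "AE \<omega> in N. \<forall>\<^sub>F n in sequentially. \<forall>i\<in>{1..n}. \<forall>t\<in>T. \<forall>u. Y i t \<omega> \<bullet> u \<le> p u * (rate n + \<delta>)"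
proof -
  \<comment> \<open>Half of \<open>\<delta>\<close> pays for the expected maxima
    \<open>5 * \<epsilon>\<close> on the pieces; the other half is the slack for
    Borel-Cantelli.\<close>
  define \<epsilon> where "\<epsilon> = \<delta> / 10"
  have \<epsilon>: "0 < \<epsilon>" using \<delta> by (simp add: \<epsilon>_def)
  obtain U0 where U0: "countable U0" "U0 \<subseteq> U" "U \<subseteq> closure U0" using separable[of U] by metis
  have cAC: "countable (U0 \<times> C)" using U0(1) C(1) by simp
  have sub: "U0 \<times> C \<subseteq> U \<times> T" using C(2) U0(2) by auto
  define Z where "Z a \<omega> = X (snd a) \<omega> \<bullet> fst a" for a :: "(real ^ 'd) \<times> 't" and \<omega>
  have Zm: "Z a \<in> borel_measurable M" if "a \<in> U \<times> T" for a
    unfolding Z_def[abs_def] using that by (intro borel_measurable_inner borel_measurable_const X_measurable) auto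
  \<comment> \<open>Path continuity gives each point of \<open>U \<times> T\<close> a radius at
    which the oscillation is at most \<open>\<epsilon>\<close> with probability at least 1/2. The
    radius depends on the point but not on the path, as the covering argument requires.\<close>
  have ex: "\<exists>k::nat. 1/2 \<le> measure M {\<omega>\<in>space M. \<forall>a\<in>(U0 \<times> C) \<inter> ball z (1 / (real k + 1)). \<bar>Z a \<omega> - Z z \<omega>\<bar> \<le> \<epsilon>}"
    if z: "z \<in> U \<times> T" for z
  proof (rule M.incseq_half)
    fix k :: nat
    show "{\<omega>\<in>space M. \<forall>a\<in>(U0 \<times> C) \<inter> ball z (1 / (real k + 1)). \<bar>Z a \<omega> - Z z \<omega>\<bar> \<le> \<epsilon>} \<in> sets M"
    proof (intro sets.sets_Collect_countable_All')
      show "countable ((U0 \<times> C) \<inter> ball z (1 / (real k + 1)))" using cAC by (rule countable_Int1)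
      fix a assume "a \<in> (U0 \<times> C) \<inter> ball z (1 / (real k + 1))"
      then have "a \<in> U \<times> T" using sub by auto
      then show "{\<omega>\<in>space M. \<bar>Z a \<omega> - Z z \<omega>\<bar> \<le> \<epsilon>} \<in> sets M"
        using Zm z by (intro borel_measurable_le borel_measurable_abs borel_measurable_diff borel_measurable_const) auto
    qed
  next
    show "incseq (\<lambda>k::nat. {\<omega>\<in>space M. \<forall>a\<in>(U0 \<times> C) \<inter> ball z (1 / (real k + 1)). \<bar>Z a \<omega> - Z z \<omega>\<bar> \<le> \<epsilon>})"
    proof (rule incseq_SucI)
      fix k :: nat
      have "ball z (1 / (real (Suc k) + 1)) \<subseteq> ball z (1 / (real k + 1))"
        by (intro subset_ball divide_left_mono) auto
      then show "{\<omega>\<in>space M. \<forall>a\<in>(U0 \<times> C) \<inter> ball z (1 / (real k + 1)). \<bar>Z a \<omega> - Z z \<omega>\<bar> \<le> \<epsilon>} \<subseteq>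
         {\<omega>\<in>space M. \<forall>a\<in>(U0 \<times> C) \<inter> ball z (1 / (real (Suc k) + 1)). \<bar>Z a \<omega> - Z z \<omega>\<bar> \<le> \<epsilon>}" by blast
    qed
    show "AE \<omega> in M. \<exists>k::nat. \<omega> \<in> {\<omega>\<in>space M. \<forall>a\<in>(U0 \<times> C) \<inter> ball z (1 / (real k + 1)). \<bar>Z a \<omega> - Z z \<omega>\<bar> \<le> \<epsilon>}"
      using cont unfolding continuous_process_def
    proof (rule AE_mp, intro AE_I2 impI)
      fix \<omega> assume \<omega>: "\<omega> \<in> space M" and c: "continuous_on T (\<lambda>t. X t \<omega>)"
      have "continuous_on (U \<times> T) (\<lambda>a. X (snd a) \<omega>)"
        by (rule continuous_on_compose2[OF c continuous_on_snd[OF continuous_on_id]]) auto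
      then have "continuous_on (U \<times> T) (\<lambda>a. Z a \<omega>)"
        unfolding Z_def by (intro continuous_on_inner continuous_on_fst continuous_on_id)
      then obtain d where d: "0 < d" "\<And>a. a \<in> U \<times> T \<Longrightarrow> dist a z < d \<Longrightarrow> dist (Z a \<omega>) (Z z \<omega>) < \<epsilon>"
        using z \<epsilon> unfolding continuous_on_iff by metis
      obtain k :: nat where k: "inverse (real (Suc k)) < d" using reals_Archimedean[OF d(1)] by blast
      show "\<exists>k::nat. \<omega> \<in> {\<omega>\<in>space M. \<forall>a\<in>(U0 \<times> C) \<inter> ball z (1 / (real k + 1)). \<bar>Z a \<omega> - Z z \<omega>\<bar> \<le> \<epsilon>}"
      proof (intro exI[of _ k] CollectI conjI ballI \<omega>)
        fix a assume a: "a \<in> (U0 \<times> C) \<inter> ball z (1 / (real k + 1))"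
        then have "dist a z < 1 / (real k + 1)" by (simp add: dist_commute)
        also have "\<dots> < d" using k by (simp add: inverse_eq_divide add.commute)
        finally have "dist (Z a \<omega>) (Z z \<omega>) < \<epsilon>" using d(2) a sub by blast
        then show "\<bar>Z a \<omega> - Z z \<omega>\<bar> \<le> \<epsilon>" by (simp add: dist_real_def)
      qed
    qed
  qed
  from bchoice[OF ballI[OF ex]] obtain k where k: "\<forall>z\<in>U \<times> T.
     1/2 \<le> measure M {\<omega>\<in>space M. \<forall>a\<in>(U0 \<times> C) \<inter> ball z (1 / (real (k z) + 1)). \<bar>Z a \<omega> - Z z \<omega>\<bar> \<le> \<epsilon>}" ..
  define P where "P z = ball z (1 / (real (k z) + 1))" for z
  have "compact (U \<times> T)" using compact_U T by (rule compact_Times)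
  moreover have "U \<times> T \<subseteq> (\<Union>z\<in>U \<times> T. P z)"
  proof
    fix z assume "z \<in> U \<times> T"
    moreover have "z \<in> P z" by (simp add: P_def)
    ultimately show "z \<in> (\<Union>z\<in>U \<times> T. P z)" by (rule UN_I)
  qed
  moreover have "open (P z)" for z by (simp add: P_def)
  ultimately obtain D where D: "D \<subseteq> U \<times> T" "finite D" "U \<times> T \<subseteq> (\<Union>z\<in>D. P z)"
    using compactE_image[of "U \<times> T" "U \<times> T" P] by metis
  have "AE \<omega> in N. \<forall>\<^sub>F n in sequentially. \<forall>i\<in>{1..n}. \<forall>t\<in>T. \<forall>u. Y i t \<omega> \<bullet> u \<le> p u * (rate n + (5 * \<epsilon> + 5 * \<epsilon>))"
  proof (rule upper_pieces[OF U0 D(2), where A="\<lambda>z. (U0 \<times> C) \<inter> P z"])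
    show "U0 \<times> C \<subseteq> (\<Union>z\<in>D. (U0 \<times> C) \<inter> P z)" using D(3) sub by (simp flip: Int_UN_distrib)
    show "(\<integral>\<omega>. Max ((\<lambda>a. X (snd a) \<omega> \<bullet> fst a) ` F) \<partial>M) \<le> 5 * \<epsilon>"
      if z: "z \<in> D" and F: "finite F" "F \<noteq> {}" "F \<subseteq> (U0 \<times> C) \<inter> P z" for z F
    proof (rule expectation_max_le_oscillation[where ?a0.0=z and A="(U0 \<times> C) \<inter> P z", OF prob_M _ _ \<epsilon> _ F])
      \<comment> \<open>The centre \<open>z\<close> may lie outside the countable set
        \<open>U0 \<times> C\<close>, so the family is taken with \<open>z\<close> inserted.\<close>
      have "insert z ((U0 \<times> C) \<inter> P z) \<subseteq> UNIV \<times> T" using z D(1) sub by auto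
      then show "gaussian_family M (insert z ((U0 \<times> C) \<inter> P z)) (\<lambda>a \<omega>. X (snd a) \<omega> \<bullet> fst a)"
        by (rule gaussian_family_subset[OF family])
      show "countable ((U0 \<times> C) \<inter> P z)" using cAC by (rule countable_Int1)
      have "z \<in> U \<times> T" using z D(1) by auto
      from bspec[OF k this] show "1/2 \<le> measure M {\<omega>\<in>space M. \<forall>a\<in>(U0 \<times> C) \<inter> P z. \<bar>X (snd a) \<omega> \<bullet> fst a - X (snd z) \<omega> \<bullet> fst z\<bar> \<le> \<epsilon>}"
        unfolding Z_def P_def .
    qed
  qed (use \<epsilon> in auto)
  then show ?thesis by (simp add: \<epsilon>_def)
qed

end

section \<open>Lower bound\<close>

text \<open>All \<open>n\<close> copies stay \<open>\<epsilon>\<close> below their level in a given direction with probability at most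
  \<open>exp (- c * exp (a * sqrt (ln n)))\<close>. This beats the cardinality of a grid of mesh \<open>1 / n\<close>, which is
  fine enough for the support functions to vary by \<open>o(1)\<close> between grid points.\<close>

definition grid :: "nat \<Rightarrow> (real ^ 'd) set" where
  "grid n = {v. \<forall>j. \<exists>k\<in>{- int n..int n}. v $ j = of_int k / real n}"

lemma grid_finite_card:
  "finite (grid n :: (real ^ 'd) set)" "card (grid n :: (real ^ 'd) set) \<le> (2 * n + 1) ^ CARD('d)"
proof -
  let ?P = "Pi\<^sub>E (UNIV :: 'd set) (\<lambda>_. {- int n..int n})"
  let ?g = "\<lambda>f. (\<chi> j. of_int (f j) / real n) :: real ^ 'd"
  have fin: "finite ?P" by (intro finite_PiE) auto
  have sub: "(grid n :: (real ^ 'd) set) \<subseteq> ?g ` ?P"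
  proof
    fix v :: "real ^ 'd" assume "v \<in> grid n"
    then have "\<forall>j. \<exists>k. k \<in> {- int n..int n} \<and> v $ j = of_int k / real n"
      unfolding grid_def mem_Collect_eq Bex_def .
    from choice[OF this] obtain f where f: "\<forall>j. f j \<in> {- int n..int n} \<and> v $ j = of_int (f j) / real n" ..
    show "v \<in> ?g ` ?P"
    proof (rule image_eqI)
      show "v = ?g f" using f by (simp add: vec_eq_iff)
      show "f \<in> ?P" using f by (simp add: PiE_iff)
    qed
  qed
  show "finite (grid n :: (real ^ 'd) set)" using sub fin by (rule finite_surj[rotated])
  have "card (grid n :: (real ^ 'd) set) \<le> card ?P" using surj_card_le[OF fin sub] .
  also have "\<dots> = (\<Prod>j\<in>(UNIV :: 'd set). card {- int n..int n})" by (rule card_PiE) simp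
  also have "\<dots> = (2 * n + 1) ^ CARD('d)"
  proof -
    have "card {- int n..int n} = 2 * n + 1" unfolding card_atLeastAtMost_int by linarith
    then show ?thesis by (simp only: prod_constant)
  qed
  finally show "card (grid n :: (real ^ 'd) set) \<le> (2 * n + 1) ^ CARD('d)" .
qed

lemma grid_norm: "v \<in> grid n \<Longrightarrow> norm (v :: real ^ 'd) \<le> CARD('d)"
proof -
  assume v: "v \<in> grid n"
  have "\<bar>v $ j\<bar> \<le> 1" for j
  proof -
    obtain k where k: "k \<in> {- int n..int n}" "v $ j = of_int k / real n" using v unfolding grid_def by blast
    have "\<bar>real_of_int k\<bar> \<le> real n" using k(1) by auto
    then show ?thesis unfolding k(2) by (cases "n = 0") (simp_all add: divide_le_eq_1)
  qed
  then have "(\<Sum>j\<in>UNIV. \<bar>v $ j\<bar>) \<le> (\<Sum>j\<in>(UNIV :: 'd set). 1)" by (intro sum_mono)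
  then show ?thesis using norm_le_l1_cart[of v] by simp
qed

lemma grid_near:
  fixes u :: "real ^ 'd"
  assumes u: "norm u \<le> 1" and n: "1 \<le> n"
  obtains v where "v \<in> grid n" "norm (u - v) \<le> CARD('d) / n"
proof -
  define k where "k j = \<lfloor>real n * u $ j\<rfloor>" for j
  define v :: "real ^ 'd" where "v = (\<chi> j. of_int (k j) / real n)"
  have k: "k j \<in> {- int n..int n}" for j
  proof -
    have "\<bar>u $ j\<bar> \<le> 1" using component_le_norm_cart[of u j] u by linarith
    then have "u $ j \<le> 1" "- 1 \<le> u $ j" by auto
    then have "real n * u $ j \<le> real n * 1" "real n * (- 1) \<le> real n * u $ j"
      by (intro mult_left_mono; simp)+
    then show ?thesis by (auto simp: k_def floor_le_iff le_floor_iff)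
  qed
  have "\<bar>(u - v) $ j\<bar> \<le> 1 / n" for j
  proof -
    have "\<bar>real n * u $ j - of_int (k j)\<bar> \<le> 1" unfolding k_def by linarith
    moreover have "(u - v) $ j = (real n * u $ j - of_int (k j)) / n" using n by (simp add: v_def field_simps)
    ultimately show ?thesis using n by (simp add: divide_right_mono)
  qed
  then have "(\<Sum>j\<in>UNIV. \<bar>(u - v) $ j\<bar>) \<le> (\<Sum>j\<in>(UNIV :: 'd set). 1 / n)" by (intro sum_mono)
  then have "norm (u - v) \<le> CARD('d) / n" using norm_le_l1_cart[of "u - v"] by simp
  moreover have "v \<in> grid n" using k by (auto simp: grid_def v_def)
  ultimately show ?thesis by (rule that[rotated])
qed

lemma double_exponential_decay:
  fixes a c D :: real
  assumes "0 < a" "0 < c" "0 \<le> D"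
  shows "\<forall>\<^sub>F n::nat in sequentially. exp (D * ln (2 * real n + 1) - c * exp (a * sqrt (2 * ln (real n)))) \<le> real n powr (-2)"
  using assms by real_asymp

text \<open>For \<open>n \<ge> 1\<close> one has
  \<open>exp (- (rate n)\<^sup>2 / 2) = 1 / n\<close>, so the shift by \<open>a\<close> turns the
  exponent into \<open>c * exp (a * rate n)\<close> up to sign. This outgrows every multiple of
  \<open>ln n\<close> and so beats the polynomial factor.\<close>

lemma grid_union_bound_summable:
  assumes a: "0 < a"
  shows "summable (\<lambda>n. (2 * real n + 1) ^ k * exp (- (real n * (a * std_normal_density (rate n - a)))))"
proof (rule summable_comparison_test_ev)
  define c where "c = a * (1 / sqrt (2 * pi)) * exp (- a\<^sup>2 / 2)"
  have c: "0 < c" using a by (simp add: c_def)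
  have eq: "(2 * real n + 1) ^ k * exp (- (real n * (a * std_normal_density (rate n - a))))
     = exp (real k * ln (2 * real n + 1) - c * exp (a * sqrt (2 * ln (real n))))" if n: "1 \<le> n" for n
  proof -
    have sc: "(rate n)\<^sup>2 = 2 * ln (real n)" using n by (simp add: rate_def)
    have "- (rate n - a)\<^sup>2 / 2 = - ln (real n) + (- a\<^sup>2 / 2 + a * rate n)"
      using sc by (simp add: power2_diff field_simps)
    then have "exp (- (rate n - a)\<^sup>2 / 2) = inverse (real n) * (exp (- a\<^sup>2 / 2) * exp (a * rate n))"
      using n by (simp only: exp_add exp_minus exp_ln of_nat_0_less_iff)
    then have "real n * (a * std_normal_density (rate n - a)) = c * exp (a * sqrt (2 * ln (real n)))"
      using n by (simp add: std_normal_density_def c_def rate_def)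
    moreover have "(2 * real n + 1) ^ k = exp (real k * ln (2 * real n + 1))"
      by (simp add: exp_of_nat_mult)
    ultimately show ?thesis by (simp add: exp_diff exp_minus field_simps)
  qed
  show "\<forall>\<^sub>F n in sequentially. norm ((2 * real n + 1) ^ k * exp (- (real n * (a * std_normal_density (rate n - a))))) \<le> real n powr (-2)"
    using double_exponential_decay[OF a c of_nat_0_le_iff[of k]] eventually_ge_at_top[of 1]
  proof eventually_elim
    case (elim n)
    have "norm ((2 * real n + 1) ^ k * exp (- (real n * (a * std_normal_density (rate n - a))))) =
      (2 * real n + 1) ^ k * exp (- (real n * (a * std_normal_density (rate n - a))))" by simp
    also have "\<dots> \<le> real n powr (-2)" using elim(1) eq[OF elim(2)] by simp
    finally show ?case .
  qed
  show "summable (\<lambda>n. real n powr (-2))" by (simp add: summable_real_powr_iff)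
qed

lemma grid_error_tendsto_0:
  fixes c \<delta> d :: real
  shows "(\<lambda>n. c * (rate n + \<delta>) * (d / real n) + c * (d / real n) * rate n) \<longlonglongrightarrow> 0"
  unfolding rate_def by real_asymp

section \<open>Lower bounds on the grid and in all directions\<close>

context gaussian_copies
begin

text \<open>With one time for all copies the events are independent, each of probability at most
  \<open>1 - x \<le> exp (- x)\<close>, where \<open>x\<close> is the lower bound from
  \<open>cgrv_tail_ge\<close>.\<close>

lemma all_below_prob:
  assumes n: "1 \<le> n" and t: "t \<in> T" and \<epsilon>: "0 < \<epsilon>" and K: "0 < K" "sd v t \<le> K" "\<epsilon> / K \<le> rate n"
  shows "{\<omega>\<in>space N. \<forall>i\<in>{1..n}. Y i t \<omega> \<bullet> v < rate n * sd v t - \<epsilon>} \<in> sets N"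
    and "measure N {\<omega>\<in>space N. \<forall>i\<in>{1..n}. Y i t \<omega> \<bullet> v < rate n * sd v t - \<epsilon>}
      \<le> exp (- (real n * (\<epsilon> / (2 * K) * std_normal_density (rate n - \<epsilon> / (2 * K)))))"
proof -
  let ?c = "rate n * sd v t - \<epsilon>"
  let ?\<pi> = "\<epsilon> / (2 * K) * std_normal_density (rate n - \<epsilon> / (2 * K))"
  let ?E = "{x \<in> space (process_space T). x t \<bullet> v < ?c}"
  have E: "?E \<in> sets (process_space T)"
    using t by (intro borel_measurable_less borel_measurable_const borel_measurable_inner coordinate_measurable)
  have vim: "{\<omega>\<in>space N. Y i t \<omega> \<bullet> v < ?c} = sample_path T (Y i) -` ?E \<inter> space N" if "i \<ge> 1" for i
    using t measurable_space[OF sample_path_Y[OF that]] by (auto simp: sample_path_def)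
  have set_eq: "{\<omega>\<in>space N. \<forall>i\<in>{1..n}. Y i t \<omega> \<bullet> v < ?c} = (\<Inter>i\<in>{1..n}. sample_path T (Y i) -` ?E \<inter> space N)"
  proof -
    have "{\<omega>\<in>space N. \<forall>i\<in>{1..n}. Y i t \<omega> \<bullet> v < ?c} = (\<Inter>i\<in>{1..n}. {\<omega>\<in>space N. Y i t \<omega> \<bullet> v < ?c})"
      using n by auto
    also have "\<dots> = (\<Inter>i\<in>{1..n}. sample_path T (Y i) -` ?E \<inter> space N)" by (intro INF_cong refl vim) auto
    finally show ?thesis .
  qed
  show "{\<omega>\<in>space N. \<forall>i\<in>{1..n}. Y i t \<omega> \<bullet> v < ?c} \<in> sets N"
    unfolding set_eq using n E by (intro sets.finite_INT measurable_sets[OF sample_path_Y]) auto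
  have indep: "N.indep_vars (\<lambda>_. process_space T) (\<lambda>i. sample_path T (Y i)) {1..}"
    using copies by (simp add: iid_copies_def)
  have single: "measure N (sample_path T (Y i) -` ?E \<inter> space N) \<le> 1 - ?\<pi>" if i: "i \<ge> 1" for i
  proof -
    have "measure N (sample_path T (Y i) -` ?E \<inter> space N) = measure N {\<omega>\<in>space N. sample_path T (Y i) \<omega> \<in> ?E}"
      by (rule arg_cong[where f="measure N"]) auto
    also have "\<dots> = measure M {\<omega>\<in>space M. sample_path T X \<omega> \<in> ?E}" by (rule law_transfer[OF i E])
    also have "{\<omega>\<in>space M. sample_path T X \<omega> \<in> ?E} = {\<omega>\<in>space M. \<not> ?c \<le> X t \<omega> \<bullet> v}"
      using t measurable_space[OF sample_path_X] by (auto simp: sample_path_def)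
    also have "measure M \<dots> = 1 - measure M {\<omega>\<in>space M. ?c \<le> X t \<omega> \<bullet> v}"
      using t by (intro M.prob_neg) (intro borel_measurable_le borel_measurable_const borel_measurable_inner X_measurable)
    also have "\<dots> \<le> 1 - ?\<pi>"
      using cgrv_tail_ge[OF prob_M gaussian_inner[OF t] \<epsilon> K(1,3), of v] K(2) by (simp add: sd_def)
    finally show ?thesis .
  qed
  have "measure N {\<omega>\<in>space N. \<forall>i\<in>{1..n}. Y i t \<omega> \<bullet> v < ?c} = (\<Prod>i\<in>{1..n}. measure N (sample_path T (Y i) -` ?E \<inter> space N))"
    unfolding set_eq using n E by (intro N.indep_varsD[OF indep]) auto
  also have "\<dots> \<le> (\<Prod>i\<in>{1..n}. exp (- ?\<pi>))"
  proof (rule prod_mono)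
    fix i assume "i \<in> {1..n}"
    then have "measure N (sample_path T (Y i) -` ?E \<inter> space N) \<le> 1 - ?\<pi>" by (intro single) simp
    also have "\<dots> \<le> exp (- ?\<pi>)" using exp_ge_add_one_self[of "- ?\<pi>"] by simp
    finally show "0 \<le> measure N (sample_path T (Y i) -` ?E \<inter> space N) \<and> measure N (sample_path T (Y i) -` ?E \<inter> space N) \<le> exp (- ?\<pi>)"
      by simp
  qed
  also have "\<dots> = exp (- ?\<pi>) ^ n" by simp
  also have "\<dots> = exp (real n * (- ?\<pi>))" by (rule exp_of_nat_mult[symmetric])
  finally show "measure N {\<omega>\<in>space N. \<forall>i\<in>{1..n}. Y i t \<omega> \<bullet> v < ?c} \<le> exp (- (real n * ?\<pi>))" by simp
qed

text \<open>For each \<open>n\<close> and \<open>v\<close> a deterministic near maximiser of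
  \<open>sd v\<close> replaces the supremum over times; since it does not depend on
  \<open>\<omega>\<close>, the probabilities of the copies can be multiplied.\<close>

lemma lower_on_grid:
  assumes \<epsilon>: "0 < \<epsilon>"
  shows "AE \<omega> in N. \<forall>\<^sub>F n in sequentially. \<forall>v\<in>grid n. \<exists>i\<in>{1..n}. \<exists>t\<in>T. p v * rate n - \<epsilon> \<le> Y i t \<omega> \<bullet> v"
proof -
  \<comment> \<open>Bounds all standard deviations on the grid, whose points have norm at most
    \<open>CARD('d)\<close>.\<close>
  define K where "K = 2 * q * CARD('d)"
  have K: "0 < K" using q(1) by (simp add: K_def)
  \<comment> \<open>\<open>\<epsilon> / 2\<close> goes into the Gaussian tail bound; the other half
    pays for the choice of the time \<open>t n v\<close>.\<close>
  define a where "a = \<epsilon> / 2 / (2 * K)"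
  have a: "0 < a" using \<epsilon> K by (simp add: a_def)
  \<comment> \<open>The accuracy shrinks like \<open>1 / rate n\<close> because it is going to be
    multiplied by \<open>rate n\<close>; the summand 1 avoids division by 0.\<close>
  have ex: "\<exists>t. t \<in> T \<and> p v - \<epsilon> / (2 * (rate n + 1)) < sd v t" for n v
  proof -
    have "0 < \<epsilon> / (2 * (rate n + 1))" using \<epsilon> rate_nonneg[of n] by (intro divide_pos_pos) auto
    from p_approx[OF this] show ?thesis by blast
  qed
  define t where "t n v = (SOME t. t \<in> T \<and> p v - \<epsilon> / (2 * (rate n + 1)) < sd v t)" for n v
  have t: "t n v \<in> T" "p v - \<epsilon> / (2 * (rate n + 1)) < sd v (t n v)" for n v
    using someI_ex[OF ex[of v n]] unfolding t_def by blast+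
  have near: "p v * rate n - \<epsilon> \<le> rate n * sd v (t n v) - \<epsilon> / 2" for n v
  proof -
    have s: "0 \<le> rate n" by (rule rate_nonneg)
    have "rate n * (p v - sd v (t n v)) \<le> rate n * (\<epsilon> / (2 * (rate n + 1)))"
      using t(2)[of v n] s by (intro mult_left_mono) auto
    also have "\<dots> \<le> \<epsilon> / 2" using s \<epsilon> by (simp add: field_simps)
    finally show ?thesis by (simp add: algebra_simps)
  qed
  define E where "E n v = {\<omega>\<in>space N. \<forall>i\<in>{1..n}. Y i (t n v) \<omega> \<bullet> v < rate n * sd v (t n v) - \<epsilon> / 2}" for n v
  obtain n0 where n0: "\<And>n. n \<ge> n0 \<Longrightarrow> \<epsilon> / 2 / K \<le> rate n"
    using eventually_rate_ge[of "\<epsilon> / 2 / K"] unfolding eventually_sequentially by blast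
  define D where "D n = (if n < max 1 n0 then {} else (\<Union>v\<in>grid n. E n v))" for n
  have Ev: "E n v \<in> sets N" "measure N (E n v) \<le> exp (- (real n * (a * std_normal_density (rate n - a))))"
    if n: "\<not> n < max 1 n0" and v: "v \<in> grid n" for n v
  proof -
    have "sd v (t n v) \<le> 2 * q * norm v" by (rule sd_le[OF t(1)])
    also have "\<dots> \<le> K" unfolding K_def using grid_norm[OF v] q(1) by (intro mult_left_mono) auto
    finally have sK: "sd v (t n v) \<le> K" .
    have n1: "1 \<le> n" "\<epsilon> / 2 / K \<le> rate n" "0 < \<epsilon> / 2" using n n0[of n] \<epsilon> by auto
    show "E n v \<in> sets N" "measure N (E n v) \<le> exp (- (real n * (a * std_normal_density (rate n - a))))"
      unfolding E_def a_def using all_below_prob[OF n1(1) t(1) n1(3) K sK n1(2)] by blast+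
  qed
  have Dm: "D n \<in> sets N" for n
    unfolding D_def using Ev(1) grid_finite_card(1) by (auto intro: sets.finite_UN)
  have Db: "measure N (D n) \<le> (2 * real n + 1) ^ CARD('d) * exp (- (real n * (a * std_normal_density (rate n - a))))" for n
  proof (cases "n < max 1 n0")
    case True
    then show ?thesis by (simp add: D_def)
  next
    case False
    let ?e = "exp (- (real n * (a * std_normal_density (rate n - a))))"
    have "measure N (D n) \<le> (\<Sum>v\<in>grid n. measure N (E n v))"
      unfolding D_def using False Ev(1)[OF False] grid_finite_card(1)
      by (auto intro!: N.finite_measure_subadditive_finite)
    also have "\<dots> \<le> (\<Sum>v\<in>(grid n :: (real ^ 'd) set). ?e)" by (intro sum_mono Ev(2) False)
    also have "\<dots> = real (card (grid n :: (real ^ 'd) set)) * ?e" by simp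
    also have "\<dots> \<le> real ((2 * n + 1) ^ CARD('d)) * ?e"
      by (intro mult_right_mono of_nat_mono grid_finite_card(2)) simp
    finally show ?thesis by (simp add: add.commute)
  qed
  have "AE \<omega> in N. \<forall>\<^sub>F n in sequentially. \<omega> \<in> space N - D n"
  proof (rule borel_cantelli_AE1)
    show "summable (\<lambda>n. measure N (D n))"
      by (rule summable_comparison_test'[OF grid_union_bound_summable[OF a, of "CARD('d)"]]) (use Db in simp)
  qed (use Dm in \<open>auto simp: N.emeasure_eq_measure\<close>)
  then show ?thesis
  proof eventually_elim
    case (elim \<omega>)
    from elim eventually_ge_at_top[of "max 1 n0"] show ?case
    proof eventually_elim
      case (elim n)
      show ?case
      proof
        fix v :: "real ^ 'd" assume v: "v \<in> grid n"
        have "\<not> n < max 1 n0" using elim(2) by (simp only: not_less)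
        then have "D n = (\<Union>v\<in>grid n. E n v)" by (simp only: D_def if_False)
        then have "\<omega> \<notin> E n v" "\<omega> \<in> space N" using elim(1) v by auto
        then obtain i where i: "i \<in> {1..n}" "rate n * sd v (t n v) - \<epsilon> / 2 \<le> Y i (t n v) \<omega> \<bullet> v"
          by (auto simp: E_def not_less)
        then have "p v * rate n - \<epsilon> \<le> Y i (t n v) \<omega> \<bullet> v" using near[of v n] by linarith
        then show "\<exists>i\<in>{1..n}. \<exists>t\<in>T. p v * rate n - \<epsilon> \<le> Y i t \<omega> \<bullet> v" using i(1) t(1) by blast
      qed
    qed
  qed
qed

text \<open>Passing from a grid point to a unit vector changes the projection of a value by its norm
  times the mesh, and \<open>p u * rate n\<close> by a multiple of \<open>rate n\<close> times the
  mesh. Both errors are of order \<open>rate n / n\<close>, the norm being controlled by the upper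
  bound.\<close>

lemma lower_all_directions:
  assumes up: "\<forall>\<^sub>F n in sequentially. \<forall>i\<in>{1..n}. \<forall>t\<in>T. \<forall>u. Y i t \<omega> \<bullet> u \<le> p u * (rate n + \<delta>)" and \<delta>: "0 \<le> \<delta>"
    and lo: "\<forall>\<^sub>F n in sequentially. \<forall>v\<in>grid n. \<exists>i\<in>{1..n}. \<exists>t\<in>T. p v * rate n - \<epsilon> \<le> Y i t \<omega> \<bullet> v" and \<epsilon>: "0 < \<epsilon>"
  shows "\<forall>\<^sub>F n in sequentially. \<forall>u. norm u = 1 \<longrightarrow> (\<exists>i\<in>{1..n}. \<exists>t\<in>T. p u * rate n - 2 * \<epsilon> \<le> Y i t \<omega> \<bullet> u)"
proof -
  define d where "d = real CARD('d)"
  have q0: "0 < 2 * q" using q(1) by simp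
  note grid_error_tendsto_0[of "2 * q" \<delta> d]
  then have small: "\<forall>\<^sub>F n in sequentially. 2 * q * (rate n + \<delta>) * (d / real n) + 2 * q * (d / real n) * rate n < \<epsilon>"
    using \<epsilon> by (intro order_tendstoD) auto
  from up lo small eventually_ge_at_top[of 1] show ?thesis
  proof eventually_elim
    case (elim n)
    show ?case
    proof (intro allI impI)
      fix u :: "real ^ 'd" assume u: "norm u = 1"
      obtain v where v: "v \<in> grid n" "norm (u - v) \<le> d / n"
        using grid_near[of u n] u elim(4) unfolding d_def by auto
      obtain i t where it: "i \<in> {1..n}" "t \<in> T" "p v * rate n - \<epsilon> \<le> Y i t \<omega> \<bullet> v" using elim(2) v(1) by blast
      let ?y = "Y i t \<omega>"
      have s: "0 \<le> rate n" by (rule rate_nonneg)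
      \<comment> \<open>The upper bound in the direction \<open>?y\<close> itself bounds the norm of
        \<open>?y\<close>.\<close>
      have "?y \<bullet> ?y \<le> p ?y * (rate n + \<delta>)" using elim(1) it by blast
      also have "\<dots> \<le> (2 * q * norm ?y) * (rate n + \<delta>)" using p_le s \<delta> by (intro mult_right_mono) auto
      finally have "norm ?y * norm ?y \<le> norm ?y * (2 * q * (rate n + \<delta>))"
        by (simp add: dot_square_norm power2_eq_square mult_ac)
      then have y: "norm ?y \<le> 2 * q * (rate n + \<delta>)"
        using q0 s \<delta> by (cases "?y = 0") auto
      have "?y \<bullet> (v - u) \<le> norm ?y * norm (v - u)" by (rule norm_cauchy_schwarz)
      also have "\<dots> \<le> 2 * q * (rate n + \<delta>) * (d / n)"
        using y v(2) q0 s \<delta> by (intro mult_mono) (auto simp: norm_minus_commute)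
      finally have e1: "?y \<bullet> v - ?y \<bullet> u \<le> 2 * q * (rate n + \<delta>) * (d / n)" by (simp add: inner_diff_right)
      have "p u \<le> p v + 2 * q * (d / n)"
        using p_lipschitz[of u v] mult_left_mono[OF v(2), of "2 * q"] q0 by linarith
      then have "p u * rate n \<le> (p v + 2 * q * (d / n)) * rate n" using s by (rule mult_right_mono)
      then have e2: "p u * rate n \<le> p v * rate n + 2 * q * (d / n) * rate n" by (simp add: distrib_right)
      have "p u * rate n - 2 * \<epsilon> \<le> ?y \<bullet> u" using e1 e2 it(3) elim(3) by linarith
      then show "\<exists>i\<in>{1..n}. \<exists>t\<in>T. p u * rate n - 2 * \<epsilon> \<le> Y i t \<omega> \<bullet> u" using it by blast
    qed
  qed
qed

section \<open>Hausdorff distance from the support function estimates\<close>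

lemma scaled_hull_convex_bodies:
  assumes b: "\<forall>i\<ge>1. \<exists>b. \<forall>t\<in>T. norm (Y i t \<omega>) \<le> b" and n: "1 \<le> n"
  shows "scaled_hull T Y n \<omega> \<in> convex_bodies"
proof -
  let ?S = "{Y i t \<omega> | i t. i \<in> {1..n} \<and> t \<in> T}"
  have S: "?S = (\<Union>i\<in>{1..n}. (\<lambda>t. Y i t \<omega>) ` T)" by blast
  have "bounded ?S" unfolding S
  proof (intro bounded_UN ballI finite_atLeastAtMost)
    fix i assume "i \<in> {1..n}"
    then show "bounded ((\<lambda>t. Y i t \<omega>) ` T)" using b by (auto simp: bounded_iff)
  qed
  moreover have "?S \<noteq> {}" unfolding S using n T_nonempty by auto
  ultimately have "process_hull T Y n \<omega> \<in> convex_bodies"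
    unfolding process_hull_def by (rule closed_convex_hull_convex_bodies)
  then show ?thesis
    unfolding scaled_hull_def convex_bodies_def by (auto intro: compact_scaling convex_scaling)
qed

text \<open>Additive errors of the support functions are divided by \<open>rate n\<close>, which is
  positive for \<open>2 \<le> n\<close>; the factor \<open>2 * q\<close> bounds \<open>p\<close> on
  unit vectors.\<close>

lemma hausdorff_bound:
  assumes b: "\<forall>i\<ge>1. \<exists>b. \<forall>t\<in>T. norm (Y i t \<omega>) \<le> b"
    and up: "\<forall>i\<in>{1..n}. \<forall>t\<in>T. \<forall>u. Y i t \<omega> \<bullet> u \<le> p u * (rate n + \<delta>)" and \<delta>: "0 \<le> \<delta>"
    and lo: "\<forall>u. norm u = 1 \<longrightarrow> (\<exists>i\<in>{1..n}. \<exists>t\<in>T. p u * rate n - \<epsilon> \<le> Y i t \<omega> \<bullet> u)" and \<epsilon>: "0 \<le> \<epsilon>"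
    and n: "2 \<le> n"
  shows "0 \<le> hausdorff_distance (scaled_hull T Y n \<omega>) (limit_body M T X)"
    and "hausdorff_distance (scaled_hull T Y n \<omega>) (limit_body M T X) \<le> (2 * q * \<delta> + \<epsilon>) / rate n"
proof -
  let ?A = "scaled_hull T Y n \<omega>" and ?W = "limit_body M T X"
  have s: "0 < rate n" using n by (simp add: rate_def)
  have q0: "0 < 2 * q" using q(1) by simp
  have A: "?A \<in> convex_bodies" using n by (intro scaled_hull_convex_bodies b) simp
  note W = limit_body_convex_bodies
  let ?e = "(2 * q * \<delta> + \<epsilon>) / rate n"
  have e0: "0 \<le> ?e" using q0 \<delta> \<epsilon> s by simp
  have e1: "2 * q * \<delta> / rate n \<le> ?e" "\<epsilon> / rate n \<le> ?e" using q0 \<delta> \<epsilon> s by (auto intro!: divide_right_mono)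
  have hullA: "x \<bullet> u \<le> p u + ?e" if x: "x \<in> ?A" and u: "norm u = 1" for x u
  proof -
    obtain z where z: "z \<in> process_hull T Y n \<omega>" "x = (1 / rate n) *\<^sub>R z"
      using x by (auto simp: scaled_hull_def rate_def)
    have "z \<bullet> u \<le> p u * (rate n + \<delta>)"
      using z(1) unfolding process_hull_def by (rule closed_convex_hull_inner_le) (use up in auto)
    then have "(z \<bullet> u) / rate n \<le> p u * (rate n + \<delta>) / rate n" using s by (intro divide_right_mono) auto
    also have "\<dots> = p u + p u * \<delta> / rate n" using s by (simp add: field_simps)
    also have "\<dots> \<le> p u + 2 * q * \<delta> / rate n"
      using p_le[of u] u s \<delta> by (intro add_left_mono divide_right_mono mult_right_mono) auto
    finally show ?thesis using z(2) e1(1) by simp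
  qed
  have gen: "\<exists>x\<in>?A. p u - \<epsilon> / rate n \<le> x \<bullet> u" if u: "norm u = 1" for u
  proof -
    obtain i t where it: "i \<in> {1..n}" "t \<in> T" "p u * rate n - \<epsilon> \<le> Y i t \<omega> \<bullet> u" using lo u by blast
    have "Y i t \<omega> \<in> process_hull T Y n \<omega>"
      unfolding process_hull_def by (rule subsetD[OF closed_convex_hull_superset]) (use it in auto)
    then have "(1 / rate n) *\<^sub>R Y i t \<omega> \<in> ?A" unfolding scaled_hull_def rate_def by (rule imageI)
    moreover have "(p u * rate n - \<epsilon>) / rate n \<le> (Y i t \<omega> \<bullet> u) / rate n" using it(3) s by (intro divide_right_mono) auto
    then have "p u - \<epsilon> / rate n \<le> ((1 / rate n) *\<^sub>R Y i t \<omega>) \<bullet> u" using s by (simp add: diff_divide_distrib)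
    ultimately show ?thesis by blast
  qed
  have AW: "\<exists>w\<in>?W. dist x w \<le> ?e" if x: "x \<in> ?A" for x
  proof (rule near_convex_set)
    show "\<exists>w\<in>?W. x \<bullet> u \<le> w \<bullet> u + ?e + \<eta>" if u: "norm u = 1" and \<eta>: "0 < \<eta>" for u \<eta>
    proof -
      obtain w where "w \<in> ?W" "p u - \<eta> < w \<bullet> u" using limit_body_approx[OF \<eta>] by blast
      then show ?thesis using hullA[OF x u] by (intro bexI[of _ w]) linarith+
    qed
  qed (use W e0 in \<open>auto simp: convex_bodies_def compact_imp_closed\<close>)
  have WA: "\<exists>x\<in>?A. dist x w \<le> ?e" if w: "w \<in> ?W" for w
  proof -
    have "\<exists>x\<in>?A. dist w x \<le> ?e"
    proof (rule near_convex_set)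
      show "\<exists>x\<in>?A. w \<bullet> u \<le> x \<bullet> u + ?e + \<eta>" if u: "norm u = 1" and \<eta>: "0 < \<eta>" for u \<eta>
      proof -
        obtain x where "x \<in> ?A" "p u - \<epsilon> / rate n \<le> x \<bullet> u" using gen[OF u] by blast
        then show ?thesis using limit_body_le[OF w, of u] e1(2) \<eta> by (intro bexI[of _ x]) linarith+
      qed
    qed (use A e0 in \<open>auto simp: convex_bodies_def compact_imp_closed\<close>)
    then show ?thesis by (simp add: dist_commute)
  qed
  have ne: "?A \<noteq> {}" "?W \<noteq> {}" using A W by (auto simp: convex_bodies_def)
  show "0 \<le> hausdorff_distance ?A ?W" by (rule hausdorff_distance_bounds(1)[OF ne e0 AW WA])
  show "hausdorff_distance ?A ?W \<le> ?e" by (rule hausdorff_distance_bounds(2)[OF ne e0 AW WA])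
qed

lemma hausdorff_eventually:
  assumes b: "\<forall>i\<ge>1. \<exists>b. \<forall>t\<in>T. norm (Y i t \<omega>) \<le> b"
    and up: "\<forall>\<^sub>F n in sequentially. \<forall>i\<in>{1..n}. \<forall>t\<in>T. \<forall>u. Y i t \<omega> \<bullet> u \<le> p u * (rate n + \<delta>)" and \<delta>: "0 \<le> \<delta>"
    and lo: "\<forall>\<^sub>F n in sequentially. \<forall>v\<in>grid n. \<exists>i\<in>{1..n}. \<exists>t\<in>T. p v * rate n - \<epsilon> \<le> Y i t \<omega> \<bullet> v" and \<epsilon>: "0 < \<epsilon>"
  shows "\<forall>\<^sub>F n in sequentially. \<bar>hausdorff_distance (scaled_hull T Y n \<omega>) (limit_body M T X)\<bar> \<le> (2 * q * \<delta> + 2 * \<epsilon>) / rate n"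
  using up lower_all_directions[OF up \<delta> lo \<epsilon>] eventually_ge_at_top[of 2]
proof eventually_elim
  case (elim n)
  have "0 \<le> 2 * \<epsilon>" using \<epsilon> by simp
  from hausdorff_bound[OF b elim(1) \<delta> elim(2) this elim(3)] show ?case by simp
qed

text \<open>A fixed error, here \<open>\<delta>\<close> above and 1 on the grid below, suffices
  because it is divided by \<open>rate n\<close>.\<close>

lemma part1:
  "AE \<omega> in N. (\<forall>n\<ge>1. scaled_hull T Y n \<omega> \<in> convex_bodies) \<and>
     (\<lambda>n. hausdorff_distance (scaled_hull T Y n \<omega>) (limit_body M T X)) \<longlonglongrightarrow> 0"
proof -
  obtain \<delta> where \<delta>: "0 \<le> \<delta>" "AE \<omega> in N. \<forall>\<^sub>F n in sequentially. \<forall>i\<in>{1..n}. \<forall>t\<in>T. \<forall>u. Y i t \<omega> \<bullet> u \<le> p u * (rate n + \<delta>)"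
    using upper_bounded by blast
  from AE_paths_bounded \<delta>(2) lower_on_grid[OF zero_less_one] show ?thesis
  proof eventually_elim
    case (elim \<omega>)
    have "(\<lambda>n. (2 * q * \<delta> + 2 * 1) / rate n) \<longlonglongrightarrow> 0"
      by (rule tendsto_divide_0[OF tendsto_const filterlim_at_top_imp_at_infinity[OF rate_at_top]])
    then have "(\<lambda>n. hausdorff_distance (scaled_hull T Y n \<omega>) (limit_body M T X)) \<longlonglongrightarrow> 0"
      by (rule Lim_null_comparison[rotated]) (use hausdorff_eventually[OF elim(1,2) \<delta>(1) elim(3) zero_less_one] in simp)
    then show ?case using scaled_hull_convex_bodies[OF elim(1)] by blast
  qed
qed

text \<open>The errors run through the countable sequence \<open>\<eta> k\<close>, so one null set
  serves all of them; outside it \<open>k\<close> is chosen according to the constant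
  \<open>c\<close> of the little-o estimate.\<close>

lemma part2:
  assumes T: "compact T" and cont: "continuous_process M T X"
  shows "AE \<omega> in N. (\<lambda>n. hausdorff_distance (scaled_hull T Y n \<omega>) (limit_body M T X)) \<in> o(\<lambda>n. 1 / sqrt (ln (real n)))"
proof -
  define \<eta> where "\<eta> k = 1 / real (Suc k)" for k
  have \<eta>: "0 < \<eta> k" for k by (simp add: \<eta>_def)
  have "AE \<omega> in N. \<forall>k. \<forall>\<^sub>F n in sequentially. \<forall>i\<in>{1..n}. \<forall>t\<in>T. \<forall>u. Y i t \<omega> \<bullet> u \<le> p u * (rate n + \<eta> k)"
    unfolding AE_all_countable using upper_continuous[OF T cont \<eta>] by blast
  moreover have "AE \<omega> in N. \<forall>k. \<forall>\<^sub>F n in sequentially. \<forall>v\<in>grid n. \<exists>i\<in>{1..n}. \<exists>t\<in>T. p v * rate n - \<eta> k \<le> Y i t \<omega> \<bullet> v"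
    unfolding AE_all_countable using lower_on_grid[OF \<eta>] by blast
  ultimately show ?thesis
    using AE_paths_bounded
  proof eventually_elim
    case (elim \<omega>)
    show ?case
    proof (rule landau_o.smallI)
      fix c :: real assume c: "0 < c"
      have "0 < c / (2 * q + 2)" using c q(1) by simp
      from reals_Archimedean[OF this] obtain k where k: "\<eta> k < c / (2 * q + 2)" by (auto simp: \<eta>_def inverse_eq_divide)
      have le: "2 * q * \<eta> k + 2 * \<eta> k \<le> c"
        using k q(1) by (simp add: field_simps)
      have "\<forall>\<^sub>F n in sequentially. \<bar>hausdorff_distance (scaled_hull T Y n \<omega>) (limit_body M T X)\<bar> \<le> (2 * q * \<eta> k + 2 * \<eta> k) / rate n"
        using hausdorff_eventually[OF elim(3) spec[OF elim(1)] less_imp_le[OF \<eta>] spec[OF elim(2)] \<eta>] .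
      then show "\<forall>\<^sub>F n in sequentially. norm (hausdorff_distance (scaled_hull T Y n \<omega>) (limit_body M T X)) \<le> c * norm (1 / sqrt (ln (real n)))"
        using eventually_ge_at_top[of 2]
      proof eventually_elim
        case (elim n)
        have l: "0 < sqrt (ln (real n))" using elim(2) by simp
        have "sqrt (ln (real n)) \<le> rate n" unfolding rate_def using elim(2) by simp
        then have "(2 * q * \<eta> k + 2 * \<eta> k) / rate n \<le> c / sqrt (ln (real n))"
          using le l c by (intro frac_le) auto
        then show ?case using elim(1) l by simp
      qed
    qed
  qed
qed

end

theorem theorem1:
  fixes T :: "'t::metric_space set"
    and M :: "'w measure" and X :: "'t \<Rightarrow> 'w \<Rightarrow> real ^ 'd"
    and N :: "'v measure" and Y :: "nat \<Rightarrow> 't \<Rightarrow> 'v \<Rightarrow> real ^ 'd"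
  assumes T: "T \<noteq> {}" "separable_space (top_of_set T)"
    and prob: "prob_space M" "prob_space N"
    and X: "centered_gaussian_process M T X" "separable_process M T X" "bounded_process M T X"
    and copies: "iid_copies N T Y M X"
    and Y: "\<And>i. i \<ge> 1 \<Longrightarrow> separable_process N T (Y i)"
           "\<And>i. i \<ge> 1 \<Longrightarrow> bounded_process N T (Y i)"
  shows "(limit_body M T X \<in> convex_bodies \<and>
          (AE \<omega> in N. (\<forall>n\<ge>1. scaled_hull T Y n \<omega> \<in> convex_bodies) \<and>
             (\<lambda>n. hausdorff_distance (scaled_hull T Y n \<omega>) (limit_body M T X)) \<longlonglongrightarrow> 0))
       \<and> (compact T \<and> continuous_process M T X \<and> (\<forall>i\<ge>1. continuous_process N T (Y i)) \<longrightarrow>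
          (AE \<omega> in N. (\<lambda>n. hausdorff_distance (scaled_hull T Y n \<omega>) (limit_body M T X))
             \<in> o(\<lambda>n. 1 / sqrt (ln (real n)))))"
proof -
  interpret gaussian_copies T M X N Y
    by (rule gaussian_copies.intro[OF T(1) prob X copies Y])
  show ?thesis
    using limit_body_convex_bodies part1 part2 by (intro conjI impI) simp_all
qed

end
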